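(* The theory $\mathsf{KM}+\mathsf{CC}_{\mathsf{set}}$ is solid. That is, let $(\mathcal{M},\mathcal{A})$, $(\mathcal{N},\mathcal{B})$, and $(\mathcal{M}^{\ast},\mathcal{A}^{\ast})$ be models of $\mathsf{KM}+\mathsf{CC}_{\mathsf{set}}$ such that $$(\mathcal{M},\mathcal{A})\trianglerighteq_{\mathrm{par}}(\mathcal{N},\mathcal{B})\trianglerighteq_{\mathrm{par}}(\mathcal{M}^{\ast},\mathcal{A}^{\ast}),$$ and suppose there is an $(\mathcal{M},\mathcal{A})$-definable isomorphism $\widehat{i_0}:(\mathcal{M},\mathcal{A})\to(\mathcal{M}^{\ast},\mathcal{A}^{\ast})$. Then there is an $(\mathcal{N},\mathcal{B})$-definable isomorphism $\widehat{j}:(\mathcal{N},\mathcal{B})\to(\mathcal{M}^{\ast},\mathcal{A}^{\ast})$.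
   Context: **The theory KM.** $\mathsf{KM}$ (Kelley-Morse theory of classes) is formulated in the two-sorted first order language $\mathcal{L}_{\mathsf{KM}}$ with a sort for sets (lower case variables), a sort for classes (upper case variables), equality on each sort, membership $x\in y$ between sets, and membership $x\in X$ between sets and classes. The two sorts do not overlap. Its axioms are: extensionality for classes; the axioms of $\mathsf{ZF}$ for sets, with replacement stated for class functions (if the class $F$ is a function and $a$ is a set then $\{F(x):x\in a\}$ is a set); and the full comprehension scheme: for every $\mathcal{L}_{\mathsf{KM}}$-formula $\varphi(x)$, possibly with set and class parameters and with quantifiers over classes, there is a class $X$ with $\forall x\,(x\in X\leftrightarrow\varphi(x))$ ($X$ not free in $\varphi$). No form of the axiom of choice is included. Models of $\mathsf{KM}$ are represented as $(\mathcal{M},\mathcal{A})$, where $\mathcal{M}\models\mathsf{ZF}$ has universe $M$ and $\mathcal{A}$ is a collection of subsets of $M$. **The scheme $\mathsf{CC}_{\mathsf{set}}$.** It consists of the universal closures of all formulae $$[\forall x\in s\ \exists X\ \varphi(x,X)]\rightarrow[\exists Y\ \forall x\in s\ \varphi(x,(Y)_x)],$$ where $x,s$ range over sets, $X,Y$ over classes, $\varphi(x,X)$ is an $\mathcal{L}_{\mathsf{KM}}$-formula in which $Y$ does not occur free and which may have set or class parameters, and $(Y)_x=\{y:\langle x,y\rangle\in Y\}$, with $\langle x,y\rangle$ the Kuratowski ordered pair. **Definability and interpretations.** For a structure $\mathcal{S}$, "$\mathcal{S}$-definable" means first order definable in $\mathcal{S}$ with parameters from $\mathcal{S}$. For models $\mathcal{S},\mathcal{T}$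 of $\mathsf{KM}$, $\mathcal{S}\trianglerighteq_{\mathrm{par}}\mathcal{T}$ means that $\mathcal{T}$ is interpreted in $\mathcal{S}$ with parameters: each sort of $\mathcal{T}$ is given as $D/E$, where $D$ is an $\mathcal{S}$-definable set of elements of $\mathcal{S}$ (objects of either sort of $\mathcal{S}$ may occur in $D$, so sorts need not be preserved) and $E$ is an $\mathcal{S}$-definable equivalence relation on $D$ interpreting equality (it need not be the identity), and the membership relations of $\mathcal{T}$ are induced by $\mathcal{S}$-definable, $E$-invariant relations. In a chain $\mathcal{S}\trianglerighteq_{\mathrm{par}}\mathcal{T}\trianglerighteq_{\mathrm{par}}\mathcal{U}$, fix the two interpretations; $\mathcal{U}$ is also regarded as interpreted in $\mathcal{S}$ via their composition, and each structure as interpreted in itself via the identity interpretation. **Definable isomorphisms.** Let $\mathcal{S}$ interpret $\mathcal{T}_0$ and $\mathcal{T}_1$ with domains $\delta_0,\delta_1$ and equivalence relations $E_0,E_1$ (sort by sort). An $\mathcal{S}$-definable isomorphism between $\mathcal{T}_0$ and $\mathcal{T}_1$ is an $\mathcal{S}$-definable relation $R\subseteq\delta_0\times\delta_1$ such that (1) the domain and codomain (set of second coordinates) of $R$ are $\delta_0$ and $\delta_1$, respectively; (2) if $x_0Rx_1$, $y_0E_0x_0$ and $y_1E_1x_1$, then $y_0Ry_1$; (3) $F([x_0]_{E_0})=[x_1]_{E_1}\Leftrightarrow x_0Rx_1$ defines an isomorphism $F$ from $\mathcal{T}_0$ to $\mathcal{T}_1$. **Solidity.** A first order theory $T$ is solid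 if for all models $\mathcal{S},\mathcal{T},\mathcal{S}^{\ast}$ of $T$ with $\mathcal{S}\trianglerighteq_{\mathrm{par}}\mathcal{T}\trianglerighteq_{\mathrm{par}}\mathcal{S}^{\ast}$ such that there is an $\mathcal{S}$-definable isomorphism from $\mathcal{S}$ to $\mathcal{S}^{\ast}$, there is a $\mathcal{T}$-definable isomorphism from $\mathcal{T}$ to $\mathcal{S}^{\ast}$. *)

theory Defs
  imports Main
begin

section \<open>Two-sorted structures and first order formulas\<close>

datatype sort = SetS | ClsS

text \<open>
  \<open>mem S SetS x y\<close> is membership between sets, \<open>mem S ClsS x X\<close> is membership of a set in a class;
  only the values on the appropriate carriers are ever used.
\<close>

record 'a struct =
  car :: "sort \<Rightarrow> 'a set"
  mem :: "sort \<Rightarrow> 'a \<Rightarrow> 'a \<Rightarrow> bool"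

text \<open>
  Each sort has its own variables, indexed by natural numbers.  In \<open>Mem s i j\<close> the left variable is
  the set variable \<open>i\<close> and the right one is the variable \<open>j\<close> of sort \<open>s\<close>.
\<close>

datatype fm =
    Eq sort nat nat
  | Mem sort nat nat
  | Neg fm
  | Conj fm fm
  | All sort nat fm

type_synonym 'a asg = "sort \<Rightarrow> nat \<Rightarrow> 'a"

definition assignment :: "'a struct \<Rightarrow> 'a asg \<Rightarrow> bool" where
  "assignment S \<rho> \<longleftrightarrow> (\<forall>s i. \<rho> s i \<in> car S s)"

definition upd :: "'a asg \<Rightarrow> sort \<Rightarrow> nat \<Rightarrow> 'a \<Rightarrow> 'a asg" where
  "upd \<rho> s i x = \<rho>(s := (\<rho> s)(i := x))"

primrec sat :: "'a struct \<Rightarrow> 'a asg \<Rightarrow> fm \<Rightarrow> bool" where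
  "sat S \<rho> (Eq s i j) \<longleftrightarrow> \<rho> s i = \<rho> s j"
| "sat S \<rho> (Mem s i j) \<longleftrightarrow> mem S s (\<rho> SetS i) (\<rho> s j)"
| "sat S \<rho> (Neg \<phi>) \<longleftrightarrow> \<not> sat S \<rho> \<phi>"
| "sat S \<rho> (Conj \<phi> \<psi>) \<longleftrightarrow> sat S \<rho> \<phi> \<and> sat S \<rho> \<psi>"
| "sat S \<rho> (All s i \<phi>) \<longleftrightarrow> (\<forall>x\<in>car S s. sat S (upd \<rho> s i x) \<phi>)"

section \<open>Models of KM and of the scheme CC\<close>

definition upair :: "'a struct \<Rightarrow> 'a \<Rightarrow> 'a \<Rightarrow> 'a \<Rightarrow> bool" where
  "upair S u x y \<longleftrightarrow> u \<in> car S SetS \<and> (\<forall>z\<in>car S SetS. mem S SetS z u \<longleftrightarrow> z = x \<or> z = y)"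

text \<open>\<open>p\<close> is the Kuratowski pair \<open>{{x}, {x, y}}\<close> in the sense of \<open>S\<close>.\<close>

definition opair :: "'a struct \<Rightarrow> 'a \<Rightarrow> 'a \<Rightarrow> 'a \<Rightarrow> bool" where
  "opair S p x y \<longleftrightarrow> (\<exists>u v. upair S u x x \<and> upair S v x y \<and> upair S p u v)"

definition pair_in :: "'a struct \<Rightarrow> 'a \<Rightarrow> 'a \<Rightarrow> 'a \<Rightarrow> bool" where
  "pair_in S x y Y \<longleftrightarrow> (\<exists>p. opair S p x y \<and> mem S ClsS p Y)"

definition is_function :: "'a struct \<Rightarrow> 'a \<Rightarrow> bool" where
  "is_function S F \<longleftrightarrow>
     (\<forall>p\<in>car S SetS. mem S ClsS p F \<longrightarrow> (\<exists>x\<in>car S SetS. \<exists>y\<in>car S SetS. opair S p x y)) \<and>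
     (\<forall>x\<in>car S SetS. \<forall>y\<in>car S SetS. \<forall>z\<in>car S SetS.
        pair_in S x y F \<longrightarrow> pair_in S x z F \<longrightarrow> y = z)"

text \<open>\<open>Z\<close> is the class \<open>(Y)\<^sub>x = {y. \<langle>x, y\<rangle> \<in> Y}\<close>.\<close>

definition slice :: "'a struct \<Rightarrow> 'a \<Rightarrow> 'a \<Rightarrow> 'a \<Rightarrow> bool" where
  "slice S Y x Z \<longleftrightarrow> Z \<in> car S ClsS \<and> (\<forall>y\<in>car S SetS. mem S ClsS y Z \<longleftrightarrow> pair_in S x y Y)"

text \<open>
  The class \<open>F\<close> in \<open>replacement\<close> need not be defined on all of \<open>a\<close>, so that (with
  \<open>comprehension\<close>) this axiom contains the separation scheme.
  In the two schemes the parameters are the values under \<open>\<rho>\<close> of the remaining free variables of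
  \<open>\<phi>\<close>; the existentially quantified class is not assigned to any variable of \<open>\<phi>\<close>, so
  it cannot occur in it.
\<close>

locale KM =
  fixes S :: "'a struct"
  assumes sorts_nonempty: "car S s \<noteq> {}"
    and sorts_disjoint: "car S SetS \<inter> car S ClsS = {}"
    and class_extensionality:
      "\<lbrakk>X \<in> car S ClsS; Y \<in> car S ClsS; \<forall>z\<in>car S SetS. mem S ClsS z X \<longleftrightarrow> mem S ClsS z Y\<rbrakk> \<Longrightarrow> X = Y"
    and set_extensionality:
      "\<lbrakk>x \<in> car S SetS; y \<in> car S SetS; \<forall>z\<in>car S SetS. mem S SetS z x \<longleftrightarrow> mem S SetS z y\<rbrakk> \<Longrightarrow> x = y"
    and foundation:
      "\<lbrakk>x \<in> car S SetS; \<exists>y\<in>car S SetS. mem S SetS y x\<rbrakk> \<Longrightarrow>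
       \<exists>y\<in>car S SetS. mem S SetS y x \<and> \<not> (\<exists>z\<in>car S SetS. mem S SetS z y \<and> mem S SetS z x)"
    and pairing:
      "\<lbrakk>x \<in> car S SetS; y \<in> car S SetS\<rbrakk> \<Longrightarrow> \<exists>u\<in>car S SetS. upair S u x y"
    and union:
      "x \<in> car S SetS \<Longrightarrow>
       \<exists>u\<in>car S SetS. \<forall>z\<in>car S SetS.
         mem S SetS z u \<longleftrightarrow> (\<exists>y\<in>car S SetS. mem S SetS z y \<and> mem S SetS y x)"
    and power_set:
      "x \<in> car S SetS \<Longrightarrow>
       \<exists>u\<in>car S SetS. \<forall>z\<in>car S SetS.
         mem S SetS z u \<longleftrightarrow> (\<forall>y\<in>car S SetS. mem S SetS y z \<longrightarrow> mem S SetS y x)"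
    and infinity:
      "\<exists>w\<in>car S SetS.
         (\<exists>e\<in>car S SetS. mem S SetS e w \<and> (\<forall>z\<in>car S SetS. \<not> mem S SetS z e)) \<and>
         (\<forall>x\<in>car S SetS. mem S SetS x w \<longrightarrow>
            (\<exists>y\<in>car S SetS. mem S SetS y w \<and>
               (\<forall>z\<in>car S SetS. mem S SetS z y \<longleftrightarrow> mem S SetS z x \<or> z = x)))"
    and replacement:
      "\<lbrakk>F \<in> car S ClsS; is_function S F; a \<in> car S SetS\<rbrakk> \<Longrightarrow>
       \<exists>b\<in>car S SetS. \<forall>y\<in>car S SetS.
         mem S SetS y b \<longleftrightarrow> (\<exists>x\<in>car S SetS. mem S SetS x a \<and> pair_in S x y F)"
    and comprehension:
      "assignment S \<rho> \<Longrightarrow>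
       \<exists>X\<in>car S ClsS. \<forall>x\<in>car S SetS. mem S ClsS x X \<longleftrightarrow> sat S (upd \<rho> SetS 0 x) \<phi>"

locale KM_CC_set = KM +
  assumes CC_set:
    "\<lbrakk>assignment S \<rho>; s \<in> car S SetS;
      \<forall>x\<in>car S SetS. mem S SetS x s \<longrightarrow>
        (\<exists>X\<in>car S ClsS. sat S (upd (upd \<rho> SetS 0 x) ClsS 0 X) \<phi>)\<rbrakk> \<Longrightarrow>
     \<exists>Y\<in>car S ClsS. \<forall>x\<in>car S SetS. mem S SetS x s \<longrightarrow>
        (\<exists>Z. slice S Y x Z \<and> sat S (upd (upd \<rho> SetS 0 x) ClsS 0 Z) \<phi>)"

section \<open>Definability with parameters\<close>

text \<open>
  The elements of \<open>S\<close> are those of its two sorts taken together.  A set or binary relation of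
  elements is definable if its restriction to each sort, or pair of sorts, is defined by a formula
  of the two-sorted language.  The parameters are the values under \<open>\<rho>\<close>.
\<close>

definition elems :: "'a struct \<Rightarrow> 'a set" where
  "elems S = (\<Union>s. car S s)"

definition definable_set :: "'a struct \<Rightarrow> 'a set \<Rightarrow> bool" where
  "definable_set S A \<longleftrightarrow> A \<subseteq> elems S \<and>
     (\<forall>s. \<exists>\<phi> \<rho>. assignment S \<rho> \<and>
        (\<forall>x\<in>car S s. x \<in> A \<longleftrightarrow> sat S (upd \<rho> s 0 x) \<phi>))"

definition definable_rel :: "'a struct \<Rightarrow> ('a \<times> 'a) set \<Rightarrow> bool" where
  "definable_rel S R \<longleftrightarrow> R \<subseteq> elems S \<times> elems S \<and>
     (\<forall>s t. \<exists>\<phi> \<rho>. assignment S \<rho> \<and>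
        (\<forall>x\<in>car S s. \<forall>y\<in>car S t. (x, y) \<in> R \<longleftrightarrow> sat S (upd (upd \<rho> s 0 x) t 1 y) \<phi>))"

section \<open>Interpretations\<close>

text \<open>
  Domain, interpreted equality and interpreted membership for each sort of the interpreted
  structure.  The interpreted structure is the quotient; the map \<open>coord\<close> sends an element of the
  domain to the element of the interpreted structure that its equivalence class stands for.
\<close>

record ('d, 'b) interp =
  dmn :: "sort \<Rightarrow> 'd set"
  eqv :: "sort \<Rightarrow> ('d \<times> 'd) set"
  imem :: "sort \<Rightarrow> ('d \<times> 'd) set"
  coord :: "sort \<Rightarrow> 'd \<Rightarrow> 'b"

definition presents :: "('d, 'b) interp \<Rightarrow> 'b struct \<Rightarrow> bool" where
  "presents I T \<longleftrightarrow>
     (\<forall>s. equiv (dmn I s) (eqv I s)) \<and>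
     (\<forall>s. imem I s \<subseteq> dmn I SetS \<times> dmn I s) \<and>
     (\<forall>s x x' y y'. (x, x') \<in> eqv I SetS \<longrightarrow> (y, y') \<in> eqv I s \<longrightarrow>
        (x, y) \<in> imem I s \<longrightarrow> (x', y') \<in> imem I s) \<and>
     (\<forall>s. coord I s ` dmn I s = car T s) \<and>
     (\<forall>s. \<forall>x\<in>dmn I s. \<forall>y\<in>dmn I s. coord I s x = coord I s y \<longleftrightarrow> (x, y) \<in> eqv I s) \<and>
     (\<forall>s. \<forall>x\<in>dmn I SetS. \<forall>y\<in>dmn I s.
        mem T s (coord I SetS x) (coord I s y) \<longleftrightarrow> (x, y) \<in> imem I s)"

definition interprets :: "'a struct \<Rightarrow> ('a, 'b) interp \<Rightarrow> 'b struct \<Rightarrow> bool" where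
  "interprets S I T \<longleftrightarrow> presents I T \<and>
     (\<forall>s. definable_set S (dmn I s) \<and> definable_rel S (eqv I s) \<and> definable_rel S (imem I s))"

definition id_interp :: "'a struct \<Rightarrow> ('a, 'a) interp" where
  "id_interp S = \<lparr>
     dmn = car S,
     eqv = (\<lambda>s. Id_on (car S s)),
     imem = (\<lambda>s. {(x, y). x \<in> car S SetS \<and> y \<in> car S s \<and> mem S s x y}),
     coord = (\<lambda>s x. x)\<rparr>"

text \<open>
  Composition of \<open>I\<close> (of \<open>T\<close> in \<open>S\<close>) with \<open>J\<close> (of \<open>U\<close> in \<open>T\<close>).  A domain of \<open>J\<close> may contain sets and
  classes of \<open>T\<close>, and the domains \<open>dmn I SetS\<close> and \<open>dmn I ClsS\<close> may overlap, so that an element of \<open>S\<close>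
  may stand both for a set and for a class of \<open>T\<close>.  The tag \<open>t\<close> in \<open>(t, x)\<close> says that \<open>x\<close> is meant as an
  element of \<open>dmn I t\<close>.
\<close>

definition comp_dmn :: "('a, 'b) interp \<Rightarrow> ('b, 'c) interp \<Rightarrow> sort \<Rightarrow> (sort \<times> 'a) set" where
  "comp_dmn I J s = {(t, x). x \<in> dmn I t \<and> coord I t x \<in> dmn J s}"

definition comp_interp :: "('a, 'b) interp \<Rightarrow> ('b, 'c) interp \<Rightarrow> (sort \<times> 'a, 'c) interp" where
  "comp_interp I J = \<lparr>
     dmn = comp_dmn I J,
     eqv = (\<lambda>s. {(p, q). p \<in> comp_dmn I J s \<and> q \<in> comp_dmn I J s \<and>
       (coord I (fst p) (snd p), coord I (fst q) (snd q)) \<in> eqv J s}),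
     imem = (\<lambda>s. {(p, q). p \<in> comp_dmn I J SetS \<and> q \<in> comp_dmn I J s \<and>
       (coord I (fst p) (snd p), coord I (fst q) (snd q)) \<in> imem J s}),
     coord = (\<lambda>s p. coord J s (coord I (fst p) (snd p)))\<rparr>"

lemma presents_id: "presents (id_interp S) S"
  by (auto simp: presents_def id_interp_def equiv_def refl_on_def sym_def trans_def)

lemma presents_comp:
  assumes I: "presents I T" and J: "presents J U" and sub: "\<And>s. dmn J s \<subseteq> elems T"
  shows "presents (comp_interp I J) U"
proof -
  have cI: "coord I t ` dmn I t = car T t" for t
    using I by (auto simp: presents_def)
  have "coord (comp_interp I J) s ` dmn (comp_interp I J) s = coord J s ` dmn J s" for s
  proof
    show "coord J s ` dmn J s \<subseteq> coord (comp_interp I J) s ` dmn (comp_interp I J) s"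
    proof
      fix u assume "u \<in> coord J s ` dmn J s"
      then obtain y where y: "y \<in> dmn J s" "u = coord J s y" by blast
      then obtain t where "y \<in> car T t" using sub by (auto simp: elems_def)
      then obtain x where "x \<in> dmn I t" "y = coord I t x" using cI by blast
      with y have "(t, x) \<in> dmn (comp_interp I J) s" "u = coord (comp_interp I J) s (t, x)"
        by (auto simp: comp_interp_def comp_dmn_def)
      then show "u \<in> coord (comp_interp I J) s ` dmn (comp_interp I J) s" by blast
    qed
  qed (auto simp: comp_interp_def comp_dmn_def)
  moreover have "equiv (dmn (comp_interp I J) s) (eqv (comp_interp I J) s)" for s
  proof -
    have "equiv (dmn J s) (eqv J s)" using J by (auto simp: presents_def)
    then have *: "refl_on (dmn J s) (eqv J s)" "sym (eqv J s)" "trans (eqv J s)"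
      by (auto simp: equiv_def)
    show ?thesis
    proof (rule equivI)
      show "refl_on (dmn (comp_interp I J) s) (eqv (comp_interp I J) s)"
        using * by (auto simp: comp_interp_def comp_dmn_def refl_on_def)
      show "sym (eqv (comp_interp I J) s)"
        using * by (auto simp: comp_interp_def sym_def)
      show "trans (eqv (comp_interp I J) s)"
        using *(3) unfolding comp_interp_def trans_def by simp blast
    qed (auto simp: comp_interp_def)
  qed
  moreover have "(x', y') \<in> imem (comp_interp I J) s"
    if "(x, x') \<in> eqv (comp_interp I J) SetS" "(y, y') \<in> eqv (comp_interp I J) s"
      "(x, y) \<in> imem (comp_interp I J) s" for s x x' y y'
    using that J unfolding comp_interp_def presents_def by simp blast
  ultimately show ?thesis
    using J unfolding presents_def by (auto simp: comp_interp_def comp_dmn_def)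
qed

section \<open>Definable isomorphisms\<close>

definition struct_iso :: "'b struct \<Rightarrow> 'c struct \<Rightarrow> (sort \<Rightarrow> 'b \<Rightarrow> 'c) \<Rightarrow> bool" where
  "struct_iso T0 T1 F \<longleftrightarrow>
     (\<forall>s. bij_betw (F s) (car T0 s) (car T1 s)) \<and>
     (\<forall>s. \<forall>x\<in>car T0 SetS. \<forall>y\<in>car T0 s. mem T1 s (F SetS x) (F s y) \<longleftrightarrow> mem T0 s x y)"

definition iso_rel ::
  "('d, 'b) interp \<Rightarrow> 'b struct \<Rightarrow> ('e, 'c) interp \<Rightarrow> 'c struct \<Rightarrow> (sort \<Rightarrow> ('d \<times> 'e) set) \<Rightarrow> bool" where
  "iso_rel I0 T0 I1 T1 R \<longleftrightarrow>
     (\<forall>s. Domain (R s) = dmn I0 s \<and> Range (R s) = dmn I1 s) \<and>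
     (\<forall>s x0 x1 y0 y1. (x0, x1) \<in> R s \<longrightarrow> (y0, x0) \<in> eqv I0 s \<longrightarrow> (y1, x1) \<in> eqv I1 s \<longrightarrow>
        (y0, y1) \<in> R s) \<and>
     (\<exists>F. struct_iso T0 T1 F \<and>
        (\<forall>s. \<forall>x0\<in>dmn I0 s. \<forall>x1\<in>dmn I1 s.
           F s (coord I0 s x0) = coord I1 s x1 \<longleftrightarrow> (x0, x1) \<in> R s))"

definition definable_iso ::
  "'a struct \<Rightarrow> ('a, 'b) interp \<Rightarrow> 'b struct \<Rightarrow> ('a, 'c) interp \<Rightarrow> 'c struct \<Rightarrow>
   (sort \<Rightarrow> ('a \<times> 'a) set) \<Rightarrow> bool" where
  "definable_iso S I0 T0 I1 T1 R \<longleftrightarrow>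
     iso_rel I0 T0 I1 T1 R \<and> (\<forall>s. definable_rel S (R s))"

text \<open>The same when \<open>T1\<close> is presented by a composition, one defining formula for each tag.\<close>

definition definable_iso_comp ::
  "'a struct \<Rightarrow> ('a, 'b) interp \<Rightarrow> 'b struct \<Rightarrow> (sort \<times> 'a, 'c) interp \<Rightarrow> 'c struct \<Rightarrow>
   (sort \<Rightarrow> ('a \<times> (sort \<times> 'a)) set) \<Rightarrow> bool" where
  "definable_iso_comp S I0 T0 I1 T1 R \<longleftrightarrow>
     iso_rel I0 T0 I1 T1 R \<and> (\<forall>s t. definable_rel S {(x, y). (x, (t, y)) \<in> R s})"

end

theory Submission
  imports Defs
begin

text \<open>
  Write \<open>M\<close>, \<open>N\<close>, \<open>K\<close> for the three models and \<open>F\<close> for the given isomorphism from \<open>M\<close> to \<open>K\<close>.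
  An \<open>N\<close>-definable collection of sets of \<open>K\<close> is \<open>M\<close>-definable, so by \<open>F\<close> and comprehension in \<open>M\<close> it
  is a class of \<open>K\<close>; hence \<open>K\<close> satisfies foundation, separation and replacement for \<open>N\<close>-definable
  predicates.  Working in \<open>N\<close>, collapse sets of \<open>N\<close> onto sets of \<open>K\<close> by membership recursion.  An
  approximation to the collapse is coded by classes of \<open>N\<close>, because sets of \<open>K\<close> may be represented by
  classes of \<open>N\<close>; the scheme CC is needed to choose representatives when approximations are extended.
  The resulting partial isomorphism is total on one of the two sides, and where it is not total its
  domain or range is a set.

  If the range is a set of \<open>K\<close>, then the sets and classes of \<open>N\<close> are coded by the elements of a set of
  \<open>K\<close>, while representing all sets of \<open>K\<close>, against Cantor's theorem.  If the domain is a set of \<open>N\<close>,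
  then \<open>K\<close>, and so \<open>M\<close>, is coded by the elements of a set of \<open>N\<close>; all \<open>M\<close>-definable collections are
  \<open>K\<close>-definable along \<open>F\<close>, hence \<open>N\<close>-definable, so that their sets of codes belong to \<open>N\<close> and are
  represented in \<open>M\<close>, again against Cantor's theorem.  Therefore the collapse is an isomorphism on
  sets, and it extends to classes by comprehension on both sides.
\<close>

section \<open>Definable predicates\<close>

text \<open>
  Definability with parameters is handled through predicates on environments.  An environment lists
  elements of either sort, and a quantifier binds position \<open>0\<close> and shifts the other positions.
\<close>

definition env :: "'a struct \<Rightarrow> (nat \<Rightarrow> 'a) \<Rightarrow> bool" where
  "env S e \<longleftrightarrow> (\<forall>i. e i \<in> elems S)"

text \<open>Definability is generated by closure rules on predicates instead of syntax, so that a
  concrete predicate is shown definable by following its logical structure. The membership atom is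
  guarded by the carriers because \<open>mem\<close> is meaningful only there, and
  \<open>dfn_cong\<close> disregards environments with values outside \<open>S\<close>.\<close>

inductive dfn :: "'a struct \<Rightarrow> ((nat \<Rightarrow> 'a) \<Rightarrow> bool) \<Rightarrow> bool" for S where
  dfn_var_eq: "dfn S (\<lambda>e. e i = e j)"
| dfn_var_mem: "dfn S (\<lambda>e. e i \<in> car S SetS \<and> e j \<in> car S s \<and> mem S s (e i) (e j))"
| dfn_var_car: "dfn S (\<lambda>e. e i \<in> car S s)"
| dfn_not: "dfn S P \<Longrightarrow> dfn S (\<lambda>e. \<not> P e)"
| dfn_conj: "dfn S P \<Longrightarrow> dfn S Q \<Longrightarrow> dfn S (\<lambda>e. P e \<and> Q e)"
| dfn_all: "dfn S P \<Longrightarrow> dfn S (\<lambda>e. \<forall>x\<in>elems S. P (case_nat x e))"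
| dfn_par: "a \<in> elems S \<Longrightarrow> dfn S P \<Longrightarrow> dfn S (\<lambda>e. P (case_nat a e))"
| dfn_cong: "dfn S P \<Longrightarrow> (\<And>e. env S e \<Longrightarrow> P e = Q e) \<Longrightarrow> dfn S Q"

lemma env_case_nat [simp]: "env S (case_nat x e) \<longleftrightarrow> x \<in> elems S \<and> env S e"
proof
  assume *: "env S (case_nat x e)"
  from *[unfolded env_def, rule_format, of 0] *[unfolded env_def, rule_format, of "Suc i" for i]
  show "x \<in> elems S \<and> env S e" by (simp add: env_def)
qed (auto simp: env_def split: nat.splits)

lemma env_ren: "env S e \<Longrightarrow> env S (\<lambda>i. e (r i))"
  by (simp add: env_def)

lemma envD: "env S e \<Longrightarrow> e i \<in> elems S"
  by (simp add: env_def)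

lemma case_nat_ren: "case_nat x (\<lambda>i. e (r i)) = (\<lambda>i. case_nat x e (case_nat 0 (\<lambda>j. Suc (r j)) i))"
  by (auto split: nat.splits)

text \<open>The renaming may identify variables. Under a binder it is extended by fixing position 0,
  which is why the induction is over all \<open>r\<close>.\<close>

lemma dfn_ren:
  assumes "dfn S P" shows "dfn S (\<lambda>e. P (\<lambda>i. e (r i)))"
  using assms
proof (induction arbitrary: r)
  case (dfn_all P)
  show ?case
    using dfn.dfn_all[OF dfn_all.IH[of "case_nat 0 (\<lambda>j. Suc (r j))"]] by (simp only: case_nat_ren[symmetric])
next
  case (dfn_par a P)
  show ?case
    using dfn.dfn_par[OF dfn_par.hyps(1) dfn_par.IH[of "case_nat 0 (\<lambda>j. Suc (r j))"]]
    by (simp only: case_nat_ren[symmetric])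
next
  case (dfn_cong P Q)
  show ?case by (rule dfn.dfn_cong[OF dfn_cong.IH dfn_cong.hyps(2)[OF env_ren]])
next
  case (dfn_var_eq i j)
  show ?case by (rule dfn.dfn_var_eq)
next
  case (dfn_var_mem i j s)
  show ?case by (rule dfn.dfn_var_mem)
next
  case (dfn_var_car i s)
  show ?case by (rule dfn.dfn_var_car)
next
  case (dfn_not P)
  show ?case by (rule dfn.dfn_not[OF dfn_not.IH])
next
  case (dfn_conj P Q)
  show ?case by (rule dfn.dfn_conj[OF dfn_conj.IH])
qed

definition supported :: "'a struct \<Rightarrow> nat \<Rightarrow> ((nat \<Rightarrow> 'a) \<Rightarrow> bool) \<Rightarrow> bool" where
  "supported S n P \<longleftrightarrow> (\<forall>e e'. env S e \<longrightarrow> env S e' \<longrightarrow> (\<forall>i<n. e i = e' i) \<longrightarrow> P e = P e')"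

lemma supportedD: "supported S n P \<Longrightarrow> env S e \<Longrightarrow> env S e' \<Longrightarrow> (\<And>i. i < n \<Longrightarrow> e i = e' i) \<Longrightarrow> P e = P e'"
  unfolding supported_def by blast

lemma supported_mono: "supported S n P \<Longrightarrow> n \<le> m \<Longrightarrow> supported S m P"
  unfolding supported_def by (meson order_less_le_trans)

text \<open>An environment has infinitely many positions; finite support supplies a fresh variable
  when a quantifier is translated into a formula.\<close>

lemma dfn_support:
  assumes "dfn S P" shows "\<exists>n. supported S n P"
  using assms
proof induction
  case (dfn_var_eq i j)
  show ?case by (rule exI[of _ "Suc (max i j)"]) (simp add: supported_def)
next
  case (dfn_var_mem i j s)
  show ?case by (rule exI[of _ "Suc (max i j)"]) (simp add: supported_def)
next
  case (dfn_var_car i s)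
  show ?case by (rule exI[of _ "Suc i"]) (simp add: supported_def)
next
  case (dfn_not P)
  then show ?case by (simp add: supported_def)
next
  case (dfn_conj P Q)
  then obtain n m where "supported S n P" "supported S m Q" by blast
  then have "supported S (max n m) P" "supported S (max n m) Q" 
    by (meson max.cobounded1 max.cobounded2 supported_mono)+
  then have "supported S (max n m) (\<lambda>e. P e \<and> Q e)"
    unfolding supported_def by blast
  then show ?case ..
next
  case (dfn_all P)
  then obtain n where n: "supported S n P" by blast
  have "supported S n (\<lambda>e. \<forall>x\<in>elems S. P (case_nat x e))"
    unfolding supported_def
  proof (intro allI impI ball_cong refl)
    fix e e' x assume "env S e" "env S e'" "\<forall>i<n. e i = e' i" "x \<in> elems S"
    then show "P (case_nat x e) = P (case_nat x e')"
      by (intro supportedD[OF n]) (auto split: nat.splits)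
  qed
  then show ?case ..
next
  case (dfn_par a P)
  then obtain n where n: "supported S n P" by blast
  have "supported S n (\<lambda>e. P (case_nat a e))"
    unfolding supported_def
  proof (intro allI impI)
    fix e e' assume "env S e" "env S e'" "\<forall>i<n. e i = e' i"
    then show "P (case_nat a e) = P (case_nat a e')"
      using dfn_par.hyps(1) by (intro supportedD[OF n]) (auto split: nat.splits)
  qed
  then show ?case ..
next
  case (dfn_cong P Q)
  then obtain n where "supported S n P" by blast
  then have "supported S n Q"
    using dfn_cong.hyps(2) unfolding supported_def by blast
  then show ?case ..
qed

lemma dfn_const: "dfn S (\<lambda>e. B)"
proof -
  have T: "dfn S (\<lambda>e. True)" by (rule dfn_cong[OF dfn_var_eq[of S 0 0]]) simp
  have F: "dfn S (\<lambda>e. False)" by (rule dfn_cong[OF dfn_not[OF T]]) simp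
  from T F show ?thesis by (cases B) auto
qed

lemma dfn_disj: assumes "dfn S P" "dfn S Q" shows "dfn S (\<lambda>e. P e \<or> Q e)"
  by (rule dfn_cong[OF dfn_not[OF dfn_conj[OF assms[THEN dfn_not]]]]) auto

lemma dfn_imp: assumes "dfn S P" "dfn S Q" shows "dfn S (\<lambda>e. P e \<longrightarrow> Q e)"
  by (rule dfn_cong[OF dfn_disj[OF dfn_not[OF assms(1)] assms(2)]]) auto

lemma dfn_iff: assumes "dfn S P" "dfn S Q" shows "dfn S (\<lambda>e. P e \<longleftrightarrow> Q e)"
  by (rule dfn_cong[OF dfn_conj[OF dfn_imp[OF assms] dfn_imp[OF assms(2,1)]]]) auto

lemma dfn_ball_elems:
  assumes "dfn S (\<lambda>e. Q (\<lambda>i. e (Suc i)) (e 0))" shows "dfn S (\<lambda>e. \<forall>x\<in>elems S. Q e x)"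
  by (rule dfn_cong[OF dfn_all[OF assms]]) simp

lemma dfn_bex_elems:
  assumes "dfn S (\<lambda>e. Q (\<lambda>i. e (Suc i)) (e 0))" shows "dfn S (\<lambda>e. \<exists>x\<in>elems S. Q e x)"
  by (rule dfn_cong[OF dfn_not[OF dfn_ball_elems[where Q = "\<lambda>e x. \<not> Q e x", OF dfn_not[OF assms]]]])
    simp

lemma dfn_all_sort:
  assumes "\<And>s. dfn S (Q s)" shows "dfn S (\<lambda>e. \<forall>s::sort. Q s e)"
proof (rule dfn_cong[OF dfn_conj[OF assms[of SetS] assms[of ClsS]]])
  show "(Q SetS e \<and> Q ClsS e) = (\<forall>s. Q s e)" for e by (metis (full_types) sort.exhaust)
qed

lemma dfn_ex_sort:
  assumes "\<And>s. dfn S (Q s)" shows "dfn S (\<lambda>e. \<exists>s::sort. Q s e)"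
  by (rule dfn_cong[OF dfn_not[OF dfn_all_sort[where Q = "\<lambda>s e. \<not> Q s e", OF dfn_not[OF assms]]]])
    simp

lemma dfn_par1:
  assumes "a \<in> elems S" "dfn S (\<lambda>e. Q (\<lambda>i. e (Suc i)) (e 0))" shows "dfn S (\<lambda>e. Q e a)"
  by (rule dfn_cong[OF dfn_par[OF assms]]) simp

lemmas dfn_logic = dfn_const dfn_not dfn_conj dfn_disj dfn_imp dfn_iff dfn_all_sort dfn_ex_sort

section \<open>Terms and substitution\<close>

text \<open>
  A map \<open>c\<close> lets elements of \<open>S\<close> stand for objects of another type.  The terms are the functions
  with values in the range of \<open>c\<close> whose graph, read through \<open>c\<close>, is definable.
\<close>

definition trm :: "'a struct \<Rightarrow> ('a \<Rightarrow> 'x) \<Rightarrow> ((nat \<Rightarrow> 'a) \<Rightarrow> 'x) \<Rightarrow> bool" where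
  "trm S c t \<longleftrightarrow> (\<forall>e. env S e \<longrightarrow> t e \<in> c ` elems S) \<and> dfn S (\<lambda>e. c (e 0) = t (\<lambda>i. e (Suc i)))"

definition cov :: "'a struct \<Rightarrow> ('a \<Rightarrow> 'x) \<Rightarrow> bool" where
  "cov S c \<longleftrightarrow> dfn S (\<lambda>e. c (e 0) = c (e 1))"

lemma cov_id: "cov S (\<lambda>x. x)"
  by (simp add: cov_def dfn_var_eq)

lemma dfn_ren2:
  assumes "dfn S (\<lambda>e. p (e 0) (e 1))" shows "dfn S (\<lambda>e. p (e i) (e j))"
  using dfn_ren[OF assms, of "\<lambda>k. if k = 0 then i else j"] by simp

lemma dfn_ren1:
  assumes "dfn S (\<lambda>e. p (e 0))" shows "dfn S (\<lambda>e. p (e i))"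
  using dfn_ren[OF assms, of "\<lambda>k. i"] by simp

lemma trm_var: assumes "cov S c" shows "trm S c (\<lambda>e. c (e k))"
  using dfn_ren2[OF assms[unfolded cov_def], of 0 "Suc k"]
  by (simp add: trm_def envD)

lemma trm_id_var: "trm S (\<lambda>x. x) (\<lambda>e. e k)"
  by (rule trm_var[OF cov_id])

lemma trm_const: assumes "cov S c" "x \<in> c ` elems S" shows "trm S c (\<lambda>e. x)"
proof -
  from assms(2) obtain y where y: "y \<in> elems S" "x = c y" by blast
  have "dfn S (\<lambda>e. c (e 0) = c y)"
    by (rule dfn_par1[OF y(1)]) (rule dfn_ren2[OF assms(1)[unfolded cov_def]])
  then show ?thesis using y by (auto simp: trm_def)
qed

lemma trm_ren: assumes "trm S c t" shows "trm S c (\<lambda>e. t (\<lambda>i. e (r i)))"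
proof -
  have "dfn S (\<lambda>e. c (e 0) = t (\<lambda>i. e (Suc i)))" using assms by (simp add: trm_def)
  from dfn_ren[OF this, of "case_nat 0 (\<lambda>j. Suc (r j))"]
  show ?thesis using assms by (simp add: trm_def env_ren)
qed

text \<open>The value \<open>t e\<close> is named by a quantified element \<open>x\<close> with
  \<open>c x = t e\<close>; one exists because the values of a term lie in the range of
  \<open>c\<close>.\<close>

lemma dfn_trm:
  assumes "dfn S (\<lambda>e. Q (\<lambda>i. e (Suc i)) (c (e 0)))" "trm S c t"
  shows "dfn S (\<lambda>e. Q e (t e))"
proof -
  have t: "dfn S (\<lambda>e. c (e 0) = t (\<lambda>i. e (Suc i)))" using assms by (simp add: trm_def)
  show ?thesis
  proof (rule dfn_cong[OF dfn_bex_elems[where Q = "\<lambda>e x. c x = t e \<and> Q e (c x)", OF dfn_conj[OF t assms(1)]]])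
    fix e assume "env S e"
    then have "t e \<in> c ` elems S" using assms(2) by (simp add: trm_def)
    then show "(\<exists>x\<in>elems S. c x = t e \<and> Q e (c x)) = Q e (t e)" by auto
  qed
qed

lemma dfn_comp1:
  assumes "dfn S (\<lambda>e. p (c (e 0)))" "trm S c t" shows "dfn S (\<lambda>e. p (t e))"
  by (rule dfn_trm[where Q = "\<lambda>_. p", OF assms])

lemma dfn_comp2:
  assumes p: "dfn S (\<lambda>e. p (c (e 0)) (c' (e 1)))" and t: "trm S c t" and u: "trm S c' u"
  shows "dfn S (\<lambda>e. p (t e) (u e))"
proof (rule dfn_trm[where Q = "\<lambda>e x. p x (u e)", OF _ t])
  show "dfn S (\<lambda>e. p (c (e 0)) (u (\<lambda>i. e (Suc i))))"
    by (rule dfn_trm[where Q = "\<lambda>e. p (c (e 0))", OF _ trm_ren[OF u]])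
      (rule dfn_ren2[where p = "\<lambda>x y. p (c x) (c' y)", OF p])
qed

lemma dfn_ren3:
  assumes "dfn S (\<lambda>e. p (e 0) (e 1) (e 2))" shows "dfn S (\<lambda>e. p (e i) (e j) (e k))"
  using dfn_ren[OF assms, of "\<lambda>l. if l = 0 then i else if l = 1 then j else k"] by simp

lemma dfn_comp3:
  assumes p: "dfn S (\<lambda>e. p (c (e 0)) (c' (e 1)) (c'' (e 2)))"
    and t: "trm S c t" and u: "trm S c' u" and v: "trm S c'' v"
  shows "dfn S (\<lambda>e. p (t e) (u e) (v e))"
proof (rule dfn_trm[where Q = "\<lambda>e x. p x (u e) (v e)", OF _ t])
  show "dfn S (\<lambda>e. p (c (e 0)) (u (\<lambda>i. e (Suc i))) (v (\<lambda>i. e (Suc i))))"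
  proof (rule dfn_trm[where Q = "\<lambda>e y. p (c (e 0)) y (v (\<lambda>i. e (Suc i)))", OF _ trm_ren[OF u]])
    show "dfn S (\<lambda>e. p (c (e (Suc 0))) (c' (e 0)) (v (\<lambda>i. e (Suc (Suc i)))))"
      by (rule dfn_trm[where Q = "\<lambda>e. p (c (e (Suc 0))) (c' (e 0))", OF _ trm_ren[OF v]])
        (rule dfn_ren3[where p = "\<lambda>x y z. p (c x) (c' y) (c'' z)", OF p])
  qed
qed

lemma dfn_ren4:
  assumes "dfn S (\<lambda>e. p (e 0) (e 1) (e 2) (e 3))" shows "dfn S (\<lambda>e. p (e i) (e j) (e k) (e l))"
  using dfn_ren[OF assms, of "\<lambda>m. if m = 0 then i else if m = 1 then j else if m = 2 then k else l"]
  by simp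

lemma dfn_comp4:
  assumes p: "dfn S (\<lambda>e. p (c (e 0)) (c' (e 1)) (c'' (e 2)) (d (e 3)))"
    and t: "trm S c t" and u: "trm S c' u" and v: "trm S c'' v" and w: "trm S d w"
  shows "dfn S (\<lambda>e. p (t e) (u e) (v e) (w e))"
proof (rule dfn_trm[where Q = "\<lambda>e x. p x (u e) (v e) (w e)", OF _ t])
  let ?s = "\<lambda>e i. e (Suc i)"
  show "dfn S (\<lambda>e. p (c (e 0)) (u (?s e)) (v (?s e)) (w (?s e)))"
  proof (rule dfn_trm[where Q = "\<lambda>e y. p (c (e 0)) y (v (?s e)) (w (?s e))", OF _ trm_ren[OF u]])
    show "dfn S (\<lambda>e. p (c (e (Suc 0))) (c' (e 0)) (v (\<lambda>i. e (Suc (Suc i)))) (w (\<lambda>i. e (Suc (Suc i)))))"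
    proof (rule dfn_trm[where Q = "\<lambda>e y. p (c (e (Suc 0))) (c' (e 0)) y (w (\<lambda>i. e (Suc (Suc i))))",
          OF _ trm_ren[OF v]])
      show "dfn S (\<lambda>e. p (c (e (Suc (Suc 0)))) (c' (e (Suc 0))) (c'' (e 0)) (w (\<lambda>i. e (Suc (Suc (Suc i))))))"
        by (rule dfn_trm[where Q = "\<lambda>e. p (c (e (Suc (Suc 0)))) (c' (e (Suc 0))) (c'' (e 0))", OF _ trm_ren[OF w]])
          (rule dfn_ren4[where p = "\<lambda>x y z w. p (c x) (c' y) (c'' z) (d w)", OF p])
    qed
  qed
qed

lemma dfn_ball:
  assumes "c ` elems S = X" "dfn S (\<lambda>e. Q (\<lambda>i. e (Suc i)) (c (e 0)))"
  shows "dfn S (\<lambda>e. \<forall>x\<in>X. Q e x)"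
  unfolding assms(1)[symmetric] ball_simps
  by (rule dfn_ball_elems[where Q = "\<lambda>e x. Q e (c x)", OF assms(2)])

lemma dfn_bex:
  assumes "c ` elems S = X" "dfn S (\<lambda>e. Q (\<lambda>i. e (Suc i)) (c (e 0)))"
  shows "dfn S (\<lambda>e. \<exists>x\<in>X. Q e x)"
  unfolding assms(1)[symmetric] bex_simps
  by (rule dfn_bex_elems[where Q = "\<lambda>e x. Q e (c x)", OF assms(2)])

lemma dfn_eq:
  assumes "cov S c" "trm S c t" "trm S c u" shows "dfn S (\<lambda>e. t e = u e)"
  by (rule dfn_comp2[OF assms[unfolded cov_def]])

lemma dfn_car: "trm S (\<lambda>x. x) t \<Longrightarrow> dfn S (\<lambda>e. t e \<in> car S s)"
  by (rule dfn_comp1[where c = "\<lambda>x. x" and p = "\<lambda>x. x \<in> car S s", OF dfn_var_car])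

lemma trm_comp:
  assumes "cov S d" "trm S (\<lambda>x. x) t" shows "trm S d (\<lambda>e. d (t e))"
proof -
  have "dfn S (\<lambda>e. d (e 0) = d (t (\<lambda>i. e (Suc i))))"
    by (rule dfn_comp2[where p = "\<lambda>x y. d x = d y" and c = "\<lambda>x. x" and c' = "\<lambda>x. x"])
      (use assms trm_id_var trm_ren in \<open>auto simp: cov_def\<close>)
  then show ?thesis using assms(2) by (auto simp: trm_def)
qed

text \<open>An interpretation whose coordinate maps are total: every element of \<open>S\<close>
  codes an element of each sort of \<open>T\<close>. Quantifiers over \<open>T\<close> then become
  quantifiers over all of \<open>S\<close>, without relativization to a domain, and one element may
  code both a set and a class.\<close>

locale cover =
  fixes S :: "'b struct" and T :: "'x struct" and c :: "sort \<Rightarrow> 'b \<Rightarrow> 'x"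
  assumes img: "c s ` elems S = car T s"
    and c_cov: "cov S (c s)"
    and c_mem: "dfn S (\<lambda>e. mem T s (c SetS (e 0)) (c s (e 1)))"
    and disj: "car T SetS \<inter> car T ClsS = {}"
begin

lemma c_in: "x \<in> elems S \<Longrightarrow> c s x \<in> car T s"
  using img by blast

lemma c_in_iff: "x \<in> elems S \<Longrightarrow> c s x \<in> car T s' \<longleftrightarrow> s = s'"
  using disj c_in[of x s] by (cases s; cases s') auto

lemmas ball = dfn_ball[OF img]
lemmas bex = dfn_bex[OF img]
lemmas var = trm_var[OF c_cov]
lemmas eq = dfn_eq[OF c_cov]
lemmas memb = dfn_comp2[where p = "mem T s" for s, OF c_mem]

lemma const: "x \<in> car T s \<Longrightarrow> trm S (c s) (\<lambda>e. x)"
  using img by (intro trm_const[OF c_cov]) auto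

lemma ex_code: "x \<in> car T s \<Longrightarrow> \<exists>y\<in>elems S. c s y = x"
  unfolding img[symmetric] by blast

lemmas rules = dfn_logic ball bex var eq[of SetS] memb dfn_ball_elems dfn_bex_elems

text \<open>The composition of interpretations, on the level of definable predicates.\<close>

lemma pull:
  assumes "dfn T P"
  shows "dfn S (\<lambda>e. P (\<lambda>i. c (\<tau> i) (e i)))"
  using assms
proof (induction arbitrary: \<tau>)
  case (dfn_var_eq i j)
  show ?case
  proof (cases "\<tau> i = \<tau> j")
    case True
    then show ?thesis using eq[OF var[of "\<tau> j"] var[of "\<tau> j"]] by simp
  next
    case False
    have "c (\<tau> i) (e i) \<noteq> c (\<tau> j) (e j)" if "env S e" for e
      using False c_in_iff[OF envD[OF that], of "\<tau> i" i "\<tau> j"] c_in[OF envD[OF that], of "\<tau> j" j]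
      by auto
    then show ?thesis by (intro dfn_cong[OF dfn_const[of S False]]) simp
  qed
next
  case (dfn_var_car i s)
  have "c (\<tau> i) (e i) \<in> car T s \<longleftrightarrow> \<tau> i = s" if "env S e" for e
    by (rule c_in_iff[OF envD[OF that]])
  then show ?case by (intro dfn_cong[OF dfn_const[of S "\<tau> i = s"]]) simp
next
  case (dfn_var_mem i j s)
  have *: "c (\<tau> i) (e i) \<in> car T s \<longleftrightarrow> \<tau> i = s" if "env S e" for e i s
    by (rule c_in_iff[OF envD[OF that]])
  have "dfn S (\<lambda>e. mem T s (c SetS (e i)) (c s (e j)))" by (rule memb[OF var var])
  then have "dfn S (\<lambda>e. (\<tau> i = SetS \<and> \<tau> j = s) \<and> mem T s (c SetS (e i)) (c s (e j)))"
    by (intro dfn_conj dfn_const)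
  then show ?case by (rule dfn_cong) (auto simp: *)
next
  case (dfn_all P)
  \<comment> \<open>Every element of \<open>T\<close> has a sort and a code, so the quantifier
    becomes one quantifier over codes for each sort; \<open>\<tau>\<close> is extended by the sort
    at which the bound code is read.\<close>
  have "dfn S (\<lambda>e. \<forall>s. \<forall>x\<in>elems S. P (case_nat (c s x) (\<lambda>i. c (\<tau> i) (e i))))"
  proof (intro dfn_all_sort dfn_ball_elems)
    fix s
    show "dfn S (\<lambda>e. P (case_nat (c s (e 0)) (\<lambda>i. c (\<tau> i) (e (Suc i)))))"
      by (rule dfn_cong[OF dfn_all.IH[of "case_nat s \<tau>"]]) (auto intro!: arg_cong[of _ _ P] split: nat.splits)
  qed
  then show ?case
  proof (rule dfn_cong)
    show "(\<forall>s. \<forall>x\<in>elems S. P (case_nat (c s x) (\<lambda>i. c (\<tau> i) (e i)))) =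
      (\<forall>x\<in>elems T. P (case_nat x (\<lambda>i. c (\<tau> i) (e i))))" for e
      unfolding elems_def[of T] img[symmetric] by auto
  qed
next
  case (dfn_par a P)
  then obtain s where "a \<in> car T s" by (auto simp: elems_def)
  then obtain y where y: "y \<in> elems S" "c s y = a" using ex_code by blast
  show ?case
    by (rule dfn.dfn_cong[OF dfn.dfn_par[OF y(1) dfn_par.IH[of "case_nat s \<tau>"]]])
      (auto intro!: arg_cong[of _ _ P] simp: y(2) split: nat.splits)
next
  case (dfn_cong P Q)
  show ?case
  proof (rule dfn.dfn_cong[OF dfn_cong.IH dfn_cong.hyps(2)])
    fix e assume "env S e"
    then show "env T (\<lambda>i. c (\<tau> i) (e i))" using c_in by (auto simp: env_def elems_def[of T])
  qed
next
  case (dfn_not P)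
  show ?case by (rule dfn.dfn_not[OF dfn_not.IH])
next
  case (dfn_conj P Q)
  show ?case by (rule dfn.dfn_conj[OF dfn_conj.IH])
qed

lemma ex_code_elems: "x \<in> elems T \<Longrightarrow> \<exists>s. \<exists>y\<in>elems S. c s y = x"
  unfolding elems_def[of T] using ex_code by blast

end

section \<open>Definability by formulas\<close>

text \<open>An element outside a nonempty domain is replaced by one fixed element of it, which makes
  the coordinate map total without changing its range.\<close>

definition rep :: "('a, 'b) interp \<Rightarrow> sort \<Rightarrow> 'a \<Rightarrow> 'a" where
  "rep I s x = (if x \<in> dmn I s then x else (SOME d. d \<in> dmn I s))"

definition tot :: "('a, 'b) interp \<Rightarrow> sort \<Rightarrow> 'a \<Rightarrow> 'b" where
  "tot I s x = coord I s (rep I s x)"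

lemma cover_tot:
  assumes I: "presents I T" and disj: "car T SetS \<inter> car T ClsS = {}"
    and ne: "\<And>s. car T s \<noteq> {}" and sub: "\<And>s. dmn I s \<subseteq> elems S"
    and dmn: "\<And>s. dfn S (\<lambda>e. e 0 \<in> dmn I s)"
    and eqv: "\<And>s. dfn S (\<lambda>e. (e 0, e 1) \<in> eqv I s)"
    and imem: "\<And>s. dfn S (\<lambda>e. (e 0, e 1) \<in> imem I s)"
  shows "cover S T (tot I)"
proof -
  have cI: "coord I s ` dmn I s = car T s" for s
    using I by (auto simp: presents_def)
  have eqvI: "coord I s x = coord I s y \<longleftrightarrow> (x, y) \<in> eqv I s" if "x \<in> dmn I s" "y \<in> dmn I s" for s x y
    using I that by (simp add: presents_def)
  have imemI: "mem T s (coord I SetS x) (coord I s y) \<longleftrightarrow> (x, y) \<in> imem I s"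
    if "x \<in> dmn I SetS" "y \<in> dmn I s" for s x y
    using I that by (simp add: presents_def)
  have d: "(SOME d. d \<in> dmn I s) \<in> dmn I s" for s
    by (rule someI_ex) (use cI[of s] ne[of s] in blast)
  then have rep: "rep I s x \<in> dmn I s" for s x by (simp add: rep_def)
  have repid: "rep I s x = x" if "x \<in> dmn I s" for s x using that by (simp add: rep_def)
  have trep: "trm S (\<lambda>x. x) (\<lambda>e. rep I s (e k))" for s k
  proof -
    \<comment> \<open>The default element enters the definition of the graph of \<open>rep\<close>
      as a parameter.\<close>
    have "dfn S (\<lambda>e. (e (Suc k) \<in> dmn I s \<longrightarrow> e 0 = e (Suc k)) \<and>
        (e (Suc k) \<notin> dmn I s \<longrightarrow> e 0 = (SOME d. d \<in> dmn I s)))"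
      using d[of s] sub[of s]
      by (intro dfn_logic dfn_eq[OF cov_id] dfn_ren1[where p = "\<lambda>x. x \<in> dmn I s", OF dmn]
          trm_id_var trm_const[OF cov_id]) auto
    then have "dfn S (\<lambda>e. e 0 = rep I s (e (Suc k)))"
      by (rule dfn_cong) (auto simp: rep_def)
    then show ?thesis using rep[of s] sub[of s] by (auto simp: trm_def)
  qed
  show ?thesis
  proof
    fix s
    show "tot I s ` elems S = car T s"
    proof
      show "tot I s ` elems S \<subseteq> car T s" using rep[of s] cI[of s] by (auto simp: tot_def)
      show "car T s \<subseteq> tot I s ` elems S"
      proof
        fix y assume "y \<in> car T s"
        then obtain x where "x \<in> dmn I s" "y = coord I s x" using cI[of s] by blast
        then have "y = tot I s x" "x \<in> elems S" using sub[of s] by (auto simp: tot_def rep_def)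
        then show "y \<in> tot I s ` elems S" by blast
      qed
    qed
    have "dfn S (\<lambda>e. (rep I s (e 0), rep I s (e 1)) \<in> eqv I s)"
      by (rule dfn_comp2[where p = "\<lambda>x y. (x, y) \<in> eqv I s", OF eqv trep trep])
    then show "cov S (tot I s)"
      unfolding cov_def by (rule dfn_cong) (simp add: tot_def eqvI rep)
    have "dfn S (\<lambda>e. (rep I SetS (e 0), rep I s (e 1)) \<in> imem I s)"
      by (rule dfn_comp2[where p = "\<lambda>x y. (x, y) \<in> imem I s", OF imem trep trep])
    then show "dfn S (\<lambda>e. mem T s (tot I SetS (e 0)) (tot I s (e 1)))"
      by (rule dfn_cong) (simp add: tot_def imemI rep)
  qed (rule disj)
qed

text \<open>The identity interpretation turned into total maps, so that a structure coded in itself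
  is handled like an interpreted one.\<close>

definition own :: "'a struct \<Rightarrow> sort \<Rightarrow> 'a \<Rightarrow> 'a" where
  "own S = tot (id_interp S)"

lemma own_id [simp]: "x \<in> car S s \<Longrightarrow> own S s x = x"
  by (simp add: own_def tot_def rep_def id_interp_def)

lemma car_elems: "x \<in> car S s \<Longrightarrow> x \<in> elems S"
  by (auto simp: elems_def)

lemma elems_eq: "elems S = car S SetS \<union> car S ClsS"
proof -
  have "(UNIV :: sort set) = {SetS, ClsS}" using sort.exhaust by auto
  show ?thesis unfolding elems_def \<open>UNIV = _\<close> by simp
qed

definition iso_interp :: "'a struct \<Rightarrow> (sort \<Rightarrow> 'a \<Rightarrow> 'b) \<Rightarrow> ('a, 'b) interp" where
  "iso_interp S G = \<lparr>dmn = dmn (id_interp S), eqv = eqv (id_interp S), imem = imem (id_interp S), coord = G\<rparr>"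

lemma tot_iso_interp: "x \<in> car S s \<Longrightarrow> tot (iso_interp S G) s x = G s x"
  by (simp add: tot_def rep_def iso_interp_def id_interp_def)

text \<open>Equality and membership of \<open>T\<close> correspond along \<open>G\<close> to those
  of \<open>S\<close>, so definable predicates of \<open>T\<close> pull back to \<open>S\<close>
  even along an isomorphism that is not definable in \<open>S\<close>.\<close>

lemma cover_struct_iso:
  assumes ne: "\<And>s. car S s \<noteq> {}" and G: "struct_iso S T G"
    and disj': "car T SetS \<inter> car T ClsS = {}"
  shows "cover S T (tot (iso_interp S G))"
proof (rule cover_tot)
  let ?I = "iso_interp S G"
  have bij: "bij_betw (G s) (car S s) (car T s)" for s using G by (simp add: struct_iso_def)
  have im: "G s ` car S s = car T s" and inj: "inj_on (G s) (car S s)" for s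
    using bij[of s] by (auto simp: bij_betw_def)
  show "presents ?I T"
    using presents_id[of S] G im
    by (auto simp: presents_def iso_interp_def id_interp_def struct_iso_def inj_on_eq_iff[OF inj])
  show "car T SetS \<inter> car T ClsS = {}" by (rule disj')
  show "car T s \<noteq> {}" for s using im[of s] ne[of s] by blast
  show "dmn ?I s \<subseteq> elems S" for s by (auto simp: iso_interp_def id_interp_def elems_def)
  show "dfn S (\<lambda>e. e 0 \<in> dmn ?I s)" for s
    by (simp add: iso_interp_def id_interp_def dfn_var_car)
  have "dfn S (\<lambda>e. e 0 \<in> car S s \<and> e 0 = e 1)" for s
    by (intro dfn_conj dfn_var_car dfn_var_eq)
  then show "dfn S (\<lambda>e. (e 0, e 1) \<in> eqv ?I s)" for s
    by (rule dfn_cong) (auto simp: iso_interp_def id_interp_def)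
  show "dfn S (\<lambda>e. (e 0, e 1) \<in> imem ?I s)" for s
    by (rule dfn_cong[OF dfn_var_mem]) (auto simp: iso_interp_def id_interp_def)
qed

lemma cover_own:
  assumes "car S SetS \<inter> car S ClsS = {}" "\<And>s. car S s \<noteq> {}"
  shows "cover S S (own S)"
proof -
  have "struct_iso S S (\<lambda>s x. x)" by (simp add: struct_iso_def bij_betw_def)
  from cover_struct_iso[OF assms(2) this assms(1)] show ?thesis by (simp add: own_def iso_interp_def id_interp_def)
qed

section \<open>From formulas to definable predicates\<close>

lemma sat_dfn:
  assumes "cover S S c" "\<And>s i. trm S (c s) (\<theta> s i)"
  shows "dfn S (\<lambda>e. sat S (\<lambda>s i. \<theta> s i e) \<phi>)"
  using assms(2)
proof (induction \<phi> arbitrary: \<theta>)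
  case (Eq s i j)
  show ?case by simp (rule cover.eq[OF assms(1) Eq Eq])
next
  case (Mem s i j)
  show ?case by simp (rule cover.memb[OF assms(1) Mem Mem])
next
  case (Neg \<phi>)
  show ?case by simp (rule dfn_not[OF Neg.IH[OF Neg.prems]])
next
  case (Conj \<phi> \<psi>)
  show ?case by simp (rule dfn_conj[OF Conj.IH(1)[OF Conj.prems] Conj.IH(2)[OF Conj.prems]])
next
  case (All s i \<phi>)
  let ?\<theta> = "\<lambda>t j. if t = s \<and> j = i then (\<lambda>e. c s (e 0)) else (\<lambda>e. \<theta> t j (\<lambda>i. e (Suc i)))"
  have "trm S (c t) (?\<theta> t j)" for t j
    using cover.var[OF assms(1)] trm_ren[OF All.prems] by auto
  then have "dfn S (\<lambda>e. sat S (\<lambda>t j. ?\<theta> t j e) \<phi>)" by (rule All.IH)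
  then have "dfn S (\<lambda>e. sat S (upd (\<lambda>t j. \<theta> t j (\<lambda>i. e (Suc i))) s i (c s (e 0))) \<phi>)"
    by (rule dfn_cong) (auto intro!: arg_cong[of _ _ "\<lambda>\<rho>. sat S \<rho> \<phi>"] simp: upd_def fun_eq_iff)
  then show ?case by simp (rule cover.ball[OF assms(1)])
qed

lemma dfn_definable_set:
  assumes ne: "car S SetS \<inter> car S ClsS = {}" "\<And>s. car S s \<noteq> {}" and A: "definable_set S A"
  shows "dfn S (\<lambda>e. e 0 \<in> A)"
proof -
  interpret cover S S "own S" by (rule cover_own[OF ne])
  from A have "\<forall>s. \<exists>\<phi> \<rho>. assignment S \<rho> \<and> (\<forall>x\<in>car S s. x \<in> A \<longleftrightarrow> sat S (upd \<rho> s 0 x) \<phi>)"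
    by (simp add: definable_set_def)
  then obtain \<phi> \<rho> where *: "assignment S (\<rho> s)"
    "x \<in> car S s \<Longrightarrow> x \<in> A \<longleftrightarrow> sat S (upd (\<rho> s) s 0 x) (\<phi> s)" for s x by metis
  have "dfn S (\<lambda>e. sat S (upd (\<rho> s) s 0 (own S s (e 0))) (\<phi> s))" for s
  proof -
    let ?\<theta> = "\<lambda>t j. if t = s \<and> j = 0 then (\<lambda>e. own S s (e 0)) else (\<lambda>e. \<rho> s t j)"
    have "trm S (own S t) (?\<theta> t j)" for t j
      using var const *(1) by (auto simp: assignment_def)
    then have "dfn S (\<lambda>e. sat S (\<lambda>t j. ?\<theta> t j e) (\<phi> s))" by (rule sat_dfn[OF cover_axioms])
    then show ?thesis
      by (rule dfn_cong) (auto intro!: arg_cong[of _ _ "\<lambda>\<rho>. sat S \<rho> (\<phi> s)"] simp: upd_def fun_eq_iff)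
  qed
  \<comment> \<open>The formulas for the two sorts are glued by a disjunction guarded by the sort;
    behind the guard \<open>own\<close> is the identity.\<close>
  then have "dfn S (\<lambda>e. \<exists>s. e 0 \<in> car S s \<and> sat S (upd (\<rho> s) s 0 (own S s (e 0))) (\<phi> s))"
    by (intro dfn_ex_sort dfn_conj dfn_var_car)
  moreover have "A \<subseteq> elems S" using A by (simp add: definable_set_def)
  ultimately show ?thesis
  proof (elim dfn_cong)
    fix e :: "nat \<Rightarrow> 'a" assume "A \<subseteq> elems S"
    then have "\<exists>s. e 0 \<in> car S s" if "e 0 \<in> A" using that by (auto simp: elems_def)
    then show "(\<exists>s. e 0 \<in> car S s \<and> sat S (upd (\<rho> s) s 0 (own S s (e 0))) (\<phi> s)) \<longleftrightarrow> e 0 \<in> A"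
      using *(2) by (metis own_id)
  qed
qed

lemma dfn_definable_rel:
  assumes ne: "car S SetS \<inter> car S ClsS = {}" "\<And>s. car S s \<noteq> {}" and R: "definable_rel S R"
  shows "dfn S (\<lambda>e. (e 0, e 1) \<in> R)"
proof -
  interpret cover S S "own S" by (rule cover_own[OF ne])
  from R have "\<forall>s t. \<exists>\<phi> \<rho>. assignment S \<rho> \<and>
      (\<forall>x\<in>car S s. \<forall>y\<in>car S t. (x, y) \<in> R \<longleftrightarrow> sat S (upd (upd \<rho> s 0 x) t 1 y) \<phi>)"
    by (simp add: definable_rel_def)
  then obtain \<phi> \<rho> where *: "assignment S (\<rho> s t)"
    "x \<in> car S s \<Longrightarrow> y \<in> car S t \<Longrightarrow>
      (x, y) \<in> R \<longleftrightarrow> sat S (upd (upd (\<rho> s t) s 0 x) t 1 y) (\<phi> s t)" for s t x y by metis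
  have "dfn S (\<lambda>e. sat S (upd (upd (\<rho> s t) s 0 (own S s (e 0))) t 1 (own S t (e 1))) (\<phi> s t))" for s t
  proof -
    let ?\<theta> = "\<lambda>s' j. if s' = t \<and> j = 1 then (\<lambda>e::nat \<Rightarrow> 'a. own S t (e 1))
      else if s' = s \<and> j = 0 then (\<lambda>e. own S s (e 0)) else (\<lambda>e. \<rho> s t s' j)"
    have "trm S (own S s') (?\<theta> s' j)" for s' j
      using var const *(1) by (auto simp: assignment_def)
    then have "dfn S (\<lambda>e. sat S (\<lambda>t j. ?\<theta> t j e) (\<phi> s t))" by (rule sat_dfn[OF cover_axioms])
    moreover have "(\<lambda>t j. ?\<theta> t j e) = upd (upd (\<rho> s t) s 0 (own S s (e 0))) t 1 (own S t (e 1))" for e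
      by (auto simp: upd_def fun_eq_iff)
    ultimately show ?thesis by simp
  qed
  then have "dfn S (\<lambda>e. \<exists>s t. e 0 \<in> car S s \<and> e 1 \<in> car S t \<and>
      sat S (upd (upd (\<rho> s t) s 0 (own S s (e 0))) t 1 (own S t (e 1))) (\<phi> s t))"
    by (intro dfn_ex_sort dfn_conj dfn_var_car)
  moreover have "R \<subseteq> elems S \<times> elems S" using R by (simp add: definable_rel_def)
  ultimately show ?thesis
  proof (elim dfn_cong)
    fix e :: "nat \<Rightarrow> 'a" assume "R \<subseteq> elems S \<times> elems S"
    show "(\<exists>s t. e 0 \<in> car S s \<and> e 1 \<in> car S t \<and>
      sat S (upd (upd (\<rho> s t) s 0 (own S s (e 0))) t 1 (own S t (e 1))) (\<phi> s t)) \<longleftrightarrow> (e 0, e 1) \<in> R"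
      (is "?L \<longleftrightarrow> ?R")
    proof
      assume ?L
      then obtain s t where st: "e 0 \<in> car S s" "e 1 \<in> car S t"
        "sat S (upd (upd (\<rho> s t) s 0 (own S s (e 0))) t 1 (own S t (e 1))) (\<phi> s t)" by blast
      then show ?R using *(2)[OF st(1,2)] by simp
    next
      assume ?R
      then have "(e 0, e 1) \<in> elems S \<times> elems S" using \<open>R \<subseteq> _\<close> by blast
      then obtain s t where st: "e 0 \<in> car S s" "e 1 \<in> car S t" by (auto simp: elems_def)
      then show ?L using \<open>?R\<close> *(2)[OF st] by (intro exI[of _ s] exI[of _ t]) simp
    qed
  qed
qed

section \<open>From definable predicates to formulas\<close>

text \<open>
  The values of \<open>\<rho>\<^sub>0\<close> at the indices in \<open>B\<close> are the parameters of \<open>\<phi>\<close>, and \<open>A\<close> contains the indices to be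
  kept free of parameters.
\<close>

definition has_fm :: "'a struct \<Rightarrow> ((nat \<Rightarrow> 'a) \<Rightarrow> bool) \<Rightarrow> (nat \<Rightarrow> sort) \<Rightarrow> (nat \<Rightarrow> nat) \<Rightarrow> nat set \<Rightarrow>
    fm \<Rightarrow> 'a asg \<Rightarrow> nat set \<Rightarrow> bool" where
  "has_fm S P \<sigma> v A \<phi> \<rho>\<^sub>0 B \<longleftrightarrow> finite B \<and> B \<inter> A = {} \<and> assignment S \<rho>\<^sub>0 \<and>
    (\<forall>\<rho>. assignment S \<rho> \<longrightarrow> (\<forall>s. \<forall>k\<in>B. \<rho> s k = \<rho>\<^sub>0 s k) \<longrightarrow>
      sat S \<rho> \<phi> = P (\<lambda>i. \<rho> (\<sigma> i) (v i)))"

lemma has_fmI: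
  assumes "finite B" "B \<inter> A = {}" "assignment S \<rho>\<^sub>0"
    "\<And>\<rho>. assignment S \<rho> \<Longrightarrow> (\<And>s k. k \<in> B \<Longrightarrow> \<rho> s k = \<rho>\<^sub>0 s k) \<Longrightarrow> sat S \<rho> \<phi> = P (\<lambda>i. \<rho> (\<sigma> i) (v i))"
  shows "has_fm S P \<sigma> v A \<phi> \<rho>\<^sub>0 B"
  using assms by (simp add: has_fm_def)

lemma has_fmD:
  assumes "has_fm S P \<sigma> v A \<phi> \<rho>\<^sub>0 B"
  shows "finite B" "B \<inter> A = {}" "assignment S \<rho>\<^sub>0"
    "assignment S \<rho> \<Longrightarrow> (\<And>s k. k \<in> B \<Longrightarrow> \<rho> s k = \<rho>\<^sub>0 s k) \<Longrightarrow> sat S \<rho> \<phi> = P (\<lambda>i. \<rho> (\<sigma> i) (v i))"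
  using assms by (simp_all add: has_fm_def)

lemma assignment_upd: "assignment S \<rho> \<Longrightarrow> x \<in> car S s \<Longrightarrow> assignment S (upd \<rho> s i x)"
  by (simp add: assignment_def upd_def)

lemma assignment_env: "assignment S \<rho> \<Longrightarrow> env S (\<lambda>i. \<rho> (\<sigma> i) (v i))"
  by (auto simp: assignment_def env_def elems_def)

text \<open>Position \<open>i\<close> is rendered by the variable \<open>v i\<close> of sort
  \<open>\<sigma> i\<close>. Atoms whose tags do not fit the sorts have a constant truth value
  because the carriers are disjoint, and a quantifier over all elements becomes a conjunction of two
  quantifiers, one for each sort.\<close>

lemma ex_has_fm:
  assumes disj: "car S SetS \<inter> car S ClsS = {}" and ne: "\<And>s. car S s \<noteq> {}"
    and "dfn S P" and "finite A"
  shows "\<exists>\<phi> \<rho>\<^sub>0 B. has_fm S P \<sigma> v A \<phi> \<rho>\<^sub>0 B"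
proof -
  define \<delta> where "\<delta> = (\<lambda>s (i::nat). SOME x. x \<in> car S s)"
  have \<delta>: "assignment S \<delta>" using ne by (simp add: \<delta>_def assignment_def some_in_eq)
  have uniq: "\<rho> s i \<in> car S t \<longleftrightarrow> s = t" if "assignment S \<rho>" for \<rho> s t i
    using that disj unfolding assignment_def by (cases s; cases t) blast+
  have const: "\<exists>\<phi> \<rho>\<^sub>0 B. has_fm S P \<sigma> v A \<phi> \<rho>\<^sub>0 B"
    if "\<And>\<rho>. assignment S \<rho> \<Longrightarrow> P (\<lambda>i. \<rho> (\<sigma> i) (v i)) = b" for P \<sigma> v A b
  proof (intro exI)
    show "has_fm S P \<sigma> v A (if b then Eq SetS 0 0 else Neg (Eq SetS 0 0)) \<delta> {}"
      by (rule has_fmI) (auto simp: \<delta> that)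
  qed
  \<comment> \<open>Two subformulas can share one assignment when the second keeps its parameter
    indices away from those of the first.\<close>
  have combine: "\<exists>\<phi> \<rho>\<^sub>0 B. has_fm S R \<sigma> v A \<phi> \<rho>\<^sub>0 B"
    if fm1: "has_fm S P \<sigma>1 v1 A1 \<phi> \<rho>1 B1" and fm2: "has_fm S Q \<sigma>2 v2 A2 \<psi> \<rho>2 B2"
      and A: "A \<subseteq> A1" "A \<subseteq> A2" "B1 \<subseteq> A2"
      and sat: "\<And>\<rho>. assignment S \<rho> \<Longrightarrow>
        (\<And>s k. k \<in> B1 \<Longrightarrow> \<rho> s k = \<rho>1 s k) \<Longrightarrow> (\<And>s k. k \<in> B2 \<Longrightarrow> \<rho> s k = \<rho>2 s k) \<Longrightarrow>
        sat S \<rho> \<chi> = R (\<lambda>i. \<rho> (\<sigma> i) (v i))"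
    for P Q R \<sigma> \<sigma>1 \<sigma>2 v v1 v2 A A1 A2 \<phi> \<psi> \<chi> \<rho>1 \<rho>2 B1 B2
  proof (intro exI)
    note 1 = has_fmD[OF fm1] and 2 = has_fmD[OF fm2]
    show "has_fm S R \<sigma> v A \<chi> (\<lambda>s k. if k \<in> B1 then \<rho>1 s k else \<rho>2 s k) (B1 \<union> B2)"
    proof (rule has_fmI)
      show "(B1 \<union> B2) \<inter> A = {}" using A 1 2 by blast
      show "assignment S (\<lambda>s k. if k \<in> B1 then \<rho>1 s k else \<rho>2 s k)"
        using 1(3) 2(3) by (simp add: assignment_def)
      fix \<rho> assume \<rho>: "assignment S \<rho>"
        "\<And>s k. k \<in> B1 \<union> B2 \<Longrightarrow> \<rho> s k = (if k \<in> B1 then \<rho>1 s k else \<rho>2 s k)"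
      have "B1 \<inter> B2 = {}" using 2(2) A(3) by blast
      with \<rho>(2) show "sat S \<rho> \<chi> = R (\<lambda>i. \<rho> (\<sigma> i) (v i))"
        by (intro sat \<rho>(1)) auto
    qed (use 1(1) 2(1) in simp)
  qed
  show ?thesis
    using assms(3,4)
  proof (induction arbitrary: \<sigma> v A)
    case (dfn_var_eq i j)
    show ?case
    proof (cases "\<sigma> i = \<sigma> j")
      case True
      then have "has_fm S (\<lambda>e. e i = e j) \<sigma> v A (Eq (\<sigma> i) (v i) (v j)) \<delta> {}"
        by (intro has_fmI) (auto simp: \<delta>)
      then show ?thesis by blast
    next
      case False
      then have "\<rho> (\<sigma> i) (v i) \<noteq> \<rho> (\<sigma> j) (v j)" if "assignment S \<rho>" for \<rho>
        using uniq[OF that] by metis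
      then show ?thesis by (intro const[where b = False]) simp
    qed
  next
    case (dfn_var_mem i j s)
    show ?case
    proof (cases "\<sigma> i = SetS \<and> \<sigma> j = s")
      case True
      then have "has_fm S (\<lambda>e. e i \<in> car S SetS \<and> e j \<in> car S s \<and> mem S s (e i) (e j)) \<sigma> v A
          (Mem s (v i) (v j)) \<delta> {}"
        by (intro has_fmI) (auto simp: \<delta> uniq)
      then show ?thesis by blast
    next
      case False
      then show ?thesis by (intro const[where b = False]) (auto simp: uniq)
    qed
  next
    case (dfn_var_car i s)
    show ?case by (rule const[where b = "\<sigma> i = s"]) (simp add: uniq)
  next
    case (dfn_not P)
    then obtain \<phi> \<rho>\<^sub>0 B where fm: "has_fm S P \<sigma> v A \<phi> \<rho>\<^sub>0 B" by blast
    have "has_fm S (\<lambda>e. \<not> P e) \<sigma> v A (Neg \<phi>) \<rho>\<^sub>0 B"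
      by (rule has_fmI) (use has_fmD[OF fm] in simp_all)
    then show ?case by blast
  next
    case (dfn_conj P Q)
    obtain \<phi> \<rho>1 B1 where 1: "has_fm S P \<sigma> v A \<phi> \<rho>1 B1"
      using dfn_conj.IH(1)[OF dfn_conj.prems] by blast
    then have "finite (A \<union> B1)" using dfn_conj.prems has_fmD(1)[OF 1] by simp
    then obtain \<psi> \<rho>2 B2 where 2: "has_fm S Q \<sigma> v (A \<union> B1) \<psi> \<rho>2 B2"
      using dfn_conj.IH(2) by blast
    show ?case
      by (rule combine[OF 1 2, where \<chi> = "Conj \<phi> \<psi>"]) (use has_fmD(4)[OF 1] has_fmD(4)[OF 2] in simp_all)
  next
    case (dfn_all P)
    obtain n where n: "supported S n P" using dfn_support[OF dfn_all.hyps(1)] by blast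
    \<comment> \<open>The bound variable \<open>k\<close> avoids the variables of the positions on
      which \<open>P\<close> depends. Inserting it into \<open>A\<close> prevents parameters from
      being stored there.\<close>
    obtain k where k: "k \<notin> A \<union> v ` {..<n}"
      using dfn_all.prems ex_new_if_finite[of "A \<union> v ` {..<n}"] by auto
    have "finite (insert k A)" using dfn_all.prems by simp
    then obtain \<phi> \<rho>1 B1 where 1: "has_fm S P (case_nat SetS \<sigma>) (case_nat k v) (insert k A) \<phi> \<rho>1 B1"
      using dfn_all.IH by blast
    have "finite (insert k A \<union> B1)" using dfn_all.prems has_fmD(1)[OF 1] by simp
    then obtain \<psi> \<rho>2 B2 where 2: "has_fm S P (case_nat ClsS \<sigma>) (case_nat k v) (insert k A \<union> B1) \<psi> \<rho>2 B2"
      using dfn_all.IH by blast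
    have upd: "P (\<lambda>i. upd \<rho> s k x (case_nat s \<sigma> i) (case_nat k v i)) = P (case_nat x (\<lambda>i. \<rho> (\<sigma> i) (v i)))"
      if \<rho>: "assignment S \<rho>" and x: "x \<in> car S s" for \<rho> s x
    proof (rule supportedD[OF n assignment_env[OF assignment_upd[OF \<rho> x]]])
      show "env S (case_nat x (\<lambda>i. \<rho> (\<sigma> i) (v i)))"
        using x car_elems assignment_env[OF \<rho>] by auto
      fix i assume "i < n"
      then show "upd \<rho> s k x (case_nat s \<sigma> i) (case_nat k v i) = case_nat x (\<lambda>i. \<rho> (\<sigma> i) (v i)) i"
        using k by (auto simp: upd_def split: nat.splits)
    qed
    show ?case
    proof (rule combine[OF 1 2, where \<chi> = "Conj (All SetS k \<phi>) (All ClsS k \<psi>)"])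
      fix \<rho> assume \<rho>: "assignment S \<rho>"
        "\<And>s j. j \<in> B1 \<Longrightarrow> \<rho> s j = \<rho>1 s j" "\<And>s j. j \<in> B2 \<Longrightarrow> \<rho> s j = \<rho>2 s j"
      have "sat S (upd \<rho> SetS k x) \<phi> = P (case_nat x (\<lambda>i. \<rho> (\<sigma> i) (v i)))" if x: "x \<in> car S SetS" for x
        unfolding upd[OF \<rho>(1) x, symmetric]
        by (rule has_fmD(4)[OF 1 assignment_upd[OF \<rho>(1) x]])
          (use has_fmD(2)[OF 1] \<rho>(2) in \<open>auto simp: upd_def\<close>)
      moreover have "sat S (upd \<rho> ClsS k x) \<psi> = P (case_nat x (\<lambda>i. \<rho> (\<sigma> i) (v i)))" if x: "x \<in> car S ClsS" for x
        unfolding upd[OF \<rho>(1) x, symmetric]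
        by (rule has_fmD(4)[OF 2 assignment_upd[OF \<rho>(1) x]])
          (use has_fmD(2)[OF 2] \<rho>(3) in \<open>auto simp: upd_def\<close>)
      moreover note elems_eq[of S]
      ultimately show "sat S \<rho> (Conj (All SetS k \<phi>) (All ClsS k \<psi>)) =
        (\<forall>x\<in>elems S. P (case_nat x (\<lambda>i. \<rho> (\<sigma> i) (v i))))"
        by auto
    qed auto
  next
    case (dfn_par a P)
    then obtain s where a: "a \<in> car S s" by (auto simp: elems_def)
    obtain n where n: "supported S n P" using dfn_support[OF dfn_par.hyps(2)] by blast
    obtain k where k: "k \<notin> A"
      using dfn_par.prems ex_new_if_finite[of A] by auto
    have "finite (insert k A)" using dfn_par.prems by simp
    then obtain \<phi> \<rho>1 B1 where 1: "has_fm S P (case_nat s \<sigma>) (case_nat k v) (insert k A) \<phi> \<rho>1 B1"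
      using dfn_par.IH by blast
    note 1 = has_fmD[OF 1]
    \<comment> \<open>The parameter \<open>a\<close> becomes the value of the reserved variable
      \<open>k\<close>.\<close>
    have "has_fm S (\<lambda>e. P (case_nat a e)) \<sigma> v A \<phi> (upd \<rho>1 s k a) (insert k B1)"
    proof (rule has_fmI)
      show "insert k B1 \<inter> A = {}" using k 1(2) by blast
      show "assignment S (upd \<rho>1 s k a)" by (rule assignment_upd[OF 1(3) a])
      fix \<rho> assume \<rho>: "assignment S \<rho>" "\<And>t j. j \<in> insert k B1 \<Longrightarrow> \<rho> t j = upd \<rho>1 s k a t j"
      have "k \<notin> B1" using 1(2) by blast
      then have "sat S \<rho> \<phi> = P (\<lambda>i. \<rho> (case_nat s \<sigma> i) (case_nat k v i))"
        by (intro 1(4)[OF \<rho>(1)]) (use \<rho>(2) in \<open>auto simp: upd_def\<close>)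
      also have "(\<lambda>i. \<rho> (case_nat s \<sigma> i) (case_nat k v i)) = case_nat a (\<lambda>i. \<rho> (\<sigma> i) (v i))"
        using \<rho>(2)[of k s] by (auto simp: upd_def fun_eq_iff split: nat.splits)
      finally show "sat S \<rho> \<phi> = P (case_nat a (\<lambda>i. \<rho> (\<sigma> i) (v i)))" .
    qed (use 1(1) in simp)
    then show ?case by blast
  next
    case (dfn_cong P Q)
    then obtain \<phi> \<rho>\<^sub>0 B where fm: "has_fm S P \<sigma> v A \<phi> \<rho>\<^sub>0 B" by blast
    have "has_fm S Q \<sigma> v A \<phi> \<rho>\<^sub>0 B"
      by (rule has_fmI) (use has_fmD[OF fm] dfn_cong.hyps(2)[OF assignment_env] in simp_all)
    then show ?case by blast
  qed
qed

lemma definable_rel_dfn: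
  assumes ne: "car S SetS \<inter> car S ClsS = {}" "\<And>s. car S s \<noteq> {}"
    and R: "R \<subseteq> elems S \<times> elems S" "dfn S (\<lambda>e. (e 0, e 1) \<in> R)"
  shows "definable_rel S R"
  unfolding definable_rel_def
proof (intro conjI R(1) allI)
  fix s t
  obtain \<phi> \<rho> B where "has_fm S (\<lambda>e. (e 0, e 1) \<in> R) (case_nat s (\<lambda>_. t)) (\<lambda>i. i) {0, 1} \<phi> \<rho> B"
    using ex_has_fm[OF ne R(2), of "{0, 1}"] by blast
  note fm = has_fmD[OF this]
  have "(x, y) \<in> R \<longleftrightarrow> sat S (upd (upd \<rho> s 0 x) t 1 y) \<phi>" if "x \<in> car S s" "y \<in> car S t" for x y
    by (subst fm(4)[OF assignment_upd[OF assignment_upd[OF fm(3)]]]) (use that fm(2) in \<open>auto simp: upd_def\<close>)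
  then show "\<exists>\<phi> \<rho>. assignment S \<rho> \<and>
      (\<forall>x\<in>car S s. \<forall>y\<in>car S t. (x, y) \<in> R \<longleftrightarrow> sat S (upd (upd \<rho> s 0 x) t 1 y) \<phi>)"
    using fm(3) by blast
qed

lemma (in KM) class_of_dfn:
  assumes "dfn S (\<lambda>e. P (own S SetS (e 0)))"
  shows "\<exists>X\<in>car S ClsS. \<forall>x\<in>car S SetS. mem S ClsS x X \<longleftrightarrow> P x"
proof -
  obtain \<phi> \<rho> B where
    "has_fm S (\<lambda>e. P (own S SetS (e 0))) (\<lambda>_. SetS) (\<lambda>i. i) {0} \<phi> \<rho> B"
    using ex_has_fm[OF sorts_disjoint sorts_nonempty assms, of "{0}"] by blast
  note fm = has_fmD[OF this]
  have "sat S (upd \<rho> SetS 0 x) \<phi> = P x" if "x \<in> car S SetS" for x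
    by (subst fm(4)[OF assignment_upd[OF fm(3)]]) (use that fm(2) in \<open>auto simp: upd_def\<close>)
  with comprehension[OF fm(3), of \<phi>] show ?thesis by auto
qed

lemma (in KM_CC_set) choice_of_dfn:
  assumes P: "dfn S (\<lambda>e. P (own S SetS (e 0)) (own S ClsS (e 1)))" and s: "s \<in> car S SetS"
    and ex: "\<And>x. x \<in> car S SetS \<Longrightarrow> mem S SetS x s \<Longrightarrow> \<exists>X\<in>car S ClsS. P x X"
  shows "\<exists>Y\<in>car S ClsS. \<forall>x\<in>car S SetS. mem S SetS x s \<longrightarrow> (\<exists>Z. slice S Y x Z \<and> P x Z)"
proof -
  \<comment> \<open>Both variables have index 0 but different sorts, as in the scheme CC.\<close>
  obtain \<phi> \<rho> B where
    "has_fm S (\<lambda>e. P (own S SetS (e 0)) (own S ClsS (e 1))) (case_nat SetS (\<lambda>_. ClsS)) (\<lambda>i. 0) {0} \<phi> \<rho> B"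
    using ex_has_fm[OF sorts_disjoint sorts_nonempty P, of "{0}"] by blast
  note fm = has_fmD[OF this]
  have *: "sat S (upd (upd \<rho> SetS 0 x) ClsS 0 X) \<phi> = P x X" if "x \<in> car S SetS" "X \<in> car S ClsS" for x X
    by (subst fm(4)[OF assignment_upd[OF assignment_upd[OF fm(3)]]]) (use that fm(2) in \<open>auto simp: upd_def\<close>)
  have "\<exists>Y\<in>car S ClsS. \<forall>x\<in>car S SetS. mem S SetS x s \<longrightarrow>
        (\<exists>Z. slice S Y x Z \<and> sat S (upd (upd \<rho> SetS 0 x) ClsS 0 Z) \<phi>)"
    by (rule CC_set[OF fm(3) s]) (use * ex in blast)
  then show ?thesis using * unfolding slice_def by metis
qed

section \<open>Set theory with definable classes\<close>

text \<open>By \<open>cls\<close>, definitions over the outer structure \<open>S\<close> produce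
  classes of \<open>T\<close>. Separation, replacement and induction thus become available in
  \<open>T\<close> for predicates that refer to \<open>S\<close>.\<close>

locale dmodel = cover S T c + KM T
  for S :: "'b struct" and T :: "'x struct" and c +
  assumes cls: "dfn S (\<lambda>e. P (c SetS (e 0))) \<Longrightarrow>
    \<exists>X\<in>car T ClsS. \<forall>x\<in>car T SetS. mem T ClsS x X \<longleftrightarrow> P x"
begin

abbreviation V where "V \<equiv> car T SetS"
abbreviation E where "E \<equiv> mem T SetS"
abbreviation In where "In \<equiv> mem T ClsS"
abbreviation dfn1 where "dfn1 P \<equiv> dfn S (\<lambda>e. P (c SetS (e 0)))"
abbreviation dfn2 where "dfn2 R \<equiv> dfn S (\<lambda>e. R (c SetS (e 0)) (c SetS (e 1)))"

lemma set_ext: "x \<in> V \<Longrightarrow> y \<in> V \<Longrightarrow> (\<And>z. z \<in> V \<Longrightarrow> E z x \<longleftrightarrow> E z y) \<Longrightarrow> x = y"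
  using set_extensionality by blast

lemma upair_ex:
  assumes "x \<in> V" "y \<in> V" obtains u where "u \<in> V" "\<And>z. z \<in> V \<Longrightarrow> E z u \<longleftrightarrow> z = x \<or> z = y"
  using pairing[OF assms] unfolding upair_def by blast

section \<open>Kuratowski pairs and class relations\<close>

lemma opair_iff:
  "opair T p x y \<longleftrightarrow> p \<in> V \<and> (\<exists>u\<in>V. \<exists>v\<in>V. (\<forall>z\<in>V. E z u \<longleftrightarrow> z = x \<or> z = x) \<and>
    (\<forall>z\<in>V. E z v \<longleftrightarrow> z = x \<or> z = y) \<and> (\<forall>z\<in>V. E z p \<longleftrightarrow> z = u \<or> z = v))"
  unfolding opair_def upair_def by blast

lemma opair_in: "opair T p x y \<Longrightarrow> p \<in> V"
  by (simp add: opair_iff)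

lemma opair_ex:
  assumes "x \<in> V" "y \<in> V" obtains p where "opair T p x y"
  using pairing[OF assms] pairing[OF assms(1) assms(1)] pairing unfolding opair_def by metis

lemma opair_members:
  assumes "opair T p x y" "w \<in> V"
  shows "E w p \<longleftrightarrow> (\<forall>z\<in>V. E z w \<longleftrightarrow> z = x) \<or> (\<forall>z\<in>V. E z w \<longleftrightarrow> z = x \<or> z = y)"
proof -
  from assms(1) obtain u v where uv: "u \<in> V" "v \<in> V" "\<forall>z\<in>V. E z u \<longleftrightarrow> z = x"
    "\<forall>z\<in>V. E z v \<longleftrightarrow> z = x \<or> z = y" "\<forall>z\<in>V. E z p \<longleftrightarrow> z = u \<or> z = v"
    unfolding opair_iff by auto
  have "w = u \<longleftrightarrow> (\<forall>z\<in>V. E z w \<longleftrightarrow> z = x)" using uv(1,3) assms(2) set_ext[of w u] by auto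
  moreover have "w = v \<longleftrightarrow> (\<forall>z\<in>V. E z w \<longleftrightarrow> z = x \<or> z = y)"
    using uv(2,4) assms(2) set_ext[of w v] by auto
  ultimately show ?thesis using uv(5) assms(2) by auto
qed

text \<open>The first coordinate is the only common element of all members of the pair, and the
  coordinates are exactly the elements of those members.\<close>

lemma opair_inject:
  assumes p: "opair T p x y" "opair T p x' y'" and V: "x \<in> V" "y \<in> V" "x' \<in> V" "y' \<in> V"
  shows "x = x' \<and> y = y'"
proof -
  have first: "(\<forall>w\<in>V. E w p \<longrightarrow> E z w) \<longleftrightarrow> z = x" if o: "opair T p x y" "x \<in> V" "z \<in> V" for x y z
  proof
    obtain u where u: "u \<in> V" "\<And>z. z \<in> V \<Longrightarrow> E z u \<longleftrightarrow> z = x \<or> z = x"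
      using upair_ex[OF o(2,2)] by blast
    assume "\<forall>w\<in>V. E w p \<longrightarrow> E z w"
    moreover have "E u p" using opair_members[OF o(1) u(1)] u(2) by blast
    ultimately show "z = x" using u o(3) by blast
  next
    assume "z = x"
    then show "\<forall>w\<in>V. E w p \<longrightarrow> E z w" using opair_members[OF o(1)] o by blast
  qed
  have second: "(\<exists>w\<in>V. E w p \<and> E z w) \<longleftrightarrow> z = x \<or> z = y"
    if o: "opair T p x y" "x \<in> V" "y \<in> V" "z \<in> V" for x y z
  proof
    assume "\<exists>w\<in>V. E w p \<and> E z w"
    then show "z = x \<or> z = y" using opair_members[OF o(1)] o by blast
  next
    obtain u where u: "u \<in> V" "\<And>z. z \<in> V \<Longrightarrow> E z u \<longleftrightarrow> z = x \<or> z = y"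
      using upair_ex[OF o(2,3)] by blast
    assume "z = x \<or> z = y"
    moreover have "E u p" using opair_members[OF o(1) u(1)] u(2) by blast
    ultimately show "\<exists>w\<in>V. E w p \<and> E z w" using u o(4) by blast
  qed
  have "x = x'" using first[OF p(1) V(1,1)] first[OF p(2) V(3,1)] by simp
  moreover have "z = x \<or> z = y \<longleftrightarrow> z = x' \<or> z = y'" if "z \<in> V" for z
    using second[OF p(1) V(1,2) that] second[OF p(2) V(3,4) that] by simp
  ultimately show ?thesis using V by metis
qed

lemma dfn_opair:
  assumes "trm S (c SetS) p" "trm S (c SetS) x" "trm S (c SetS) y"
  shows "dfn S (\<lambda>e. opair T (p e) (x e) (y e))"
proof (rule dfn_comp3[where p = "opair T", OF _ assms])
  have "dfn S (\<lambda>e. \<exists>u\<in>V. \<exists>v\<in>V. (\<forall>z\<in>V. E z u \<longleftrightarrow> z = c SetS (e 1) \<or> z = c SetS (e 1)) \<and>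
    (\<forall>z\<in>V. E z v \<longleftrightarrow> z = c SetS (e 1) \<or> z = c SetS (e 2)) \<and> (\<forall>z\<in>V. E z (c SetS (e 0)) \<longleftrightarrow> z = u \<or> z = v))"
    by (intro rules)
  then show "dfn S (\<lambda>e. opair T (c SetS (e 0)) (c SetS (e 1)) (c SetS (e 2)))"
    by (rule dfn_cong) (simp add: opair_iff c_in[OF envD])
qed

lemma pair_in_iff: "pair_in T x y Y \<longleftrightarrow> (\<exists>p\<in>V. opair T p x y \<and> In p Y)"
  unfolding pair_in_def using opair_in by blast

lemma dfn_pair_in:
  assumes "trm S (c SetS) x" "trm S (c SetS) y" "trm S (c ClsS) Y"
  shows "dfn S (\<lambda>e. pair_in T (x e) (y e) (Y e))"
  by (rule dfn_comp3[where p = "pair_in T", OF _ assms], unfold pair_in_iff) (intro rules dfn_opair)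

lemma rel_class:
  assumes "dfn2 Q"
  obtains C where "C \<in> car T ClsS" "\<And>x y. x \<in> V \<Longrightarrow> y \<in> V \<Longrightarrow> pair_in T x y C \<longleftrightarrow> Q x y"
    "\<And>p. p \<in> V \<Longrightarrow> In p C \<Longrightarrow> \<exists>x\<in>V. \<exists>y\<in>V. opair T p x y"
proof -
  have "dfn1 (\<lambda>p. \<exists>x\<in>V. \<exists>y\<in>V. opair T p x y \<and> Q x y)"
    by (intro rules dfn_opair dfn_comp2[where p = Q, OF assms])
  from cls[OF this] obtain C where C: "C \<in> car T ClsS"
    "\<forall>p\<in>V. In p C \<longleftrightarrow> (\<exists>x\<in>V. \<exists>y\<in>V. opair T p x y \<and> Q x y)" by blast
  have "pair_in T x y C \<longleftrightarrow> Q x y" if xy: "x \<in> V" "y \<in> V" for x y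
  proof
    assume "pair_in T x y C"
    then obtain p x' y' where *: "opair T p x y" "opair T p x' y'" "x' \<in> V" "y' \<in> V" "Q x' y'"
      unfolding pair_in_iff using C(2) by blast
    then show "Q x y" using opair_inject[OF *(1,2) xy *(3,4)] by simp
  next
    assume "Q x y"
    moreover obtain p where "opair T p x y" using opair_ex[OF xy] by blast
    ultimately show "pair_in T x y C" unfolding pair_in_iff using C(2) opair_in xy by blast
  qed
  then show thesis using C that by blast
qed

section \<open>Replacement, separation and induction for definable predicates\<close>

lemma repl:
  assumes R: "dfn2 R" and a: "a \<in> V"
    and fn: "\<And>x y y'. \<lbrakk>x \<in> V; y \<in> V; y' \<in> V; E x a; R x y; R x y'\<rbrakk> \<Longrightarrow> y = y'"
  obtains b where "b \<in> V" "\<And>y. y \<in> V \<Longrightarrow> E y b \<longleftrightarrow> (\<exists>x\<in>V. E x a \<and> R x y)"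
proof -
  have "dfn2 (\<lambda>x y. E x a \<and> R x y)"
    by (intro rules R const a)
  then obtain F where F: "F \<in> car T ClsS" "\<And>x y. x \<in> V \<Longrightarrow> y \<in> V \<Longrightarrow> pair_in T x y F \<longleftrightarrow> E x a \<and> R x y"
    "\<And>p. p \<in> V \<Longrightarrow> In p F \<Longrightarrow> \<exists>x\<in>V. \<exists>y\<in>V. opair T p x y" by (rule rel_class) blast
  have "is_function T F" unfolding is_function_def
  proof (intro conjI ballI impI)
    fix x y z assume "x \<in> V" "y \<in> V" "z \<in> V" "pair_in T x y F" "pair_in T x z F"
    then show "y = z" using fn[of x y z] F(2) by simp
  qed (rule F(3))
  from replacement[OF F(1) this a] obtain b where
    "b \<in> V" "\<forall>y\<in>V. E y b \<longleftrightarrow> (\<exists>x\<in>V. E x a \<and> pair_in T x y F)" by blast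
  then show thesis using F(2) that by auto
qed

text \<open>Replacement along the identity restricted to \<open>P\<close>.\<close>

lemma sep:
  assumes P: "dfn1 P" and a: "a \<in> V"
  obtains b where "b \<in> V" "\<And>y. y \<in> V \<Longrightarrow> E y b \<longleftrightarrow> E y a \<and> P y"
proof -
  have "dfn2 (\<lambda>x y. x = y \<and> P x)" by (intro rules P)
  then obtain b where "b \<in> V" "\<And>y. y \<in> V \<Longrightarrow> E y b \<longleftrightarrow> (\<exists>x\<in>V. E x a \<and> x = y \<and> P x)"
    using a by (rule repl) blast+
  then show thesis using that by blast
qed

lemma union_ex:
  assumes "a \<in> V"
  obtains u where "u \<in> V" "\<And>z. z \<in> V \<Longrightarrow> E z u \<longleftrightarrow> (\<exists>y\<in>V. E z y \<and> E y a)"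
  using union[OF assms] by blast

definition sub where "sub x y \<longleftrightarrow> (\<forall>z\<in>V. E z x \<longrightarrow> E z y)"

lemma power_ex:
  assumes "a \<in> V"
  obtains u where "u \<in> V" "\<And>z. z \<in> V \<Longrightarrow> E z u \<longleftrightarrow> sub z a"
  using power_set[OF assms] unfolding sub_def by blast

lemma no_cycle: assumes "x \<in> V" "y \<in> V" "E x y" shows "\<not> E y x"
proof -
  obtain u where u: "u \<in> V" "\<And>z. z \<in> V \<Longrightarrow> E z u \<longleftrightarrow> z = x \<or> z = y"
    using upair_ex[OF assms(1,2)] by blast
  then have "\<exists>y\<in>V. E y u" using assms by blast
  from foundation[OF u(1) this] obtain m where m: "m \<in> V" "E m u" "\<And>z. z \<in> V \<Longrightarrow> E z m \<Longrightarrow> \<not> E z u"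
    by auto
  from m(1,2) u(2) have "m = x \<or> m = y" by simp
  then show ?thesis using m(3)[of x] m(3)[of y] u(2) assms by auto
qed

lemma no_loop: "x \<in> V \<Longrightarrow> \<not> E x x"
  using no_cycle by blast

text \<open>The sets reached from \<open>x\<close> by descending membership are collected level by
  level. The levels are indexed by an arbitrary inductive set \<open>w\<close> instead of the
  natural numbers, and recursion is replaced by the least relation closed under its clauses.\<close>

lemma transitive_closure:
  assumes x: "x \<in> V"
  obtains t where "t \<in> V" "E x t" "\<And>y z. y \<in> V \<Longrightarrow> z \<in> V \<Longrightarrow> E z y \<Longrightarrow> E y t \<Longrightarrow> E z t"
proof -
  define sc where "sc n m \<longleftrightarrow> (\<forall>z\<in>V. E z m \<longleftrightarrow> E z n \<or> z = n)" for n m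
  obtain w where w: "w \<in> V" and "\<exists>e\<in>V. E e w \<and> (\<forall>z\<in>V. \<not> E z e)"
    and w_sc: "\<forall>n\<in>V. E n w \<longrightarrow> (\<exists>m\<in>V. E m w \<and> sc n m)"
    unfolding sc_def using infinity by auto
  then obtain e where e: "e \<in> V" "E e w" "\<forall>z\<in>V. \<not> E z e" by blast
  have dfn_sc: "dfn S (\<lambda>e. sc (n e) (m e))" if "trm S (c SetS) n" "trm S (c SetS) m" for n m
    by (rule dfn_comp2[where p = sc, OF _ that], unfold sc_def) (intro rules)
  have sc_inj: "n = n'" if "sc n m" "sc n' m" "n \<in> V" "n' \<in> V" for n n' m
  proof (rule ccontr)
    assume "n \<noteq> n'"
    have "E n m" using that(1,3) unfolding sc_def by simp
    then have "E n n'" using that(2,3) \<open>n \<noteq> n'\<close> unfolding sc_def by simp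
    have "E n' m" using that(2,4) unfolding sc_def by simp
    then have "E n' n" using that(1,4) \<open>n \<noteq> n'\<close> unfolding sc_def by simp
    then show False using no_cycle[OF that(3,4) \<open>E n n'\<close>] by simp
  qed
  define closed where "closed C \<longleftrightarrow> pair_in T e x C \<and>
    (\<forall>n\<in>V. \<forall>m\<in>V. \<forall>z\<in>V. \<forall>u\<in>V. E n w \<longrightarrow> sc n m \<longrightarrow> pair_in T n z C \<longrightarrow> E u z \<longrightarrow> pair_in T m u C)" for C
  \<comment> \<open>\<open>u\<close> lies \<open>n\<close> membership steps below \<open>x\<close>\<close>
  define R where "R n u \<longleftrightarrow> (\<forall>C\<in>car T ClsS. closed C \<longrightarrow> pair_in T n u C)" for n u
  have dfn_R: "dfn S (\<lambda>e. R (n e) (u e))" if "trm S (c SetS) n" "trm S (c SetS) u" for n u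
    by (rule dfn_comp2[where p = R, OF _ that], unfold R_def closed_def)
      (intro rules dfn_pair_in dfn_sc const w e x)
  have R0: "R e x" by (simp add: R_def closed_def)
  have Rs: "R m u" if "R n z" "E u z" "E n w" "sc n m" "n \<in> V" "m \<in> V" "z \<in> V" "u \<in> V" for n m z u
    unfolding R_def
  proof (intro ballI impI)
    fix C assume "C \<in> car T ClsS" "closed C"
    then have "pair_in T n z C" using that(1) unfolding R_def by simp
    then show "pair_in T m u C" using \<open>closed C\<close> that unfolding closed_def by simp
  qed
  \<comment> \<open>By leastness of \<open>R\<close>: the relation on the right hand side satisfies
    the closure clauses itself.\<close>
  have R_inv: "m = e \<and> u = x \<or> (\<exists>n\<in>V. \<exists>z\<in>V. E n w \<and> sc n m \<and> R n z \<and> E u z)"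
    if mu: "m \<in> V" "u \<in> V" "R m u" for m u
  proof -
    let ?Q = "\<lambda>m u. m = e \<and> u = x \<or> (\<exists>n\<in>V. \<exists>z\<in>V. E n w \<and> sc n m \<and> R n z \<and> E u z)"
    have "dfn2 ?Q" by (intro rules dfn_sc dfn_R const w e x)
    then obtain C where C: "C \<in> car T ClsS" "\<And>x y. x \<in> V \<Longrightarrow> y \<in> V \<Longrightarrow> pair_in T x y C \<longleftrightarrow> ?Q x y"
      by (rule rel_class) (rule that)
    have QR: "R n z" if "?Q n z" "n \<in> V" "z \<in> V" for n z
      using that R0 Rs by blast
    have "closed C" unfolding closed_def
    proof (intro conjI ballI impI)
      show "pair_in T e x C" using C(2) e x by blast
      fix n m z u assume *: "n \<in> V" "m \<in> V" "z \<in> V" "u \<in> V" "E n w" "sc n m" "pair_in T n z C" "E u z"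
      then have "R n z" using C(2) QR by blast
      with * show "pair_in T m u C" using C(2)[of m u] by blast
    qed
    then show ?thesis using mu C unfolding R_def by blast
  qed
  \<comment> \<open>\<open>w\<close> may have elements that are not natural numbers, so instead of
    induction a membership-minimal bad \<open>m\<close> is taken by foundation. If \<open>m\<close>
    is the successor of some \<open>k\<close> in \<open>w\<close>, the union of a bound at
    \<open>k\<close> is a bound at \<open>m\<close>; otherwise only \<open>x\<close> can occur at
    \<open>m\<close>.\<close>
  have small: "\<exists>b\<in>V. \<forall>u\<in>V. R n u \<longrightarrow> E u b" if "n \<in> V" "E n w" for n
  proof (rule ccontr)
    let ?bad = "\<lambda>n. \<not> (\<exists>b\<in>V. \<forall>u\<in>V. R n u \<longrightarrow> E u b)"
    assume "?bad n"
    have "dfn1 ?bad" by (intro rules dfn_R)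
    then obtain B where B: "B \<in> V" "\<And>n. n \<in> V \<Longrightarrow> E n B \<longleftrightarrow> E n w \<and> ?bad n" using w by (rule sep) (rule that)
    then have "\<exists>y\<in>V. E y B" using \<open>?bad n\<close> that by blast
    from foundation[OF B(1) this] obtain m where m: "m \<in> V" "E m B" "\<And>k. k \<in> V \<Longrightarrow> E k m \<Longrightarrow> \<not> E k B"
      by blast
    then have badm: "?bad m" using B(2) by blast
    show False
    proof (cases "\<exists>k\<in>V. E k w \<and> sc k m")
      case True
      then obtain k where k: "k \<in> V" "E k w" "sc k m" by blast
      then have "E k m" by (simp add: sc_def)
      then have "\<not> ?bad k" using m(3) B(2) k by blast
      then obtain b where b: "b \<in> V" "\<forall>u\<in>V. R k u \<longrightarrow> E u b" by blast
      obtain u where u: "u \<in> V" "\<And>z. z \<in> V \<Longrightarrow> E z u \<longleftrightarrow> (\<exists>y\<in>V. E z y \<and> E y b)"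
        using union_ex[OF b(1)] by blast
      have "E v u" if v: "v \<in> V" "R m v" for v
      proof -
        have "m \<noteq> e" using \<open>E k m\<close> e k by blast
        then obtain n z where "n \<in> V" "z \<in> V" "sc n m" "R n z" "E v z" using R_inv[OF m(1) v] by blast
        moreover have "n = k" using sc_inj \<open>sc n m\<close> k \<open>n \<in> V\<close> by blast
        ultimately show ?thesis using b u v by blast
      qed
      then show False using badm u by blast
    next
      case False
      obtain b where "b \<in> V" "\<And>z. z \<in> V \<Longrightarrow> E z b \<longleftrightarrow> z = x \<or> z = x"
        using upair_ex[OF x x] by blast
      then show False using badm R_inv[OF m(1)] False by blast
    qed
  qed
  have exact: "\<exists>b\<in>V. \<forall>u\<in>V. E u b \<longleftrightarrow> R n u" if n: "n \<in> V" "E n w" for n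
  proof -
    obtain b where b: "b \<in> V" "\<forall>u\<in>V. R n u \<longrightarrow> E u b" using small[OF n] by blast
    have "dfn1 (R n)" by (intro dfn_R const var n)
    then obtain b' where "b' \<in> V" "\<And>u. u \<in> V \<Longrightarrow> E u b' \<longleftrightarrow> E u b \<and> R n u" using b(1) by (rule sep) (rule that)
    then show ?thesis using b by blast
  qed
  have "dfn2 (\<lambda>n b. \<forall>u\<in>V. E u b \<longleftrightarrow> R n u)" by (intro rules dfn_R)
  then obtain s where s: "s \<in> V" "\<And>b. b \<in> V \<Longrightarrow> E b s \<longleftrightarrow> (\<exists>n\<in>V. E n w \<and> (\<forall>u\<in>V. E u b \<longleftrightarrow> R n u))"
    using w by (rule repl) (rule set_ext, assumption, assumption, simp, rule that)
  obtain t where t: "t \<in> V" "\<And>z. z \<in> V \<Longrightarrow> E z t \<longleftrightarrow> (\<exists>y\<in>V. E z y \<and> E y s)"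
    using union_ex[OF s(1)] by blast
  have t': "E u t \<longleftrightarrow> (\<exists>n\<in>V. E n w \<and> R n u)" if "u \<in> V" for u
  proof
    assume "E u t"
    then show "\<exists>n\<in>V. E n w \<and> R n u" using t(2)[OF that] s(2) that by blast
  next
    assume "\<exists>n\<in>V. E n w \<and> R n u"
    then obtain n where n: "n \<in> V" "E n w" "R n u" by blast
    then obtain b where "b \<in> V" "\<forall>u\<in>V. E u b \<longleftrightarrow> R n u" using exact by blast
    then show "E u t" using t(2)[OF that] s(2) that n by blast
  qed
  show thesis
  proof (rule that[OF t(1)])
    show "E x t" using t' x R0 e by blast
    fix y z assume "y \<in> V" "z \<in> V" "E z y" "E y t"
    then show "E z t" using t' w_sc Rs by meson
  qed
qed

text \<open>Foundation speaks of sets, so a minimal counterexample is sought inside a transitive set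
  containing \<open>x\<close>.\<close>

lemma E_induct:
  assumes P: "dfn1 P" and step: "\<And>x. x \<in> V \<Longrightarrow> (\<And>y. y \<in> V \<Longrightarrow> E y x \<Longrightarrow> P y) \<Longrightarrow> P x" and x: "x \<in> V"
  shows "P x"
proof (rule ccontr)
  assume "\<not> P x"
  obtain t where t: "t \<in> V" "E x t" "\<And>y z. y \<in> V \<Longrightarrow> z \<in> V \<Longrightarrow> E z y \<Longrightarrow> E y t \<Longrightarrow> E z t"
    using transitive_closure[OF x] by blast
  have "dfn1 (\<lambda>y. \<not> P y)" by (rule dfn_not[OF P])
  then obtain b where b: "b \<in> V" "\<And>y. y \<in> V \<Longrightarrow> E y b \<longleftrightarrow> E y t \<and> \<not> P y" using t(1) by (rule sep) (rule that)
  then have "\<exists>y\<in>V. E y b" using x t \<open>\<not> P x\<close> by blast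
  from foundation[OF b(1) this] show False using b(2) t(3) step by metis
qed

text \<open>The union clause also provides the starting point, since the union of the empty set is
  empty.\<close>

definition lev_closed where
  "lev_closed C \<longleftrightarrow> (\<forall>l\<in>V. \<forall>p\<in>V. In l C \<longrightarrow> (\<forall>z\<in>V. E z p \<longleftrightarrow> sub z l) \<longrightarrow> In p C) \<and>
    (\<forall>s\<in>V. \<forall>u\<in>V. (\<forall>l\<in>V. E l s \<longrightarrow> In l C) \<longrightarrow> (\<forall>z\<in>V. E z u \<longleftrightarrow> (\<exists>y\<in>V. E z y \<and> E y s)) \<longrightarrow> In u C)"

text \<open>The stages of the cumulative hierarchy, obtained without ordinals.\<close>

definition Lev where "Lev l \<longleftrightarrow> (\<forall>C\<in>car T ClsS. lev_closed C \<longrightarrow> In l C)"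

lemma dfn_sub:
  assumes "trm S (c SetS) x" "trm S (c SetS) y" shows "dfn S (\<lambda>e. sub (x e) (y e))"
  by (rule dfn_comp2[where p = sub, OF _ assms], unfold sub_def) (intro rules)

lemma dfn_Lev:
  assumes "trm S (c SetS) l" shows "dfn S (\<lambda>e. Lev (l e))"
  by (rule dfn_comp1[where p = Lev, OF _ assms], unfold Lev_def lev_closed_def) (intro rules dfn_sub)

lemma Lev_power:
  "Lev l \<Longrightarrow> l \<in> V \<Longrightarrow> p \<in> V \<Longrightarrow> (\<And>z. z \<in> V \<Longrightarrow> E z p \<longleftrightarrow> sub z l) \<Longrightarrow> Lev p"
  unfolding Lev_def lev_closed_def by blast

lemma Lev_Union:
  "(\<And>l. l \<in> V \<Longrightarrow> E l s \<Longrightarrow> Lev l) \<Longrightarrow> s \<in> V \<Longrightarrow> u \<in> V \<Longrightarrow>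
    (\<And>z. z \<in> V \<Longrightarrow> E z u \<longleftrightarrow> (\<exists>y\<in>V. E z y \<and> E y s)) \<Longrightarrow> Lev u"
  unfolding Lev_def lev_closed_def by blast

lemma Lev_induct:
  assumes "Lev l" "l \<in> V" and P: "dfn1 P"
    and pow: "\<And>l p. \<lbrakk>l \<in> V; p \<in> V; Lev l; P l; \<And>z. z \<in> V \<Longrightarrow> E z p \<longleftrightarrow> sub z l\<rbrakk> \<Longrightarrow> P p"
    and un: "\<And>s u. \<lbrakk>s \<in> V; u \<in> V; \<And>l. l \<in> V \<Longrightarrow> E l s \<Longrightarrow> Lev l \<and> P l;
      \<And>z. z \<in> V \<Longrightarrow> E z u \<longleftrightarrow> (\<exists>y\<in>V. E z y \<and> E y s)\<rbrakk> \<Longrightarrow> P u"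
  shows "P l"
proof -
  have "dfn1 (\<lambda>l. Lev l \<and> P l)" by (intro rules dfn_Lev P)
  from cls[OF this] obtain C where C: "C \<in> car T ClsS" "\<And>l. l \<in> V \<Longrightarrow> In l C \<longleftrightarrow> Lev l \<and> P l" by blast
  have "lev_closed C" unfolding lev_closed_def
  proof (intro conjI ballI impI)
    fix l p assume *: "l \<in> V" "p \<in> V" "In l C" "\<forall>z\<in>V. E z p \<longleftrightarrow> sub z l"
    then have "Lev l" "P l" using C by auto
    then have "Lev p" "P p" using * Lev_power pow by blast+
    then show "In p C" using C * by blast
  next
    fix s u assume *: "s \<in> V" "u \<in> V" "\<forall>l\<in>V. E l s \<longrightarrow> In l C" "\<forall>z\<in>V. E z u \<longleftrightarrow> (\<exists>y\<in>V. E z y \<and> E y s)"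
    then have s: "\<And>l. l \<in> V \<Longrightarrow> E l s \<Longrightarrow> Lev l \<and> P l" using C by blast
    have "Lev u" by (rule Lev_Union[of s]) (use * s in auto)
    moreover have "P u" by (rule un[of s]) (use * s in auto)
    ultimately show "In u C" using C * by blast
  qed
  then show ?thesis using assms(1,2) C unfolding Lev_def by blast
qed

lemma Lev_trans:
  assumes "Lev l" "l \<in> V" "y \<in> V" "E y l" shows "sub y l"
proof -
  have "\<forall>y\<in>V. E y l \<longrightarrow> sub y l"
  proof (rule Lev_induct[OF assms(1,2)])
    show "dfn1 (\<lambda>l. \<forall>y\<in>V. E y l \<longrightarrow> sub y l)" by (intro rules dfn_sub)
  next
    fix l p assume *: "\<forall>y\<in>V. E y l \<longrightarrow> sub y l" "\<And>z. z \<in> V \<Longrightarrow> E z p \<longleftrightarrow> sub z l"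
    show "\<forall>y\<in>V. E y p \<longrightarrow> sub y p"
    proof (intro ballI impI)
      fix y assume "y \<in> V" "E y p"
      then have "sub y l" using * by blast
      then show "sub y p" using * unfolding sub_def[of y] by blast
    qed
  next
    fix s u assume *: "s \<in> V" "u \<in> V" "\<And>l. l \<in> V \<Longrightarrow> E l s \<Longrightarrow> Lev l \<and> (\<forall>y\<in>V. E y l \<longrightarrow> sub y l)"
      "\<And>z. z \<in> V \<Longrightarrow> E z u \<longleftrightarrow> (\<exists>y\<in>V. E z y \<and> E y s)"
    show "\<forall>y\<in>V. E y u \<longrightarrow> sub y u" using * unfolding sub_def by blast
  qed
  then show ?thesis using assms by blast
qed

lemma sub_refl: "sub x x" and sub_trans: "sub x y \<Longrightarrow> sub y z \<Longrightarrow> sub x z"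
  unfolding sub_def by blast+

lemma sub_antisym: "sub x y \<Longrightarrow> sub y x \<Longrightarrow> x \<in> V \<Longrightarrow> y \<in> V \<Longrightarrow> x = y"
  by (rule set_ext) (auto simp: sub_def)

definition pow_sub where "pow_sub m l \<longleftrightarrow> (\<forall>z\<in>V. sub z m \<longrightarrow> E z l)"

lemma dfn_pow_sub:
  assumes "trm S (c SetS) x" "trm S (c SetS) y" shows "dfn S (\<lambda>e. pow_sub (x e) (y e))"
  by (rule dfn_comp2[where p = pow_sub, OF _ assms], unfold pow_sub_def) (intro rules dfn_sub)

lemma pow_sub_mono: "pow_sub m l \<Longrightarrow> sub l l' \<Longrightarrow> pow_sub m l'"
  unfolding pow_sub_def sub_def[of l] by blast

text \<open>Comparability of stages in a sharp form: \<open>pow_sub m l\<close> says that even the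
  stage following \<open>m\<close> is included in \<open>l\<close>. The induction on
  \<open>l\<close> is for all \<open>m\<close> simultaneously.\<close>

lemma Lev_dichotomy:
  assumes "Lev l" "l \<in> V" "Lev m" "m \<in> V"
  shows "sub l m \<or> pow_sub m l"
proof -
  let ?Q = "\<lambda>l. \<forall>m\<in>V. Lev m \<longrightarrow> sub l m \<or> pow_sub m l"
  have "?Q l"
  proof (rule Lev_induct[OF assms(1,2)])
    show "dfn1 ?Q" by (intro rules dfn_sub dfn_pow_sub dfn_Lev)
  next
    fix l p assume l: "l \<in> V" "p \<in> V" "Lev l" "?Q l" and p: "\<And>z. z \<in> V \<Longrightarrow> E z p \<longleftrightarrow> sub z l"
    have lp: "pow_sub l p" unfolding pow_sub_def using p by blast
    \<comment> \<open>An inner induction on \<open>m\<close> shows that no stage lies strictly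
      between \<open>l\<close> and its power set \<open>p\<close>.\<close>
    have 1: "sub m l \<or> sub p m" if m: "Lev m" "m \<in> V" for m
    proof (rule Lev_induct[OF m])
      show "dfn1 (\<lambda>m. sub m l \<or> sub p m)" by (intro rules dfn_sub const l)
    next
      fix m q assume m: "m \<in> V" "q \<in> V" "Lev m" "sub m l \<or> sub p m" and q: "\<And>z. z \<in> V \<Longrightarrow> E z q \<longleftrightarrow> sub z m"
      have "Lev q" using Lev_power m q by blast
      have "E m q" using q m sub_refl by blast
      then have mq: "sub m q" using Lev_trans[OF \<open>Lev q\<close>] m by blast
      from m(4) show "sub q l \<or> sub p q"
      proof
        assume "sub p m" then show ?thesis using mq sub_trans by blast
      next
        assume ml: "sub m l"
        have "sub l m \<or> pow_sub m l" using l m by blast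
        then show ?thesis
        proof
          assume "sub l m"
          then have "l = m" using ml sub_antisym l m by blast
          then have "sub p q" using p q unfolding sub_def[of p] by blast
          then show ?thesis ..
        next
          assume "pow_sub m l"
          then have "sub q l" using q unfolding pow_sub_def sub_def[of q] by blast
          then show ?thesis ..
        qed
      qed
    next
      fix s u assume *: "s \<in> V" "u \<in> V" "\<And>m. m \<in> V \<Longrightarrow> E m s \<Longrightarrow> Lev m \<and> (sub m l \<or> sub p m)"
        "\<And>z. z \<in> V \<Longrightarrow> E z u \<longleftrightarrow> (\<exists>y\<in>V. E z y \<and> E y s)"
      show "sub u l \<or> sub p u"
      proof (cases "\<exists>m\<in>V. E m s \<and> sub p m")
        case True
        then have "sub p u" using *(4) unfolding sub_def by blast
        then show ?thesis ..
      next
        case False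
        then have "\<And>m. m \<in> V \<Longrightarrow> E m s \<Longrightarrow> sub m l" using *(3) by blast
        then have "sub u l" using *(4) unfolding sub_def by blast
        then show ?thesis ..
      qed
    qed
    show "?Q p"
    proof (intro ballI impI)
      fix m assume "m \<in> V" "Lev m"
      from 1[OF this(2,1)] show "sub p m \<or> pow_sub m p"
        using lp unfolding pow_sub_def using sub_trans by blast
    qed
  next
    fix s u assume *: "s \<in> V" "u \<in> V" "\<And>l. l \<in> V \<Longrightarrow> E l s \<Longrightarrow> Lev l \<and> ?Q l"
      "\<And>z. z \<in> V \<Longrightarrow> E z u \<longleftrightarrow> (\<exists>y\<in>V. E z y \<and> E y s)"
    show "?Q u"
    proof (intro ballI impI)
      fix m assume m: "m \<in> V" "Lev m"
      show "sub u m \<or> pow_sub m u"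
      proof (cases "\<exists>l\<in>V. E l s \<and> pow_sub m l")
        case True
        then obtain l where l: "l \<in> V" "E l s" "pow_sub m l" by blast
        then have "sub l u" using *(4) unfolding sub_def by blast
        then show ?thesis using pow_sub_mono l by blast
      next
        case False
        then have "\<And>l. l \<in> V \<Longrightarrow> E l s \<Longrightarrow> sub l m" using *(3) m by blast
        then have "sub u m" using *(4) unfolding sub_def by blast
        then show ?thesis ..
      qed
    qed
  qed
  then show ?thesis using assms by blast
qed

text \<open>Takes the place of the rank of \<open>y\<close>.\<close>

definition least_lev where
  "least_lev y l \<longleftrightarrow> Lev l \<and> E y l \<and> (\<forall>m\<in>V. Lev m \<longrightarrow> E y m \<longrightarrow> sub l m)"

lemma dfn_least_lev:
  assumes "trm S (c SetS) x" "trm S (c SetS) y" shows "dfn S (\<lambda>e. least_lev (x e) (y e))"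
  by (rule dfn_comp2[where p = least_lev, OF _ assms], unfold least_lev_def) (intro rules dfn_sub dfn_Lev)

lemma least_lev_unique:
  "least_lev y l \<Longrightarrow> least_lev y l' \<Longrightarrow> l \<in> V \<Longrightarrow> l' \<in> V \<Longrightarrow> l = l'"
  unfolding least_lev_def using sub_antisym by blast

text \<open>If a stage containing \<open>y\<close> is not least, the dichotomy provides another
  stage containing \<open>y\<close> that is an element of it, so membership induction on the stage
  applies.\<close>

lemma ex_least_lev_aux:
  assumes y: "y \<in> V" and l: "l \<in> V" "Lev l" "E y l"
  shows "\<exists>l\<in>V. least_lev y l"
proof -
  let ?P = "\<lambda>l. Lev l \<longrightarrow> E y l \<longrightarrow> (\<exists>l\<in>V. least_lev y l)"
  have "?P l"
  proof (rule E_induct[OF _ _ l(1)])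
    show "dfn1 ?P" by (intro rules dfn_Lev dfn_least_lev const y)
    fix l assume l: "l \<in> V" and IH: "\<And>m. m \<in> V \<Longrightarrow> E m l \<Longrightarrow> ?P m"
    show "?P l"
    proof (intro impI)
      assume yl: "Lev l" "E y l"
      show "\<exists>l\<in>V. least_lev y l"
      proof (cases "\<forall>m\<in>V. Lev m \<longrightarrow> E y m \<longrightarrow> sub l m")
        case True
        then show ?thesis using l yl unfolding least_lev_def by blast
      next
        case False
        then obtain m where m: "m \<in> V" "Lev m" "E y m" "\<not> sub l m" by blast
        then have "pow_sub m l" using Lev_dichotomy l yl by blast
        then have "E m l" using m sub_refl unfolding pow_sub_def by blast
        then show ?thesis using IH m by blast
      qed
    qed
  qed
  then show ?thesis using l by blast
qed

text \<open>The least stages of the elements of \<open>x\<close> form a set by replacement. Their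
  union is a stage including \<open>x\<close>, and the power set of this union is a stage with
  \<open>x\<close> as an element.\<close>

lemma ex_least_lev: assumes "x \<in> V" shows "\<exists>l\<in>V. least_lev x l"
proof (rule E_induct[OF _ _ assms])
  show "dfn1 (\<lambda>x. \<exists>l\<in>V. least_lev x l)" by (intro rules dfn_least_lev)
  fix x assume x: "x \<in> V" and IH: "\<And>y. y \<in> V \<Longrightarrow> E y x \<Longrightarrow> \<exists>l\<in>V. least_lev y l"
  have "dfn2 least_lev" by (intro dfn_least_lev var)
  then obtain s where s: "s \<in> V" "\<And>l. l \<in> V \<Longrightarrow> E l s \<longleftrightarrow> (\<exists>y\<in>V. E y x \<and> least_lev y l)"
    using x by (rule repl) (rule least_lev_unique, assumption+, rule that)
  obtain u where u: "u \<in> V" "\<And>z. z \<in> V \<Longrightarrow> E z u \<longleftrightarrow> (\<exists>y\<in>V. E z y \<and> E y s)"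
    using union_ex[OF s(1)] by blast
  obtain p where p: "p \<in> V" "\<And>z. z \<in> V \<Longrightarrow> E z p \<longleftrightarrow> sub z u"
    using power_ex[OF u(1)] by blast
  have "Lev u" by (rule Lev_Union[OF _ s(1) u]) (use s in \<open>auto simp: least_lev_def\<close>)
  then have "Lev p" using Lev_power u(1) p by blast
  moreover have "sub x u" unfolding sub_def
  proof (intro ballI impI)
    fix y assume y: "y \<in> V" "E y x"
    then obtain l where "l \<in> V" "least_lev y l" using IH by blast
    then show "E y u" using y s u unfolding least_lev_def by blast
  qed
  ultimately show "\<exists>l\<in>V. least_lev x l" using ex_least_lev_aux[OF x] p x by blast
qed

text \<open>Let \<open>m\<close> be a stage containing the missing \<open>x\<close>. Since
  \<open>W\<close> is transitive, a stage in \<open>W\<close> cannot have \<open>m\<close> as an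
  element; by the dichotomy it is included in \<open>m\<close>, and so \<open>m\<close> bounds all
  of \<open>W\<close>.\<close>

lemma bounded_if_not_everything:
  assumes W: "dfn1 W" and lev: "\<And>y. y \<in> V \<Longrightarrow> W y \<Longrightarrow> \<exists>l\<in>V. Lev l \<and> E y l \<and> W l"
    and trans: "\<And>x y. x \<in> V \<Longrightarrow> y \<in> V \<Longrightarrow> E y x \<Longrightarrow> W x \<Longrightarrow> W y"
    and x: "x \<in> V" "\<not> W x"
  obtains a where "a \<in> V" "\<And>y. y \<in> V \<Longrightarrow> E y a \<longleftrightarrow> W y"
proof -
  obtain m where m: "m \<in> V" "Lev m" "E x m" using ex_least_lev[OF x(1)] by (auto simp: least_lev_def)
  have "E y m" if y: "y \<in> V" "W y" for y
  proof -
    obtain l where l: "l \<in> V" "Lev l" "E y l" "W l" using lev[OF y] by blast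
    have "\<not> pow_sub m l"
    proof
      assume "pow_sub m l"
      then have "E m l" using m sub_refl unfolding pow_sub_def by blast
      then show False using trans l m x by blast
    qed
    then show ?thesis using Lev_dichotomy[OF l(2,1) m(2,1)] l y unfolding sub_def by blast
  qed
  moreover obtain a where "a \<in> V" "\<And>y. y \<in> V \<Longrightarrow> E y a \<longleftrightarrow> E y m \<and> W y"
    using W m(1) by (rule sep) (rule that)
  ultimately show thesis using that by blast
qed

end

section \<open>Maximal definable partial isomorphisms\<close>

text \<open>Only back-and-forth conditions are assumed; that \<open>j\<close> is single-valued,
  injective and preserves membership follows by induction.\<close>

locale bisimulation = A: dmodel S A a + B: dmodel S B b
  for S :: "'s struct" and A :: "'x struct" and B :: "'y struct" and a b +
  fixes j :: "'x \<Rightarrow> 'y \<Rightarrow> bool"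
  assumes j_dfn: "dfn S (\<lambda>e. j (a SetS (e 0)) (b SetS (e 1)))"
    and j_forth: "\<lbrakk>j x y; x \<in> A.V; y \<in> B.V; u \<in> A.V; A.E u x\<rbrakk> \<Longrightarrow> \<exists>v\<in>B.V. B.E v y \<and> j u v"
    and j_back: "\<lbrakk>j x y; x \<in> A.V; y \<in> B.V; v \<in> B.V; B.E v y\<rbrakk> \<Longrightarrow> \<exists>u\<in>A.V. A.E u x \<and> j u v"
begin

lemma dfn_j:
  assumes "trm S (a SetS) x" "trm S (b SetS) y" shows "dfn S (\<lambda>e. j (x e) (y e))"
  by (rule dfn_comp2[where p = j, OF j_dfn assms])

lemma converse: "bisimulation S B A b a (\<lambda>y x. j x y)"
proof (intro bisimulation.intro bisimulation_axioms.intro)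
  show "dfn S (\<lambda>e. j (a SetS (e 1)) (b SetS (e 0)))"
    by (intro dfn_j A.var B.var)
qed (rule B.dmodel_axioms A.dmodel_axioms j_forth j_back; assumption)+

text \<open>The elements of \<open>y\<close> and of \<open>y'\<close> are matched with the same
  elements of \<open>x\<close>, and the partners of these are unique by induction.\<close>

lemma j_fun:
  assumes "j x y" "j x y'" and V: "x \<in> A.V" "y \<in> B.V" "y' \<in> B.V"
  shows "y = y'"
proof -
  let ?P = "\<lambda>x. \<forall>y\<in>B.V. \<forall>y'\<in>B.V. j x y \<longrightarrow> j x y' \<longrightarrow> y = y'"
  have "?P x"
  proof (rule A.E_induct[OF _ _ V(1)])
    show "dfn S (\<lambda>e. ?P (a SetS (e 0)))" by (intro B.rules A.var dfn_j)
    fix x assume x: "x \<in> A.V" and IH: "\<And>u. u \<in> A.V \<Longrightarrow> A.E u x \<Longrightarrow> ?P u"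
    have *: "B.E v y'" if y: "y \<in> B.V" "y' \<in> B.V" "j x y" "j x y'" and v: "v \<in> B.V" "B.E v y" for y y' v
    proof -
      obtain u where u: "u \<in> A.V" "A.E u x" "j u v" using j_back[OF y(3) x y(1) v] by blast
      obtain v' where "v' \<in> B.V" "B.E v' y'" "j u v'" using j_forth[OF y(4) x y(2) u(1,2)] by blast
      then show ?thesis using IH[OF u(1,2)] u(3) v by blast
    qed
    show "?P x"
    proof (intro ballI impI)
      fix y y' assume y: "y \<in> B.V" "y' \<in> B.V" "j x y" "j x y'"
      show "y = y'" by (rule B.set_ext[OF y(1,2)]) (use *[OF y] *[OF y(2,1,4,3)] in blast)
    qed
  qed
  then show ?thesis using assms by blast
qed

lemma j_inj:
  assumes "j x y" "j x' y" "x \<in> A.V" "x' \<in> A.V" "y \<in> B.V" shows "x = x'"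
  by (rule bisimulation.j_fun[OF converse assms(1,2,5,3,4)])

lemma j_mem:
  assumes "j x y" "j x' y'" and V: "x \<in> A.V" "y \<in> B.V" "x' \<in> A.V" "y' \<in> B.V"
  shows "B.E y y' \<longleftrightarrow> A.E x x'"
proof
  assume "A.E x x'"
  then obtain v where "v \<in> B.V" "B.E v y'" "j x v" using j_forth[OF assms(2) V(3,4,1)] by blast
  then show "B.E y y'" using j_fun[OF assms(1) \<open>j x v\<close>] V by blast
next
  assume "B.E y y'"
  then obtain u where "u \<in> A.V" "A.E u x'" "j u y" using j_back[OF assms(2) V(3,4,2)] by blast
  then show "A.E x x'" using j_inj[OF assms(1) \<open>j u y\<close>] V by blast
qed

end

text \<open>Maximality takes the form of upward closure: a pair whose elements are matched both ways
  is matched itself. Through it, a set construction carried out on both sides extends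
  \<open>j\<close>.\<close>

locale partial_iso = bisimulation +
  assumes j_maximal: "\<lbrakk>x \<in> A.V; y \<in> B.V; \<And>u. u \<in> A.V \<Longrightarrow> A.E u x \<Longrightarrow> \<exists>v\<in>B.V. B.E v y \<and> j u v;
      \<And>v. v \<in> B.V \<Longrightarrow> B.E v y \<Longrightarrow> \<exists>u\<in>A.V. A.E u x \<and> j u v\<rbrakk> \<Longrightarrow> j x y"
begin

lemma flip: "partial_iso S B A b a (\<lambda>y x. j x y)"
  by (intro partial_iso.intro converse partial_iso_axioms.intro) (rule j_maximal)

section \<open>Closure of the domain under set constructions\<close>

definition dom where "dom x \<longleftrightarrow> (\<exists>y\<in>B.V. j x y)"

lemma dfn_dom: assumes "trm S (a SetS) x" shows "dfn S (\<lambda>e. dom (x e))"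
  by (rule dfn_comp1[where p = dom, OF _ assms], unfold dom_def) (intro B.rules A.var dfn_j)

lemma dom_trans: "dom x \<Longrightarrow> x \<in> A.V \<Longrightarrow> u \<in> A.V \<Longrightarrow> A.E u x \<Longrightarrow> dom u"
  unfolding dom_def using j_forth by blast

text \<open>The image of \<open>x'\<close> is separated from \<open>y\<close> in \<open>B\<close>,
  and maximality matches it with \<open>x'\<close>.\<close>

lemma image_subset:
  assumes xy: "x \<in> A.V" "y \<in> B.V" "j x y" and x': "x' \<in> A.V" "A.sub x' x"
  shows "\<exists>y'\<in>B.V. j x' y' \<and> B.sub y' y"
proof -
  have "dfn S (\<lambda>e. \<exists>u\<in>A.V. A.E u x' \<and> j u (b SetS (e 0)))"
    by (intro A.rules B.var dfn_j A.const x')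
  then obtain y' where y': "y' \<in> B.V" "\<And>v. v \<in> B.V \<Longrightarrow> B.E v y' \<longleftrightarrow> B.E v y \<and> (\<exists>u\<in>A.V. A.E u x' \<and> j u v)"
    using xy(2) by (rule B.sep) (rule that)
  have "j x' y'"
  proof (rule j_maximal[OF x'(1) y'(1)])
    fix u assume u: "u \<in> A.V" "A.E u x'"
    then have "A.E u x" using x' by (simp add: A.sub_def)
    then obtain v where "v \<in> B.V" "B.E v y" "j u v" using j_forth[OF xy(3,1,2) u(1)] by blast
    then show "\<exists>v\<in>B.V. B.E v y' \<and> j u v" using y'(2) u by blast
  next
    fix v assume "v \<in> B.V" "B.E v y'"
    then show "\<exists>u\<in>A.V. A.E u x' \<and> j u v" using y'(2) by blast
  qed
  moreover have "B.sub y' y" using y'(2) by (simp add: B.sub_def)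
  ultimately show ?thesis using y'(1) by blast
qed

lemma dom_subset:
  assumes "x \<in> A.V" "dom x" "x' \<in> A.V" "A.sub x' x" shows "dom x'"
  using assms image_subset unfolding dom_def by meson

text \<open>The power set of \<open>x\<close> is matched with the power set of its partner, since
  subsets on either side are matched with subsets on the other.\<close>

lemma dom_power:
  assumes x: "x \<in> A.V" "dom x" and p: "p \<in> A.V" "\<And>z. z \<in> A.V \<Longrightarrow> A.E z p \<longleftrightarrow> A.sub z x"
  shows "dom p"
proof -
  obtain y where y: "y \<in> B.V" "j x y" using x(2) by (auto simp: dom_def)
  obtain q where q: "q \<in> B.V" "\<And>z. z \<in> B.V \<Longrightarrow> B.E z q \<longleftrightarrow> B.sub z y" using B.power_ex[OF y(1)] by blast
  have "j p q"
  proof (rule j_maximal[OF p(1) q(1)])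
    fix u assume "u \<in> A.V" "A.E u p"
    then show "\<exists>v\<in>B.V. B.E v q \<and> j u v"
      using image_subset[OF x(1) y] p(2) q(2) by meson
  next
    fix v assume "v \<in> B.V" "B.E v q"
    then show "\<exists>u\<in>A.V. A.E u p \<and> j u v"
      using partial_iso.image_subset[OF flip y(1) x(1) y(2)] p(2) q(2) by meson
  qed
  then show ?thesis using q(1) by (auto simp: dom_def)
qed

lemma dom_Union:
  assumes x: "x \<in> A.V" "dom x" and p: "p \<in> A.V" "\<And>z. z \<in> A.V \<Longrightarrow> A.E z p \<longleftrightarrow> (\<exists>y\<in>A.V. A.E z y \<and> A.E y x)"
  shows "dom p"
proof -
  obtain y where y: "y \<in> B.V" "j x y" using x(2) by (auto simp: dom_def)
  obtain q where q: "q \<in> B.V" "\<And>z. z \<in> B.V \<Longrightarrow> B.E z q \<longleftrightarrow> (\<exists>w\<in>B.V. B.E z w \<and> B.E w y)"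
    using B.union_ex[OF y(1)] by blast
  have "j p q"
  proof (rule j_maximal[OF p(1) q(1)])
    fix u assume u: "u \<in> A.V" "A.E u p"
    then obtain w where w: "w \<in> A.V" "A.E u w" "A.E w x" using p(2) by blast
    obtain w' where w': "w' \<in> B.V" "B.E w' y" "j w w'" using j_forth[OF y(2) x(1) y(1) w(1,3)] by blast
    obtain v where v: "v \<in> B.V" "B.E v w'" "j u v" using j_forth[OF w'(3) w(1) w'(1) u(1) w(2)] by blast
    then show "\<exists>v\<in>B.V. B.E v q \<and> j u v" using q(2) w' by blast
  next
    fix v assume v: "v \<in> B.V" "B.E v q"
    then obtain w where w: "w \<in> B.V" "B.E v w" "B.E w y" using q(2) by blast
    obtain w' where w': "w' \<in> A.V" "A.E w' x" "j w' w" using j_back[OF y(2) x(1) y(1) w(1,3)] by blast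
    obtain u where u: "u \<in> A.V" "A.E u w'" "j u v" using j_back[OF w'(3) w'(1) w(1) v(1) w(2)] by blast
    then show "\<exists>u\<in>A.V. A.E u p \<and> j u v" using p(2) w' by blast
  qed
  then show ?thesis using q(1) by (auto simp: dom_def)
qed

text \<open>The function \<open>R\<close> is transported along \<open>j\<close> to a definable
  function on the partner of \<open>x\<close>, and replacement in \<open>B\<close> yields the
  partner of \<open>s\<close>.\<close>

lemma dom_replacement:
  assumes x: "x \<in> A.V" "dom x" and R: "dfn S (\<lambda>e. R (a SetS (e 0)) (a SetS (e 1)))"
    and R_fun: "\<And>u h h'. \<lbrakk>u \<in> A.V; h \<in> A.V; h' \<in> A.V; A.E u x; R u h; R u h'\<rbrakk> \<Longrightarrow> h = h'"
    and R_dom: "\<And>u h. \<lbrakk>u \<in> A.V; h \<in> A.V; A.E u x; R u h\<rbrakk> \<Longrightarrow> dom h"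
    and s: "s \<in> A.V" "\<And>h. h \<in> A.V \<Longrightarrow> A.E h s \<longleftrightarrow> (\<exists>u\<in>A.V. A.E u x \<and> R u h)"
  shows "dom s"
proof -
  obtain y where y: "y \<in> B.V" "j x y" using x(2) by (auto simp: dom_def)
  define Q where "Q v z \<longleftrightarrow> (\<exists>u\<in>A.V. \<exists>h\<in>A.V. j u v \<and> A.E u x \<and> R u h \<and> j h z)" for v z
  have "dfn S (\<lambda>e. Q (b SetS (e 0)) (b SetS (e 1)))"
    unfolding Q_def by (intro A.rules B.var dfn_j A.const x dfn_comp2[where p = R, OF R])
  moreover have "z = z'"
    if V: "v \<in> B.V" "z \<in> B.V" "z' \<in> B.V" "B.E v y" "Q v z" "Q v z'" for v z z'
  proof -
    obtain u h where 1: "u \<in> A.V" "h \<in> A.V" "j u v" "A.E u x" "R u h" "j h z"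
      using V(5) unfolding Q_def by blast
    obtain u' h' where 2: "u' \<in> A.V" "h' \<in> A.V" "j u' v" "A.E u' x" "R u' h'" "j h' z'"
      using V(6) unfolding Q_def by blast
    have "u' = u" by (rule j_inj[OF 2(3) 1(3) 2(1) 1(1) V(1)])
    then have "h' = h" using R_fun 1 2 by blast
    then show ?thesis using j_fun[OF 1(6) _ 1(2) V(2,3)] 2(6) by blast
  qed
  ultimately obtain t where t: "t \<in> B.V" "\<And>z. z \<in> B.V \<Longrightarrow> B.E z t \<longleftrightarrow> (\<exists>v\<in>B.V. B.E v y \<and> Q v z)"
    using B.repl[OF _ y(1), of Q] by blast
  have "j s t"
  proof (rule j_maximal[OF s(1) t(1)])
    fix h assume h: "h \<in> A.V" "A.E h s"
    then obtain u where u: "u \<in> A.V" "A.E u x" "R u h" using s(2) by blast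
    obtain v where v: "v \<in> B.V" "B.E v y" "j u v" using j_forth[OF y(2) x(1) y(1) u(1,2)] by blast
    obtain z where z: "z \<in> B.V" "j h z" using R_dom[OF u(1) h(1) u(2,3)] by (auto simp: dom_def)
    have "Q v z" unfolding Q_def using u h v z by blast
    then show "\<exists>z\<in>B.V. B.E z t \<and> j h z" using t(2)[OF z(1)] v z by blast
  next
    fix z assume z: "z \<in> B.V" "B.E z t"
    then obtain v where "Q v z" using t(2) by blast
    then show "\<exists>h\<in>A.V. A.E h s \<and> j h z" unfolding Q_def using s(2) by blast
  qed
  then show ?thesis using t(1) by (auto simp: dom_def)
qed

text \<open>The construction of a stage containing \<open>x\<close> is repeated while every
  intermediate set is kept in the domain. The least stage is a subset of the stage so
  obtained.\<close>

lemma dom_least_lev: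
  assumes "x \<in> A.V" "dom x" shows "\<exists>l\<in>A.V. A.least_lev x l \<and> dom l"
proof -
  let ?P = "\<lambda>x. dom x \<longrightarrow> (\<exists>l\<in>A.V. A.least_lev x l \<and> dom l)"
  have "?P x"
  proof (rule A.E_induct[OF _ _ assms(1)])
    show "dfn S (\<lambda>e. ?P (a SetS (e 0)))" by (intro A.rules dfn_dom A.dfn_least_lev)
    fix x assume x: "x \<in> A.V" and IH: "\<And>u. u \<in> A.V \<Longrightarrow> A.E u x \<Longrightarrow> ?P u"
    show "?P x"
    proof
      assume "dom x"
      have uniq: "l = l'" if "l \<in> A.V" "l' \<in> A.V" "A.least_lev u l" "A.least_lev u l'" for u l l'
        by (rule A.least_lev_unique[OF that(3,4,1,2)])
      have lev: "dfn S (\<lambda>e. A.least_lev (a SetS (e 0)) (a SetS (e 1)))"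
        by (intro A.dfn_least_lev A.var)
      then obtain s where s: "s \<in> A.V" "\<And>l. l \<in> A.V \<Longrightarrow> A.E l s \<longleftrightarrow> (\<exists>u\<in>A.V. A.E u x \<and> A.least_lev u l)"
        using x by (rule A.repl) (rule uniq, assumption+, rule that)
      have "dom s"
      proof (rule dom_replacement[OF x \<open>dom x\<close> lev _ _ s])
        fix u l assume *: "u \<in> A.V" "l \<in> A.V" "A.E u x" "A.least_lev u l"
        then have "dom u" using dom_trans[OF \<open>dom x\<close> x] by simp
        then obtain l' where l': "l' \<in> A.V" "A.least_lev u l'" "dom l'" using IH[OF *(1,3)] by auto
        then show "dom l" using uniq[OF *(2) l'(1) *(4) l'(2)] by simp
      qed (rule uniq)
      obtain u where u: "u \<in> A.V" "\<And>z. z \<in> A.V \<Longrightarrow> A.E z u \<longleftrightarrow> (\<exists>y\<in>A.V. A.E z y \<and> A.E y s)"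
        using A.union_ex[OF s(1)] by blast
      obtain p where p: "p \<in> A.V" "\<And>z. z \<in> A.V \<Longrightarrow> A.E z p \<longleftrightarrow> A.sub z u"
        using A.power_ex[OF u(1)] by blast
      have "dom u" by (rule dom_Union[OF s(1) \<open>dom s\<close> u])
      then have "dom p" by (rule dom_power[OF u(1) _ p])
      have "A.Lev u" by (rule A.Lev_Union[OF _ s(1) u]) (use s in \<open>auto simp: A.least_lev_def\<close>)
      then have "A.Lev p" using A.Lev_power u(1) p by blast
      have "A.sub x u" unfolding A.sub_def
      proof (intro ballI impI)
        fix y assume y: "y \<in> A.V" "A.E y x"
        then obtain l where "l \<in> A.V" "A.least_lev y l" using A.ex_least_lev by blast
        then show "A.E y u" using y s u unfolding A.least_lev_def by blast
      qed
      then have "A.E x p" using p x by blast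
      obtain l where l: "l \<in> A.V" "A.least_lev x l" using A.ex_least_lev x by blast
      then have "A.sub l p" using \<open>A.Lev p\<close> \<open>A.E x p\<close> p(1) unfolding A.least_lev_def by blast
      then have "dom l" using dom_subset[OF p(1) \<open>dom p\<close> l(1)] by blast
      then show "\<exists>l\<in>A.V. A.least_lev x l \<and> dom l" using l by blast
    qed
  qed
  then show ?thesis using assms by blast
qed

text \<open>The domain is transitive and contains a stage around each of its elements, hence it is a
  set as soon as it misses some \<open>x\<close>.\<close>

lemma total_or_set:
  "(\<forall>x\<in>A.V. \<exists>y\<in>B.V. j x y) \<or> (\<exists>d\<in>A.V. \<forall>x\<in>A.V. A.E x d \<longleftrightarrow> (\<exists>y\<in>B.V. j x y))"
proof (cases "\<forall>x\<in>A.V. dom x")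
  case False
  then obtain x where x: "x \<in> A.V" "\<not> dom x" by blast
  have "dfn S (\<lambda>e. dom (a SetS (e 0)))" by (intro dfn_dom A.var)
  moreover have "\<exists>l\<in>A.V. A.Lev l \<and> A.E y l \<and> dom l" if "y \<in> A.V" "dom y" for y
    using dom_least_lev[OF that] unfolding A.least_lev_def by blast
  moreover have "dom v" if "u \<in> A.V" "v \<in> A.V" "A.E v u" "dom u" for u v
    using dom_trans that by blast
  ultimately obtain d where "d \<in> A.V" "\<And>y. y \<in> A.V \<Longrightarrow> A.E y d \<longleftrightarrow> dom y"
    using A.bounded_if_not_everything[of dom, OF _ _ _ x] by blast
  then show ?thesis unfolding dom_def by blast
qed (simp add: dom_def)

text \<open>By maximality \<open>d\<close> and \<open>r\<close> would be matched with each other, so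
  that \<open>d\<close> would be an element of itself.\<close>

lemma not_both_sets:
  assumes d: "d \<in> A.V" "\<forall>x\<in>A.V. A.E x d \<longleftrightarrow> (\<exists>y\<in>B.V. j x y)"
    and r: "r \<in> B.V" "\<forall>y\<in>B.V. B.E y r \<longleftrightarrow> (\<exists>x\<in>A.V. j x y)"
  shows False
proof -
  have "j d r"
  proof (rule j_maximal[OF d(1) r(1)])
    fix u assume u: "u \<in> A.V" "A.E u d"
    then obtain v where "v \<in> B.V" "j u v" using d(2) by blast
    then show "\<exists>v\<in>B.V. B.E v r \<and> j u v" using r(2) u(1) by blast
  next
    fix v assume v: "v \<in> B.V" "B.E v r"
    then obtain u where "u \<in> A.V" "j u v" using r(2) by blast
    then show "\<exists>u\<in>A.V. A.E u d \<and> j u v" using d(2) v(1) by blast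
  qed
  then have "A.E d d" using d r(1) by blast
  then show False using A.no_loop[OF d(1)] by simp
qed

lemma trichotomy:
  obtains (iso) "\<And>x. x \<in> A.V \<Longrightarrow> \<exists>y\<in>B.V. j x y" "\<And>y. y \<in> B.V \<Longrightarrow> \<exists>x\<in>A.V. j x y"
  | (left) r where "\<And>x. x \<in> A.V \<Longrightarrow> \<exists>y\<in>B.V. j x y" "r \<in> B.V"
      "\<And>y. y \<in> B.V \<Longrightarrow> B.E y r \<longleftrightarrow> (\<exists>x\<in>A.V. j x y)"
  | (right) d where "\<And>y. y \<in> B.V \<Longrightarrow> \<exists>x\<in>A.V. j x y" "d \<in> A.V"
      "\<And>x. x \<in> A.V \<Longrightarrow> A.E x d \<longleftrightarrow> (\<exists>y\<in>B.V. j x y)"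
proof -
  note flip_total_or_set = partial_iso.total_or_set[OF flip]
  show thesis
  proof (cases "\<forall>x\<in>A.V. \<exists>y\<in>B.V. j x y")
    case total: True
    show thesis
    proof (cases "\<forall>y\<in>B.V. \<exists>x\<in>A.V. j x y")
      case True
      show thesis by (rule iso) (use total True in blast)+
    next
      case False
      then obtain r where "r \<in> B.V" "\<forall>y\<in>B.V. B.E y r \<longleftrightarrow> (\<exists>x\<in>A.V. j x y)"
        using flip_total_or_set by auto
      then show thesis by (intro left[of r]) (use total in blast)+
    qed
  next
    case False
    then obtain d where d: "d \<in> A.V" "\<forall>x\<in>A.V. A.E x d \<longleftrightarrow> (\<exists>y\<in>B.V. j x y)"
      using total_or_set by auto
    have "\<forall>y\<in>B.V. \<exists>x\<in>A.V. j x y"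
    proof (rule ccontr)
      assume "\<not> ?thesis"
      then obtain r where r: "r \<in> B.V" "\<forall>y\<in>B.V. B.E y r \<longleftrightarrow> (\<exists>x\<in>A.V. j x y)"
        using flip_total_or_set by auto
      show False by (rule not_both_sets[OF d r])
    qed
    then show thesis by (intro right[of d]) (use d in blast)+
  qed
qed

end

section \<open>Collapsing one model onto the other\<close>

lemma trm_own:
  assumes "car S s \<noteq> {}" shows "trm S (\<lambda>x. x) (\<lambda>e. own S s (e i))"
proof -
  define d where "d = (SOME x. x \<in> car S s)"
  have d: "d \<in> car S s" using assms by (simp add: d_def some_in_eq)
  have own: "own S s x = (if x \<in> car S s then x else d)" for x
    by (simp add: own_def tot_def rep_def id_interp_def d_def)
  have "dfn S (\<lambda>e. (e (Suc i) \<in> car S s \<longrightarrow> e 0 = e (Suc i)) \<and> (e (Suc i) \<notin> car S s \<longrightarrow> e 0 = d))"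
    using car_elems[OF d]
    by (intro dfn_logic dfn_eq[OF cov_id] dfn_car trm_id_var trm_const[OF cov_id]) auto
  then have "dfn S (\<lambda>e. e 0 = own S s (e (Suc i)))"
    by (rule dfn_cong) (simp add: own)
  then show ?thesis using car_elems[OF d] by (auto simp: trm_def own envD)
qed

lemma dmodel_own:
  assumes "KM S" shows "dmodel S S (own S)"
proof -
  interpret KM S by (rule assms)
  show ?thesis
    by (intro dmodel.intro dmodel_axioms.intro cover_own sorts_disjoint sorts_nonempty assms class_of_dfn)
qed

locale class_comparison = C: KM_CC_set N + A: dmodel N N "own N" + B: dmodel N K k
  for N :: "'b struct" and K :: "'c struct" and k
begin

lemma dfn_subst_k: "trm N (k SetS) (\<lambda>e. k SetS (own N s (e i)))"
  by (rule trm_comp[OF B.c_cov trm_own[OF C.sorts_nonempty]])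

text \<open>
  A map from sets of \<open>N\<close> to sets of \<open>K\<close> is coded by two classes of \<open>N\<close>.  The section \<open>(F)\<^sub>x\<close> is a
  code of the value at \<open>x\<close>: it is the representing class if \<open>x \<in> G\<close>, and otherwise it has the same
  elements as the representing set.
\<close>

definition val :: "'b \<Rightarrow> 'b \<Rightarrow> 'b \<Rightarrow> 'c \<Rightarrow> bool" where
  "val F G x l \<longleftrightarrow>
    (A.In x G \<and> (\<exists>U\<in>car N ClsS. (\<forall>z\<in>A.V. A.In z U \<longleftrightarrow> pair_in N x z F) \<and> l = k SetS U)) \<or>
    (\<not> A.In x G \<and> (\<exists>u\<in>A.V. (\<forall>z\<in>A.V. A.E z u \<longleftrightarrow> pair_in N x z F) \<and> l = k SetS u))"

lemma dfn_val:
  assumes "trm N (own N ClsS) F" "trm N (own N ClsS) G" "trm N (own N SetS) x" "trm N (k SetS) l"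
  shows "dfn N (\<lambda>e. val (F e) (G e) (x e) (l e))"
  by (rule dfn_comp4[where p = val, OF _ assms], unfold val_def)
    (intro dfn_logic A.bex A.ball A.memb A.var A.dfn_pair_in B.eq[of SetS] B.var dfn_subst_k)

lemma val_fun: assumes "val F G x l" "val F G x l'" shows "l = l'"
proof (cases "A.In x G")
  case True
  then obtain U U' where "U \<in> car N ClsS" "U' \<in> car N ClsS" "l = k SetS U" "l' = k SetS U'"
    "\<forall>z\<in>A.V. A.In z U \<longleftrightarrow> pair_in N x z F" "\<forall>z\<in>A.V. A.In z U' \<longleftrightarrow> pair_in N x z F"
    using assms unfolding val_def by blast
  then show ?thesis using C.class_extensionality[of U U'] by simp
next
  case False
  then obtain U U' where "U \<in> A.V" "U' \<in> A.V" "l = k SetS U" "l' = k SetS U'"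
    "\<forall>z\<in>A.V. A.E z U \<longleftrightarrow> pair_in N x z F" "\<forall>z\<in>A.V. A.E z U' \<longleftrightarrow> pair_in N x z F"
    using assms unfolding val_def by blast
  then show ?thesis using C.set_extensionality[of U U'] by simp
qed

text \<open>The scheme CC chooses classes, while a value may be represented by sets only. So
  \<open>G\<close> marks the arguments whose value has a class representative, and elsewhere a set
  representative is replaced by the class with the same elements. As \<open>P\<close> is
  single-valued on \<open>s\<close>, any choice of representatives codes it.\<close>

lemma choice:
  assumes P: "dfn N (\<lambda>e. P (own N SetS (e 0)) (k SetS (e 1)))" and s: "s \<in> A.V"
    and ex: "\<And>x. x \<in> A.V \<Longrightarrow> A.E x s \<Longrightarrow> \<exists>l\<in>B.V. P x l"
    and fn: "\<And>x l l'. \<lbrakk>x \<in> A.V; A.E x s; l \<in> B.V; l' \<in> B.V; P x l; P x l'\<rbrakk> \<Longrightarrow> l = l'"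
  obtains F G where "F \<in> car N ClsS" "G \<in> car N ClsS"
    "\<And>x l. x \<in> A.V \<Longrightarrow> A.E x s \<Longrightarrow> l \<in> B.V \<Longrightarrow> val F G x l \<longleftrightarrow> P x l"
proof -
  note dfn_P = dfn_comp2[where p = P, OF P]
  have k_in: "k SetS U \<in> B.V" if "U \<in> car N s" for U s
    by (rule B.c_in[OF car_elems[OF that]])
  have "dfn N (\<lambda>e. \<exists>Z\<in>car N ClsS. P (own N SetS (e 0)) (k SetS Z))"
    by (intro A.bex dfn_P A.var dfn_subst_k)
  from A.cls[where P = "\<lambda>x. \<exists>Z\<in>car N ClsS. P x (k SetS Z)", OF this]
  obtain G where G: "G \<in> car N ClsS" "\<And>x. x \<in> A.V \<Longrightarrow> A.In x G \<longleftrightarrow> (\<exists>Z\<in>car N ClsS. P x (k SetS Z))"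
    by blast
  define R where "R x Z \<longleftrightarrow> (A.In x G \<and> P x (k SetS Z)) \<or>
    (\<not> A.In x G \<and> (\<exists>u\<in>A.V. (\<forall>z\<in>A.V. A.E z u \<longleftrightarrow> A.In z Z) \<and> P x (k SetS u)))" for x Z
  have "dfn N (\<lambda>e. R (own N SetS (e 0)) (own N ClsS (e 1)))"
    unfolding R_def
    by (intro dfn_logic A.bex A.ball A.memb A.var dfn_P dfn_subst_k A.const G)
  moreover have "\<exists>Z\<in>car N ClsS. R x Z" if x: "x \<in> A.V" "A.E x s" for x
  proof (cases "A.In x G")
    case True
    then show ?thesis using G(2)[OF x(1)] unfolding R_def by blast
  next
    case False
    obtain l where l: "l \<in> B.V" "P x l" using ex[OF x] by blast
    obtain u where u: "u \<in> elems N" "k SetS u = l" using B.ex_code[OF l(1)] by blast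
    have "u \<notin> car N ClsS" using False G(2)[OF x(1)] l u by blast
    then have uV: "u \<in> A.V" using u(1) elems_eq[of N] by blast
    have "dfn N (\<lambda>e. A.E (own N SetS (e 0)) u)" by (intro A.memb A.var A.const uV)
    from A.cls[where P = "\<lambda>z. A.E z u", OF this] obtain Z
      where "Z \<in> car N ClsS" "\<forall>z\<in>A.V. A.In z Z \<longleftrightarrow> A.E z u" by blast
    then show ?thesis using False uV l(2) u(2) unfolding R_def by blast
  qed
  ultimately obtain F where F: "F \<in> car N ClsS"
    "\<And>x. x \<in> A.V \<Longrightarrow> A.E x s \<Longrightarrow> \<exists>Z. slice N F x Z \<and> R x Z"
    using C.choice_of_dfn[OF _ s, of R] by blast
  have "val F G x l \<longleftrightarrow> P x l" if x: "x \<in> A.V" "A.E x s" and l: "l \<in> B.V" for x l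
  proof -
    obtain Z where Z: "Z \<in> car N ClsS" "\<And>y. y \<in> A.V \<Longrightarrow> A.In y Z \<longleftrightarrow> pair_in N x y F" "R x Z"
      using F(2)[OF x] unfolding slice_def by blast
    have "\<exists>l'\<in>B.V. val F G x l' \<and> P x l'"
    proof (cases "A.In x G")
      case True
      then have "val F G x (k SetS Z)" "P x (k SetS Z)" using Z unfolding val_def R_def by blast+
      then show ?thesis using k_in[OF Z(1)] by blast
    next
      case False
      then obtain u where u: "u \<in> A.V" "\<forall>z\<in>A.V. A.E z u \<longleftrightarrow> A.In z Z" "P x (k SetS u)"
        using Z(3) unfolding R_def by blast
      then have "val F G x (k SetS u)" using Z(2) False unfolding val_def by blast
      then show ?thesis using k_in[OF u(1)] u(3) by blast
    qed
    then obtain l' where l': "l' \<in> B.V" "val F G x l'" "P x l'" by blast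
    show ?thesis
    proof
      assume "val F G x l"
      then show "P x l" using val_fun[OF _ l'(2)] l'(3) by blast
    next
      assume "P x l"
      then have "l = l'" using fn[OF x l l'(1)] l'(3) by blast
      then show "val F G x l" using l'(2) by simp
    qed
  qed
  then show thesis using that F(1) G(1) by blast
qed

text \<open>A solution of the recursion for the Mostowski collapse on a transitive set
  \<open>t\<close>.\<close>

definition approx :: "'b \<Rightarrow> 'b \<Rightarrow> 'b \<Rightarrow> bool" where
  "approx t F G \<longleftrightarrow> (\<forall>x\<in>A.V. \<forall>y\<in>A.V. A.E y x \<longrightarrow> A.E x t \<longrightarrow> A.E y t) \<and>
    (\<forall>x\<in>A.V. A.E x t \<longrightarrow> (\<exists>l\<in>B.V. val F G x l \<and>
      (\<forall>m\<in>B.V. B.E m l \<longleftrightarrow> (\<exists>y\<in>A.V. A.E y x \<and> val F G y m))))"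

text \<open>All approximations are united at once; their compatibility comes out afterwards, from
  the uniqueness of partners in a bisimulation.\<close>

definition collapse :: "'b \<Rightarrow> 'c \<Rightarrow> bool" where
  "collapse x l \<longleftrightarrow> (\<exists>t\<in>A.V. \<exists>F\<in>car N ClsS. \<exists>G\<in>car N ClsS. approx t F G \<and> A.E x t \<and> val F G x l)"

lemma dfn_collapse: "dfn N (\<lambda>e. collapse (own N SetS (e 0)) (k SetS (e 1)))"
  unfolding collapse_def approx_def
  by (intro dfn_logic A.bex A.ball A.memb A.var B.bex B.ball B.memb B.var dfn_val)

lemma approxD:
  assumes "approx t F G" "x \<in> A.V" "A.E x t"
  shows "\<exists>l\<in>B.V. val F G x l" "y \<in> A.V \<Longrightarrow> A.E y x \<Longrightarrow> A.E y t"
    "\<lbrakk>val F G x l; m \<in> B.V\<rbrakk> \<Longrightarrow> B.E m l \<longleftrightarrow> (\<exists>y\<in>A.V. A.E y x \<and> val F G y m)"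
proof -
  from assms obtain l' where l': "l' \<in> B.V" "val F G x l'"
    "\<forall>m\<in>B.V. B.E m l' \<longleftrightarrow> (\<exists>y\<in>A.V. A.E y x \<and> val F G y m)"
    unfolding approx_def by blast
  then show "\<exists>l\<in>B.V. val F G x l" by blast
  show "A.E y t" if "y \<in> A.V" "A.E y x"
    using assms that unfolding approx_def by blast
  show "B.E m l \<longleftrightarrow> (\<exists>y\<in>A.V. A.E y x \<and> val F G y m)" if "val F G x l" "m \<in> B.V"
    using l'(3) val_fun[OF l'(2) that(1)] that(2) by blast
qed

sublocale collapse: bisimulation N N K "own N" k collapse
proof (intro bisimulation.intro bisimulation_axioms.intro)
  show "dfn N (\<lambda>e. collapse (own N SetS (e 0)) (k SetS (e 1)))" by (rule dfn_collapse)
next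
  fix x l y assume "collapse x l" and V: "x \<in> A.V" "l \<in> B.V" "y \<in> A.V" "A.E y x"
  then obtain t F G where ap: "t \<in> A.V" "F \<in> car N ClsS" "G \<in> car N ClsS" "approx t F G" "A.E x t" "val F G x l"
    unfolding collapse_def by blast
  have yt: "A.E y t" by (rule approxD(2)[OF ap(4) V(1) ap(5) V(3,4)])
  then obtain m where m: "m \<in> B.V" "val F G y m" using approxD(1)[OF ap(4) V(3)] by blast
  then have "B.E m l" using approxD(3)[OF ap(4) V(1) ap(5,6)] V by blast
  moreover have "collapse y m" unfolding collapse_def using ap m yt by blast
  ultimately show "\<exists>m\<in>B.V. B.E m l \<and> collapse y m" using m(1) by blast
next
  fix x l m assume "collapse x l" and V: "x \<in> A.V" "l \<in> B.V" "m \<in> B.V" "B.E m l"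
  then obtain t F G where ap: "t \<in> A.V" "F \<in> car N ClsS" "G \<in> car N ClsS" "approx t F G" "A.E x t" "val F G x l"
    unfolding collapse_def by blast
  then obtain y where y: "y \<in> A.V" "A.E y x" "val F G y m"
    using approxD(3)[OF ap(4) V(1) ap(5,6) V(3)] V(4) by blast
  then have "A.E y t" using approxD(2)[OF ap(4) V(1) ap(5)] by blast
  then have "collapse y m" unfolding collapse_def using ap y by blast
  then show "\<exists>y\<in>A.V. A.E y x \<and> collapse y m" using y by blast
qed (rule A.dmodel_axioms B.dmodel_axioms)+

text \<open>An approximation reaching \<open>x\<close> consists of the collapse on part of a
  transitive set, with the pair of \<open>x\<close> and \<open>l\<close> added. Here CC enters: the
  old values come from different approximations, and their representatives have to be coded
  together.\<close>

sublocale collapse: partial_iso N N K "own N" k collapse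
proof
  fix x l assume V: "x \<in> A.V" "l \<in> B.V"
    and zig: "\<And>y. y \<in> A.V \<Longrightarrow> A.E y x \<Longrightarrow> \<exists>m\<in>B.V. B.E m l \<and> collapse y m"
    and zag: "\<And>m. m \<in> B.V \<Longrightarrow> B.E m l \<Longrightarrow> \<exists>y\<in>A.V. A.E y x \<and> collapse y m"
  obtain t0 where t0: "t0 \<in> A.V" "A.E x t0"
    "\<And>y z. y \<in> A.V \<Longrightarrow> z \<in> A.V \<Longrightarrow> A.E z y \<Longrightarrow> A.E y t0 \<Longrightarrow> A.E z t0"
    using A.transitive_closure[OF V(1)] by blast
  \<comment> \<open>\<open>x\<close> may already have a value; \<open>P_fun\<close> below shows that
    \<open>l\<close> does not conflict with it.\<close>
  define P where "P z m \<longleftrightarrow> z = x \<and> m = l \<or> collapse z m" for z m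
  have dfn_P: "dfn N (\<lambda>e. P (own N SetS (e i)) (k SetS (e j)))" for i j
    unfolding P_def
    by (intro dfn_logic A.eq[of SetS] B.eq[of SetS] A.var B.var A.const B.const V collapse.dfn_j)
  have "dfn N (\<lambda>e. \<exists>m\<in>B.V. P (own N SetS (e 0)) m)"
    by (intro B.bex dfn_P)
  then obtain t where t: "t \<in> A.V" "\<And>z. z \<in> A.V \<Longrightarrow> A.E z t \<longleftrightarrow> A.E z t0 \<and> (\<exists>m\<in>B.V. P z m)"
    using t0(1) by (rule A.sep) (rule that)
  have P_forth: "\<exists>n\<in>B.V. B.E n m \<and> collapse y n" if "P z m" "z \<in> A.V" "m \<in> B.V" "y \<in> A.V" "A.E y z" for z m y
    using that zig collapse.j_forth unfolding P_def by blast
  have P_back: "\<exists>y\<in>A.V. A.E y z \<and> collapse y n" if "P z m" "z \<in> A.V" "m \<in> B.V" "n \<in> B.V" "B.E n m" for z m n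
    using that zag collapse.j_back unfolding P_def by blast
  \<comment> \<open>The elements of any \<open>P\<close>-value of \<open>z\<close> are the values of
    the collapse at the elements of \<open>z\<close>, so two \<open>P\<close>-values have the same
    elements.\<close>
  have sub_image: "B.E n m'" if P: "P z m" "P z m'" and zm: "z \<in> A.V" "m \<in> B.V" "m' \<in> B.V" "n \<in> B.V" "B.E n m" for z m m' n
  proof -
    obtain y where y: "y \<in> A.V" "A.E y z" "collapse y n" using P_back[OF P(1) zm(1,2,4,5)] by blast
    obtain n' where n': "n' \<in> B.V" "B.E n' m'" "collapse y n'" using P_forth[OF P(2) zm(1,3) y(1,2)] by blast
    have "n = n'" by (rule collapse.j_fun[OF y(3) n'(3) y(1) zm(4) n'(1)])
    then show ?thesis using n'(2) by simp
  qed
  have P_fun: "m = m'" if P: "P z m" "P z m'" and zm: "z \<in> A.V" "m \<in> B.V" "m' \<in> B.V" for z m m'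
    by (rule B.set_ext[OF zm(2,3)]) (use sub_image[OF P zm] sub_image[OF P(2,1) zm(1,3,2)] in blast)
  obtain F G where FG: "F \<in> car N ClsS" "G \<in> car N ClsS"
    "\<And>z m. z \<in> A.V \<Longrightarrow> A.E z t \<Longrightarrow> m \<in> B.V \<Longrightarrow> val F G z m \<longleftrightarrow> P z m"
  proof (rule choice[OF dfn_P t(1)])
    show "\<exists>m\<in>B.V. P z m" if "z \<in> A.V" "A.E z t" for z using t(2) that by blast
  qed (rule P_fun that; assumption)+
  have t_trans: "A.E y t" if y: "z \<in> A.V" "y \<in> A.V" "A.E y z" "A.E z t" for z y
  proof -
    obtain m where "m \<in> B.V" "P z m" using t(2) y by blast
    then obtain n where "n \<in> B.V" "collapse y n" using P_forth y by blast
    then show ?thesis using t(2)[OF y(2)] t0(3)[OF y(1-3)] t(2)[OF y(1)] y(4) unfolding P_def by blast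
  qed
  have "approx t F G" unfolding approx_def
  proof (intro conjI ballI impI)
    show "A.E y t" if "z \<in> A.V" "y \<in> A.V" "A.E y z" "A.E z t" for z y by (rule t_trans[OF that])
    fix z assume z: "z \<in> A.V" "A.E z t"
    then obtain m where m: "m \<in> B.V" "P z m" using t(2) by blast
    have "B.E n m \<longleftrightarrow> (\<exists>y\<in>A.V. A.E y z \<and> val F G y n)" if n: "n \<in> B.V" for n
    proof
      assume "B.E n m"
      then obtain y where y: "y \<in> A.V" "A.E y z" "collapse y n" using P_back[OF m(2) z(1) m(1) n] by blast
      then have "val F G y n" using FG(3)[OF y(1) t_trans[OF z(1) y(1,2) z(2)] n] by (simp add: P_def)
      then show "\<exists>y\<in>A.V. A.E y z \<and> val F G y n" using y by blast
    next
      assume "\<exists>y\<in>A.V. A.E y z \<and> val F G y n"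
      then obtain y where y: "y \<in> A.V" "A.E y z" "val F G y n" by blast
      then have Pn: "P y n" using FG(3)[OF y(1) t_trans[OF z(1) y(1,2) z(2)] n] by simp
      obtain n' where n': "n' \<in> B.V" "B.E n' m" "collapse y n'" using P_forth[OF m(2) z(1) m(1) y(1,2)] by blast
      have "n = n'" by (rule P_fun[OF Pn _ y(1) n n'(1)]) (simp add: P_def n'(3))
      then show "B.E n m" using n'(2) by simp
    qed
    then show "\<exists>m\<in>B.V. val F G z m \<and> (\<forall>n\<in>B.V. B.E n m \<longleftrightarrow> (\<exists>y\<in>A.V. A.E y z \<and> val F G y n))"
      using m FG(3)[OF z m(1)] by blast
  qed
  moreover have "P x l" by (simp add: P_def)
  moreover have "A.E x t" using t(2)[OF V(1)] t0(2) V(2) \<open>P x l\<close> by blast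
  ultimately show "collapse x l" unfolding collapse_def using t(1) FG V by blast
qed

end

section \<open>Total collapses\<close>

text \<open>A stage with \<open>r\<close> as an element is transitive, hence includes every set
  whose elements lie in \<open>r\<close> or equal \<open>r\<close>; the power set of this stage is
  the bound.\<close>

lemma (in dmodel) subsets_bounded:
  assumes r: "r \<in> V"
  obtains w where "w \<in> V" "\<And>l. l \<in> V \<Longrightarrow> (\<And>m. m \<in> V \<Longrightarrow> E m l \<Longrightarrow> E m r \<or> m = r) \<Longrightarrow> E l w"
proof -
  obtain l\<^sub>0 where l\<^sub>0: "l\<^sub>0 \<in> V" "Lev l\<^sub>0" "E r l\<^sub>0" using ex_least_lev[OF r] by (auto simp: least_lev_def)
  obtain w where w: "w \<in> V" "\<And>z. z \<in> V \<Longrightarrow> E z w \<longleftrightarrow> sub z l\<^sub>0" using power_ex[OF l\<^sub>0(1)] by blast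
  have "sub r l\<^sub>0" using Lev_trans l\<^sub>0 r by blast
  then have "sub l l\<^sub>0" if "l \<in> V" "\<And>m. m \<in> V \<Longrightarrow> E m l \<Longrightarrow> E m r \<or> m = r" for l
    using that l\<^sub>0(3) unfolding sub_def by blast
  then show thesis using that w by blast
qed

locale bounded_bisimulation = bisimulation +
  fixes r
  assumes total: "x \<in> A.V \<Longrightarrow> \<exists>y\<in>B.V. j x y"
    and r: "r \<in> B.V" and r_iff: "y \<in> B.V \<Longrightarrow> B.E y r \<longleftrightarrow> (\<exists>x\<in>A.V. j x y)"
begin

text \<open>
  The sets and classes of \<open>A\<close> are coded by sets of \<open>B\<close>; having \<open>r\<close> as an element marks the codes
  of classes.
\<close>

definition code where
  "code s x n \<longleftrightarrow> (case s of SetS \<Rightarrow> j x n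
    | ClsS \<Rightarrow> \<forall>m\<in>B.V. B.E m n \<longleftrightarrow> m = r \<or> (\<exists>u\<in>A.V. A.In u x \<and> j u m))"

lemma code_simps:
  "code SetS x n \<longleftrightarrow> j x n"
  "code ClsS x n \<longleftrightarrow> (\<forall>m\<in>B.V. B.E m n \<longleftrightarrow> m = r \<or> (\<exists>u\<in>A.V. A.In u x \<and> j u m))"
  by (simp_all add: code_def)

lemma dfn_code:
  assumes "trm S (a s) x" "trm S (b SetS) n" shows "dfn S (\<lambda>e. code s (x e) (n e))"
proof (cases s)
  case SetS
  then show ?thesis using assms by (simp add: code_simps dfn_j)
next
  case ClsS
  then have "dfn S (\<lambda>e. code s (a s (e 0)) (b SetS (e 1)))"
    unfolding ClsS code_simps
    by (intro dfn_logic B.ball B.memb B.eq[of SetS] B.var B.const r A.bex A.memb A.var dfn_j)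
  then show ?thesis by (rule dfn_comp2[where p = "code s", OF _ assms])
qed

lemma r_trans: assumes "B.E n r" "n \<in> B.V" "m \<in> B.V" "B.E m n" shows "B.E m r"
proof -
  obtain x where x: "x \<in> A.V" "j x n" using r_iff assms by blast
  then obtain u where "u \<in> A.V" "j u m" using j_back[OF x(2,1) assms(2-4)] by blast
  then show ?thesis using r_iff assms by blast
qed

text \<open>Every element of a code lies in \<open>r\<close> or equals \<open>r\<close>: a set code
  belongs to the transitive set \<open>r\<close>, and a class code consists of \<open>r\<close> and
  of matched sets.\<close>

lemma code_bound:
  obtains w where "w \<in> B.V" "\<And>s x n. \<lbrakk>x \<in> car A s; n \<in> B.V; code s x n\<rbrakk> \<Longrightarrow> B.E n w"
proof -
  obtain w where w: "w \<in> B.V"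
    "\<And>l. l \<in> B.V \<Longrightarrow> (\<And>m. m \<in> B.V \<Longrightarrow> B.E m l \<Longrightarrow> B.E m r \<or> m = r) \<Longrightarrow> B.E l w"
    using B.subsets_bounded[OF r] by blast
  have "B.E m r \<or> m = r" if "x \<in> car A s" "n \<in> B.V" "code s x n" "m \<in> B.V" "B.E m n" for s x n m
  proof (cases s)
    case SetS
    then have "B.E n r" using that r_iff by (auto simp: code_simps)
    then show ?thesis using r_trans that by blast
  next
    case ClsS
    then show ?thesis using that r_iff by (auto simp: code_simps)
  qed
  then show thesis using that w by meson
qed

lemma code_total: assumes "x \<in> car A s" shows "\<exists>n\<in>B.V. code s x n"
proof (cases s)
  case SetS
  then show ?thesis using assms total by (simp add: code_simps)
next
  case ClsS
  \<comment> \<open>A stage with \<open>r\<close> as an element contains all intended elements of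
    the code, so separation applies.\<close>
  obtain l where l: "l \<in> B.V" "B.Lev l" "B.E r l"
    using B.ex_least_lev[OF r] by (auto simp: B.least_lev_def)
  have "B.sub r l" using B.Lev_trans l r by blast
  have "dfn S (\<lambda>e. b SetS (e 0) = r \<or> (\<exists>u\<in>A.V. A.In u x \<and> j u (b SetS (e 0))))"
    using assms[unfolded ClsS]
    by (intro dfn_logic B.eq[of SetS] B.var B.const r A.bex A.memb A.var A.const dfn_j)
  then obtain n where n: "n \<in> B.V"
    "\<And>m. m \<in> B.V \<Longrightarrow> B.E m n \<longleftrightarrow> B.E m l \<and> (m = r \<or> (\<exists>u\<in>A.V. A.In u x \<and> j u m))"
    using l(1) by (rule B.sep) (rule that)
  have "B.E m l" if m: "m \<in> B.V" "m = r \<or> (\<exists>u\<in>A.V. A.In u x \<and> j u m)" for m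
    using m(2)
  proof
    assume "\<exists>u\<in>A.V. A.In u x \<and> j u m"
    then have "B.E m r" using r_iff[OF m(1)] by blast
    then show ?thesis using \<open>B.sub r l\<close> m(1) by (simp add: B.sub_def)
  qed (simp add: l(3))
  then have "code s x n" unfolding ClsS code_simps using n(2) by blast
  then show ?thesis using n(1) by blast
qed

lemma code_fun:
  assumes "code s x n" "code s x n'" "x \<in> car A s" "n \<in> B.V" "n' \<in> B.V" shows "n = n'"
proof (cases s)
  case SetS
  then show ?thesis using assms j_fun by (simp add: code_simps)
next
  case ClsS
  show ?thesis by (rule B.set_ext[OF assms(4,5)]) (use assms ClsS in \<open>simp add: code_simps\<close>)
qed

text \<open>The marker \<open>r\<close> is not the partner of any set, since it would then be an
  element of itself; the other elements of the code have unique preimages.\<close>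

lemma code_class: assumes "code ClsS X n" "u \<in> A.V" "m \<in> B.V" "j u m" shows "A.In u X \<longleftrightarrow> B.E m n"
proof
  assume "A.In u X" then show "B.E m n" using assms by (auto simp: code_simps)
next
  assume "B.E m n"
  then have "m = r \<or> (\<exists>u\<in>A.V. A.In u X \<and> j u m)" using assms(1,3) by (simp add: code_simps)
  moreover have "m \<noteq> r" using r_iff[OF assms(3)] assms(2,4) B.no_loop[OF r] by blast
  ultimately obtain u' where "u' \<in> A.V" "A.In u' X" "j u' m" by blast
  then show "A.In u X" using j_inj[OF assms(4) \<open>j u' m\<close> assms(2) \<open>u' \<in> A.V\<close> assms(3)] by simp
qed

text \<open>A set code is an element of \<open>r\<close> and a class code has \<open>r\<close> as an
  element, so a common code would produce a membership cycle.\<close>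

lemma code_sort: assumes "code SetS x n" "x \<in> A.V" "n \<in> B.V" shows "\<not> code ClsS X n"
proof
  assume "code ClsS X n"
  then have "B.E r n" using r by (simp add: code_simps)
  moreover have "B.E n r" using r_iff[OF assms(3)] assms(1,2) by (auto simp: code_simps)
  ultimately show False using B.no_cycle[OF r assms(3)] by simp
qed

lemma code_inj:
  assumes c: "code s x n" "code s' x' n" and V: "x \<in> car A s" "x' \<in> car A s'" "n \<in> B.V"
  shows "s = s' \<and> x = x'"
proof -
  have "s = s'" using c V code_sort[of x n x'] code_sort[of x' n x] by (cases s; cases s') simp_all
  moreover have "x = x'"
  proof (cases s)
    case SetS
    then show ?thesis using c V \<open>s = s'\<close> j_inj[of x n x'] by (simp add: code_simps)
  next
    case ClsS
    have "A.In u x \<longleftrightarrow> A.In u x'" if u: "u \<in> A.V" for u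
    proof -
      obtain m where "m \<in> B.V" "j u m" using total[OF u] by blast
      then show ?thesis using code_class[of x n u m] code_class[of x' n u m] c u \<open>s = s'\<close> ClsS by simp
    qed
    then show ?thesis using A.class_extensionality[of x x'] V ClsS \<open>s = s'\<close> by simp
  qed
  ultimately show ?thesis ..
qed

end

section \<open>Isomorphisms from bisimulations total on both sides\<close>

context bisimulation
begin

text \<open>Classes are matched when they agree on matched sets. Partners exist because images and
  preimages of classes are definable over \<open>S\<close>, hence are classes by \<open>cls\<close>
  on each side.\<close>

lemma struct_iso_if_total:
  assumes total: "\<And>x. x \<in> A.V \<Longrightarrow> \<exists>y\<in>B.V. j x y" and onto: "\<And>y. y \<in> B.V \<Longrightarrow> \<exists>x\<in>A.V. j x y"
  obtains F where "struct_iso A B F" "\<And>s. dfn S (\<lambda>e. F s (a s (e 0)) = b s (e 1))"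
proof -
  define R where "R s x y \<longleftrightarrow> (case s of SetS \<Rightarrow> j x y
    | ClsS \<Rightarrow> \<forall>u\<in>A.V. \<forall>v\<in>B.V. j u v \<longrightarrow> (A.In u x \<longleftrightarrow> B.In v y))" for s x y
  have R_simps: "R SetS x y \<longleftrightarrow> j x y"
    "R ClsS x y \<longleftrightarrow> (\<forall>u\<in>A.V. \<forall>v\<in>B.V. j u v \<longrightarrow> (A.In u x \<longleftrightarrow> B.In v y))" for x y
    by (simp_all add: R_def)
  have dfn_R: "dfn S (\<lambda>e. R s (a s (e 0)) (b s (e 1)))" for s
  proof (cases s)
    case SetS
    then show ?thesis by (simp add: R_simps) (intro dfn_j A.var B.var)
  next
    case ClsS
    show ?thesis unfolding ClsS R_simps
      by (intro dfn_logic A.ball B.ball A.memb B.memb A.var B.var dfn_j)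
  qed
  have R_total: "\<exists>y\<in>car B s. R s x y" if x: "x \<in> car A s" for s x
  proof (cases s)
    case SetS
    then show ?thesis using total x by (simp add: R_simps)
  next
    case ClsS
    have "dfn S (\<lambda>e. \<exists>u\<in>A.V. A.In u x \<and> j u (b SetS (e 0)))"
      using x ClsS by (intro A.bex dfn_logic A.memb A.var B.var A.const dfn_j) simp
    from B.cls[where P = "\<lambda>v. \<exists>u\<in>A.V. A.In u x \<and> j u v", OF this]
    obtain y where y: "y \<in> car B ClsS" "\<And>v. v \<in> B.V \<Longrightarrow> B.In v y \<longleftrightarrow> (\<exists>u\<in>A.V. A.In u x \<and> j u v)" by blast
    have "A.In u x \<longleftrightarrow> B.In v y" if "u \<in> A.V" "v \<in> B.V" "j u v" for u v
      using y(2)[OF that(2)] j_inj[OF that(3) _ that(1) _ that(2)] that by blast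
    then show ?thesis using y(1) ClsS by (auto simp: R_simps)
  qed
  have R_onto: "\<exists>x\<in>car A s. R s x y" if y: "y \<in> car B s" for s y
  proof (cases s)
    case SetS
    then show ?thesis using onto y by (simp add: R_simps)
  next
    case ClsS
    have "dfn S (\<lambda>e. \<exists>v\<in>B.V. B.In v y \<and> j (a SetS (e 0)) v)"
      using y ClsS by (intro B.bex dfn_logic B.memb A.var B.var B.const dfn_j) simp
    from A.cls[where P = "\<lambda>u. \<exists>v\<in>B.V. B.In v y \<and> j u v", OF this]
    obtain x where x: "x \<in> car A ClsS" "\<And>u. u \<in> A.V \<Longrightarrow> A.In u x \<longleftrightarrow> (\<exists>v\<in>B.V. B.In v y \<and> j u v)" by blast
    have "A.In u x \<longleftrightarrow> B.In v y" if "u \<in> A.V" "v \<in> B.V" "j u v" for u v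
      using x(2)[OF that(1)] j_fun[OF that(3) _ that(1,2)] that by blast
    then show ?thesis using x(1) ClsS by (auto simp: R_simps)
  qed
  have R_fun: "y = y'" if R: "R s x y" "R s x y'" and car: "x \<in> car A s" "y \<in> car B s" "y' \<in> car B s" for s x y y'
  proof (cases s)
    case SetS
    then show ?thesis using j_fun that by (simp add: R_simps)
  next
    case ClsS
    have "B.In v y \<longleftrightarrow> B.In v y'" if "v \<in> B.V" for v
      using onto[OF that] R that unfolding ClsS R_simps by blast
    then show ?thesis using B.class_extensionality[of y y'] car ClsS by simp
  qed
  have R_inj: "x = x'" if R: "R s x y" "R s x' y" and car: "x \<in> car A s" "x' \<in> car A s" "y \<in> car B s" for s x x' y
  proof (cases s)
    case SetS
    then show ?thesis using j_inj that by (simp add: R_simps)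
  next
    case ClsS
    have "A.In u x \<longleftrightarrow> A.In u x'" if "u \<in> A.V" for u
      using total[OF that] R that unfolding ClsS R_simps by blast
    then show ?thesis using A.class_extensionality[of x x'] car ClsS by simp
  qed
  define F where "F s x = (THE y. y \<in> car B s \<and> R s x y)" for s x
  have F: "F s x \<in> car B s \<and> R s x (F s x)" if "x \<in> car A s" for s x
    unfolding F_def by (rule theI') (use R_total[OF that] R_fun[OF _ _ that] in blast)
  then have F_iff: "F s x = y \<longleftrightarrow> R s x y" if "x \<in> car A s" "y \<in> car B s" for s x y
    using R_fun[OF _ _ that(1)] that by blast
  show thesis
  proof (rule that)
    show "struct_iso A B F" unfolding struct_iso_def
    proof (intro conjI allI ballI)
      fix s
      show "bij_betw (F s) (car A s) (car B s)" unfolding bij_betw_def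
      proof
        show "inj_on (F s) (car A s)"
        proof (rule inj_onI)
          fix x x' assume x: "x \<in> car A s" "x' \<in> car A s" "F s x = F s x'"
          show "x = x'" by (rule R_inj[of s x "F s x"]) (use F[OF x(1)] F[OF x(2)] x in simp_all)
        qed
        show "F s ` car A s = car B s" using F F_iff R_onto by blast
      qed
    next
      fix s x y assume x: "x \<in> A.V" and y: "y \<in> car A s"
      have jx: "j x (F SetS x)" "F SetS x \<in> B.V" using F[of x SetS] x by (simp_all add: R_simps)
      show "mem B s (F SetS x) (F s y) \<longleftrightarrow> mem A s x y"
      proof (cases s)
        case SetS
        have "j y (F SetS y)" "F SetS y \<in> B.V" using F[of y SetS] y SetS by (simp_all add: R_simps)
        then show ?thesis using j_mem[OF jx(1) _ x jx(2), of y "F SetS y"] y SetS by simp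
      next
        case ClsS
        have "R ClsS y (F ClsS y)" using F[of y ClsS] y ClsS by simp
        then show ?thesis unfolding ClsS R_simps using jx x by blast
      qed
    qed
    show "dfn S (\<lambda>e. F s (a s (e 0)) = b s (e 1))" for s
      by (rule dfn_cong[OF dfn_R]) (simp add: F_iff A.c_in[OF envD] B.c_in[OF envD])
  qed
qed

end

section \<open>Solidity\<close>

lemma struct_iso_inv:
  assumes "struct_iso S T F"
  shows "struct_iso T S (\<lambda>s. inv_into (car S s) (F s))"
proof -
  have bij: "bij_betw (F s) (car S s) (car T s)" for s using assms by (simp add: struct_iso_def)
  show ?thesis unfolding struct_iso_def
  proof (intro conjI allI ballI)
    show "bij_betw (inv_into (car S s) (F s)) (car T s) (car S s)" for s
      by (rule bij_betw_inv_into[OF bij])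
    fix s x y assume xy: "x \<in> car T SetS" "y \<in> car T s"
    have F: "F t (inv_into (car S t) (F t) z) = z" "inv_into (car S t) (F t) z \<in> car S t" if "z \<in> car T t" for t z
      using bij_betw_inv_into_right[OF bij that] bij_betw_apply[OF bij_betw_inv_into[OF bij] that] by auto
    have "mem T s (F SetS (inv_into (car S SetS) (F SetS) x)) (F s (inv_into (car S s) (F s) y)) \<longleftrightarrow>
        mem S s (inv_into (car S SetS) (F SetS) x) (inv_into (car S s) (F s) y)"
      using assms F(2) xy unfolding struct_iso_def by blast
    then show "mem S s (inv_into (car S SetS) (F SetS) x) (inv_into (car S s) (F s) y) \<longleftrightarrow> mem T s x y"
      by (simp add: F(1) xy)
  qed
qed

lemma cover_interprets:
  assumes S: "KM S" and T: "KM T" and I: "interprets S I T"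
  shows "cover S T (tot I)"
proof -
  interpret S: KM S by (rule S)
  interpret T: KM T by (rule T)
  note S_dfn = dfn_definable_set[OF S.sorts_disjoint S.sorts_nonempty] dfn_definable_rel[OF S.sorts_disjoint S.sorts_nonempty]
  show ?thesis
    by (rule cover_tot[OF _ T.sorts_disjoint T.sorts_nonempty]; (rule S_dfn)?)
      (use I in \<open>auto simp: interprets_def definable_set_def\<close>)
qed

text \<open>\<open>graph\<close> is stated for every tag \<open>t\<close>, since a set or class of
  \<open>K\<close> may be represented by an element of either sort of \<open>N\<close>.\<close>

locale self_interpretation = M: KM M + K: KM K + MN: cover M N f + NK: cover N K g
  for M :: "'a struct" and N :: "'b struct" and K :: "'c struct" and f g +
  fixes F :: "sort \<Rightarrow> 'a \<Rightarrow> 'c"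
  assumes F: "struct_iso M K F"
    and graph: "dfn M (\<lambda>e. e 0 \<in> car M s \<and> F s (e 0) = g s (f t (e 1)))"
begin

lemma F_bij: "bij_betw (F s) (car M s) (car K s)"
  using F by (simp add: struct_iso_def)

lemma F_in: "x \<in> car M s \<Longrightarrow> F s x \<in> car K s"
  using bij_betw_apply[OF F_bij] .

lemma ex_rep: assumes "y \<in> car K s" obtains t x where "x \<in> elems M" "g s (f t x) = y"
  using NK.ex_code[OF assms] MN.ex_code_elems by blast

text \<open>The value \<open>F s x\<close> lives in \<open>K\<close>; in \<open>M\<close> it is
  named by a quantified representative, which \<open>graph\<close> relates definably to
  \<open>x\<close>.\<close>

lemma pull_iso2:
  assumes R: "dfn N (\<lambda>e. R (g s (e 0)) (own N SetS (e 1)))"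
  shows "dfn M (\<lambda>e. e 0 \<in> car M s \<and> R (F s (e 0)) (f SetS (e 1)))"
proof -
  have 1: "dfn M (\<lambda>e. R (g s (f t (e 0))) (f SetS (e 1)))" for t
    by (rule dfn_cong[OF MN.pull[OF R, of "case_nat t (\<lambda>_. SetS)"]]) (simp add: MN.c_in[OF envD])
  have "dfn M (\<lambda>e. \<exists>t. \<exists>x\<in>elems M. (e 0 \<in> car M s \<and> F s (e 0) = g s (f t x)) \<and> R (g s (f t x)) (f SetS (e 1)))"
    by (intro dfn_ex_sort dfn_bex_elems
        dfn_conj[OF dfn_ren2[where p = "\<lambda>x y. x \<in> car M s \<and> F s x = g s (f t y)" for t, OF graph]
          dfn_ren2[where p = "\<lambda>x y. R (g s (f t x)) (f SetS y)" for t, OF 1]])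
  then show ?thesis
  proof (rule dfn_cong)
    fix e :: "nat \<Rightarrow> 'a"
    show "(\<exists>t. \<exists>x\<in>elems M. (e 0 \<in> car M s \<and> F s (e 0) = g s (f t x)) \<and> R (g s (f t x)) (f SetS (e 1))) \<longleftrightarrow>
      e 0 \<in> car M s \<and> R (F s (e 0)) (f SetS (e 1))" (is "?L \<longleftrightarrow> ?R")
    proof
      assume ?R
      then obtain t x where "x \<in> elems M" "g s (f t x) = F s (e 0)" using F_in by (meson ex_rep)
      then show ?L using \<open>?R\<close> by (intro exI[of _ t] bexI[of _ x]) simp_all
    qed auto
  qed
qed

lemma pull_iso:
  assumes "dfn N (\<lambda>e. P (g s (e 0)))" shows "dfn M (\<lambda>e. e 0 \<in> car M s \<and> P (F s (e 0)))"
  by (rule pull_iso2[where R = "\<lambda>x _. P x", OF assms])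

text \<open>The predicate is pulled back along \<open>F\<close> to \<open>M\<close>, where
  comprehension turns it into a class; the image of this class under \<open>F\<close> is the
  required class of \<open>K\<close>.\<close>

lemma dmodel: "dmodel N K g"
proof (intro dmodel.intro dmodel_axioms.intro NK.cover_axioms K.KM_axioms)
  fix P assume "dfn N (\<lambda>e. P (g SetS (e 0)))"
  from pull_iso[OF this] have "dfn M (\<lambda>e. own M SetS (e 0) \<in> car M SetS \<and> P (F SetS (own M SetS (e 0))))"
    by (rule dfn_comp1[where c = "\<lambda>x. x" and p = "\<lambda>x. x \<in> car M SetS \<and> P (F SetS x)"])
      (rule trm_own[OF M.sorts_nonempty])
  from M.class_of_dfn[where P = "\<lambda>x. x \<in> car M SetS \<and> P (F SetS x)", OF this]
  obtain X where X: "X \<in> car M ClsS" "\<And>x. x \<in> car M SetS \<Longrightarrow> mem M ClsS x X \<longleftrightarrow> P (F SetS x)" by blast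
  have "mem K ClsS y (F ClsS X) \<longleftrightarrow> P y" if y: "y \<in> car K SetS" for y
  proof -
    obtain x where "x \<in> car M SetS" "y = F SetS x" using F_bij[of SetS] y by (auto simp: bij_betw_def)
    then show ?thesis using X F unfolding struct_iso_def by blast
  qed
  then show "\<exists>X\<in>car K ClsS. \<forall>x\<in>car K SetS. mem K ClsS x X \<longleftrightarrow> P x" using F_in[OF X(1)] by blast
qed

text \<open>
  Cantor's diagonal argument: \<open>K\<close> is too large for its sets and classes to be coded by the elements
  of a set \<open>w\<close> of \<open>N\<close>, because \<open>N\<close> contains all \<open>M\<close>-definable sets of codes, and so \<open>M\<close> would
  enumerate them by its own elements.
\<close>

lemma no_coding:
  assumes N: "KM N" and dfn_G: "\<And>s. dfn N (\<lambda>e. G s (g s (e 0)) (own N SetS (e 1)))"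
    and total: "\<And>s y. y \<in> car K s \<Longrightarrow> \<exists>n\<in>car N SetS. G s y n"
    and fn: "\<And>s y n n'. \<lbrakk>G s y n; G s y n'; y \<in> car K s; n \<in> car N SetS; n' \<in> car N SetS\<rbrakk> \<Longrightarrow> n = n'"
    and inj: "\<And>s s' y y' n. \<lbrakk>G s y n; G s' y' n; y \<in> car K s; y' \<in> car K s'; n \<in> car N SetS\<rbrakk> \<Longrightarrow> s = s' \<and> y = y'"
    and w: "w \<in> car N SetS" "\<And>s y n. \<lbrakk>y \<in> car K s; n \<in> car N SetS; G s y n\<rbrakk> \<Longrightarrow> mem N SetS n w"
  shows False
proof -
  interpret A: dmodel N N "own N" by (rule dmodel_own[OF N])
  \<comment> \<open>The diagonal: \<open>x\<close> is read through \<open>f\<close> as a set of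
    \<open>N\<close> and tested against the code of its own image \<open>F s x\<close>.\<close>
  define Z where "Z s x \<longleftrightarrow> x \<in> car M s \<and> (\<exists>n\<in>A.V. G s (F s x) n \<and> \<not> A.E n (f SetS x))" for s x
  have dfn_FG: "dfn M (\<lambda>e. x e \<in> car M s \<and> G s (F s (x e)) (n e))"
    if "trm M (\<lambda>x. x) x" "trm M (f SetS) n" for x n s
    by (rule dfn_comp2[where p = "\<lambda>x n. x \<in> car M s \<and> G s (F s x) n", OF pull_iso2[OF dfn_G] that])
  have "dfn M (\<lambda>e. \<exists>n\<in>A.V. (e 0 \<in> car M s \<and> G s (F s (e 0)) n) \<and> \<not> A.E n (f SetS (e 0)))" for s
    by (intro MN.bex dfn_logic(2,3) dfn_FG trm_id_var MN.memb MN.var)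
  then have dfn_Z: "dfn M (\<lambda>e. Z s (e 0))" for s
    by (rule dfn_cong) (auto simp: Z_def)
  \<comment> \<open>Reading elements of \<open>K\<close> back in \<open>M\<close> along the inverse
    of \<open>F\<close> makes the predicate \<open>Z\<close> definable over \<open>K\<close>, and
    therefore over \<open>N\<close>.\<close>
  define h where "h = tot (iso_interp K (\<lambda>s. inv_into (car M s) (F s)))"
  interpret KM: cover K M h
    unfolding h_def by (rule cover_struct_iso[OF K.sorts_nonempty struct_iso_inv[OF F] M.sorts_disjoint])
  have h: "h s (F s x) = x" if "x \<in> car M s" for s x
    using that F_in[OF that] bij_betw_inv_into_left[OF F_bij that]
    by (simp add: h_def tot_iso_interp)
  have "dfn N (\<lambda>e. Z s (h s (g s (e 0))))" for s
    by (rule NK.pull[OF KM.pull[OF dfn_Z]])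
  then have "dfn N (\<lambda>e. \<exists>s. \<exists>y\<in>car K s. Z s (h s y) \<and> G s y (own N SetS (e 0)))"
    by (intro dfn_ex_sort NK.bex dfn_conj dfn_ren2[where p = "\<lambda>y n. G s (g s y) (own N SetS n)" for s, OF dfn_G])
  \<comment> \<open>The codes of the elements satisfying \<open>Z\<close> form a set of
    \<open>N\<close> by separation from \<open>w\<close>. It has a representative \<open>x\<close>
    in \<open>M\<close>, and \<open>x\<close> contradicts itself.\<close>
  then obtain v where v: "v \<in> A.V" "\<And>n. n \<in> A.V \<Longrightarrow> A.E n v \<longleftrightarrow> A.E n w \<and> (\<exists>s. \<exists>y\<in>car K s. Z s (h s y) \<and> G s y n)"
    using w(1) by (rule A.sep) (rule that)
  obtain x where x: "x \<in> elems M" "f SetS x = v" using MN.ex_code[OF v(1)] by blast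
  then obtain s where s: "x \<in> car M s" by (auto simp: elems_def)
  obtain n where n: "n \<in> A.V" "G s (F s x) n" using total[OF F_in[OF s]] by blast
  have "A.E n v \<longleftrightarrow> Z s x"
  proof
    assume "Z s x"
    then show "A.E n v" using v(2)[OF n(1)] w(2)[OF F_in[OF s] n] F_in[OF s] h[OF s] n(2) by metis
  next
    assume "A.E n v"
    then obtain t y where y: "y \<in> car K t" "Z t (h t y)" "G t y n" using v(2)[OF n(1)] by blast
    then have "t = s \<and> y = F s x" using inj[OF y(3) n(2) y(1) F_in[OF s] n(1)] by simp
    then show "Z s x" using y(2) h[OF s] by simp
  qed
  moreover have "Z s x \<longleftrightarrow> \<not> A.E n v"
  proof
    assume "Z s x"
    then obtain n' where "n' \<in> A.V" "G s (F s x) n'" "\<not> A.E n' v" unfolding Z_def x(2) by blast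
    then show "\<not> A.E n v" using fn[OF n(2) _ F_in[OF s] n(1)] by blast
  next
    assume "\<not> A.E n v"
    then show "Z s x" unfolding Z_def x(2) using n s by blast
  qed
  ultimately show False by blast
qed

end

text \<open>Cantor's argument for the opposite direction: every set of \<open>T\<close> has a
  representative in \<open>S\<close>, while all elements of \<open>S\<close> are coded inside
  \<open>w\<close>. The set of codes of those \<open>y\<close> whose code is not in the set
  represented by \<open>y\<close> can have no representative.\<close>

lemma (in dmodel) no_coding:
  assumes dfn_G: "\<And>s. dfn S (\<lambda>e. G s (own S s (e 0)) (c SetS (e 1)))" and S: "\<And>s. car S s \<noteq> {}"
    and total: "\<And>s y. y \<in> car S s \<Longrightarrow> \<exists>n\<in>V. G s y n"
    and fn: "\<And>s y n n'. \<lbrakk>G s y n; G s y n'; y \<in> car S s; n \<in> V; n' \<in> V\<rbrakk> \<Longrightarrow> n = n'"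
    and inj: "\<And>s s' y y' n. \<lbrakk>G s y n; G s' y' n; y \<in> car S s; y' \<in> car S s'; n \<in> V\<rbrakk> \<Longrightarrow> s = s' \<and> y = y'"
    and w: "w \<in> V" "\<And>s y n. \<lbrakk>y \<in> car S s; n \<in> V; G s y n\<rbrakk> \<Longrightarrow> E n w"
  shows False
proof -
  have "dfn S (\<lambda>e. \<exists>s. \<exists>y\<in>elems S. y \<in> car S s \<and> G s (own S s y) (c SetS (e 0)) \<and> \<not> E (c SetS (e 0)) (c SetS y))"
    by (intro dfn_ex_sort dfn_bex_elems dfn_logic(2,3) dfn_var_car memb var
        dfn_ren2[where p = "\<lambda>y n. G s (own S s y) (c SetS n)" for s, OF dfn_G])
  then obtain v where v: "v \<in> V" "\<And>n. n \<in> V \<Longrightarrow> E n v \<longleftrightarrow> E n w \<and>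
      (\<exists>s. \<exists>y\<in>elems S. y \<in> car S s \<and> G s (own S s y) n \<and> \<not> E n (c SetS y))"
    using w(1) sep[where P = "\<lambda>n. \<exists>s. \<exists>y\<in>elems S. y \<in> car S s \<and> G s (own S s y) n \<and> \<not> E n (c SetS y)"] by blast
  obtain x where x: "x \<in> elems S" "c SetS x = v" using ex_code[OF v(1)] by blast
  then obtain s where s: "x \<in> car S s" by (auto simp: elems_def)
  obtain n where n: "n \<in> V" "G s x n" using total[OF s] by blast
  have "E n v \<longleftrightarrow> \<not> E n v"
  proof
    assume "E n v"
    then obtain t y where y: "y \<in> car S t" "G t y n" "\<not> E n (c SetS y)" using v(2)[OF n(1)] by auto
    then have "t = s \<and> y = x" using inj[OF y(2) n(2) y(1) s n(1)] by simp
    then show "\<not> E n v" using y(3) x(2) by simp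
  next
    assume "\<not> E n v"
    then show "E n v" using v(2)[OF n(1)] w(2)[OF s n] x s n(2) by (metis own_id)
  qed
  then show False by blast
qed

theorem theorem2p7:
  fixes MA :: "'a struct" and NB :: "'b struct" and MA' :: "'c struct"
    and I :: "('a, 'b) interp" and J :: "('b, 'c) interp"
    and i0 :: "sort \<Rightarrow> ('a \<times> (sort \<times> 'a)) set"
  assumes "KM_CC_set MA" and "KM_CC_set NB" and "KM_CC_set MA'"
    and "interprets MA I NB" and "interprets NB J MA'"
    and "definable_iso_comp MA (id_interp MA) MA (comp_interp I J) MA' i0"
  shows "\<exists>j. definable_iso NB (id_interp NB) NB J MA' j"
proof -
  interpret M: KM_CC_set MA by fact
  interpret N: KM_CC_set NB by fact
  interpret K: KM_CC_set MA' by fact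
  interpret MN: cover MA NB "tot I" by (rule cover_interprets[OF M.KM_axioms N.KM_axioms assms(4)])
  interpret NK: cover NB MA' "tot J" by (rule cover_interprets[OF N.KM_axioms K.KM_axioms assms(5)])
  have iso: "iso_rel (id_interp MA) MA (comp_interp I J) MA' i0"
    and i0_dfn: "\<And>s t. definable_rel MA {(x, y). (x, (t, y)) \<in> i0 s}"
    using assms(6) by (simp_all add: definable_iso_comp_def)
  have i0: "\<And>s. Domain (i0 s) = car MA s" "\<And>s. Range (i0 s) = comp_dmn I J s"
    using iso by (simp_all add: iso_rel_def id_interp_def comp_interp_def)
  obtain F where F: "struct_iso MA MA' F"
    and "\<forall>s. \<forall>x\<in>dmn (id_interp MA) s. \<forall>p\<in>dmn (comp_interp I J) s.
      F s (coord (id_interp MA) s x) = coord (comp_interp I J) s p \<longleftrightarrow> (x, p) \<in> i0 s"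
    using iso unfolding iso_rel_def by blast
  then have F_i0: "F s x = coord J s (coord I (fst p) (snd p)) \<longleftrightarrow> (x, p) \<in> i0 s"
    if "x \<in> car MA s" "p \<in> comp_dmn I J s" for s x p
    using that by (simp add: id_interp_def comp_interp_def)
  \<comment> \<open>\<open>i0\<close> relates \<open>x\<close> only to elements of the composite
    domain, whereas \<open>e 1\<close> is arbitrary. It is therefore compared, through the total
    maps, with some representative related to \<open>x\<close> by \<open>i0\<close>.\<close>
  have graph: "dfn MA (\<lambda>e. e 0 \<in> car MA s \<and> F s (e 0) = tot J s (tot I t (e 1)))" for s t
  proof -
    have 1: "dfn MA (\<lambda>e. (e 0, (t', e 1)) \<in> i0 s)" for t'
      using dfn_definable_rel[OF M.sorts_disjoint M.sorts_nonempty i0_dfn] by simp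
    have 2: "dfn MA (\<lambda>e. tot J s (tot I t' (e 0)) = tot J s (tot I t (e 1)))" for t'
      using MN.pull[OF NK.c_cov[unfolded cov_def], where \<tau> = "case_nat t' (\<lambda>_. t)"] by simp
    have "dfn MA (\<lambda>e. \<exists>t'. \<exists>y\<in>elems MA. (e 0, (t', y)) \<in> i0 s \<and> tot J s (tot I t' y) = tot J s (tot I t (e 1)))"
      by (intro dfn_ex_sort dfn_bex_elems dfn_conj[OF dfn_ren2[where p = "\<lambda>x y. (x, (t', y)) \<in> i0 s" for t', OF 1]
            dfn_ren2[where p = "\<lambda>x y. tot J s (tot I t' x) = tot J s (tot I t y)" for t', OF 2]])
    moreover have i0D: "x \<in> car MA s \<and> y \<in> elems MA \<and> F s x = tot J s (tot I t' y)" if xy: "(x, (t', y)) \<in> i0 s" for x t' y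
    proof -
      have "x \<in> car MA s" "(t', y) \<in> comp_dmn I J s"
        unfolding i0[symmetric] using xy by blast+
      moreover from this have "y \<in> dmn I t'" "coord I t' y \<in> dmn J s" by (auto simp: comp_dmn_def)
      moreover have "dmn I t' \<subseteq> elems MA" using assms(4) by (simp add: interprets_def definable_set_def)
      ultimately show ?thesis using F_i0 xy by (auto simp: tot_def rep_def)
    qed
    ultimately show ?thesis
    proof (elim dfn_cong)
      fix e :: "nat \<Rightarrow> 'a"
      show "(\<exists>t'. \<exists>y\<in>elems MA. (e 0, (t', y)) \<in> i0 s \<and> tot J s (tot I t' y) = tot J s (tot I t (e 1))) \<longleftrightarrow>
        e 0 \<in> car MA s \<and> F s (e 0) = tot J s (tot I t (e 1))" (is "?L \<longleftrightarrow> ?R")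
      proof
        assume ?L
        then obtain t' y where "(e 0, (t', y)) \<in> i0 s" "tot J s (tot I t' y) = tot J s (tot I t (e 1))" by blast
        then show ?R using i0D by metis
      next
        assume ?R
        then obtain t' y where "(e 0, (t', y)) \<in> i0 s" using i0(1)[of s] by (metis DomainE surj_pair)
        then show ?L using i0D \<open>?R\<close> by metis
      qed
    qed
  qed
  interpret self_interpretation MA NB MA' "tot I" "tot J" F
    by unfold_locales (rule F, rule graph)
  interpret class_comparison NB MA' "tot J"
    by (intro class_comparison.intro N.KM_CC_set_axioms dmodel_own N.KM_axioms dmodel)
  obtain G where G: "struct_iso NB MA' G" "\<And>s. dfn NB (\<lambda>e. G s (own NB s (e 0)) = tot J s (e 1))"
  proof (cases rule: collapse.trichotomy)
    case iso
    then show thesis using collapse.struct_iso_if_total that by blast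
  next
    case (left r)
    \<comment> \<open>All of \<open>NB\<close> would be coded inside a set of
      \<open>MA'\<close>.\<close>
    interpret bounded_bisimulation NB NB MA' "own NB" "tot J" collapse r
      by unfold_locales (use left in blast)+
    obtain w where "w \<in> car MA' SetS" "\<And>s x n. \<lbrakk>x \<in> car NB s; n \<in> car MA' SetS; code s x n\<rbrakk> \<Longrightarrow> mem MA' SetS n w"
      by (rule code_bound) (rule that)
    then have False
      by (intro B.no_coding[of code w] dfn_code A.var NK.var N.sorts_nonempty code_total code_fun code_inj)
    then show thesis ..
  next
    case (right d)
    \<comment> \<open>With the two sides exchanged, all of \<open>MA'\<close> would be coded inside
      a set of \<open>NB\<close>.\<close>
    interpret bounded_bisimulation NB MA' NB "tot J" "own NB" "\<lambda>y x. collapse x y" d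
      by (intro bounded_bisimulation.intro collapse.converse bounded_bisimulation_axioms.intro) (use right in blast)+
    obtain w where "w \<in> car NB SetS" "\<And>s x n. \<lbrakk>x \<in> car MA' s; n \<in> car NB SetS; code s x n\<rbrakk> \<Longrightarrow> mem NB SetS n w"
      by (rule code_bound) (rule that)
    then have False
      by (intro no_coding[of code w] N.KM_axioms dfn_code A.var NK.var code_total code_fun code_inj)
    then show thesis ..
  qed
  have dJ: "dmn J s \<subseteq> elems NB" "dfn NB (\<lambda>e. e 0 \<in> dmn J s)" for s
    using assms(5) dfn_definable_set[OF N.sorts_disjoint N.sorts_nonempty]
    by (auto simp: interprets_def definable_set_def)
  have presents: "presents J MA'" using assms(5) by (simp add: interprets_def)
  \<comment> \<open>\<open>G\<close> is lifted to all representatives in the domain of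
    \<open>J\<close>, which makes the relation invariant under the interpreted equality.\<close>
  define j where "j s = {(x, y). x \<in> car NB s \<and> y \<in> dmn J s \<and> G s x = coord J s y}" for s
  have G_im: "G s ` car NB s = car MA' s" for s using G(1) by (auto simp: struct_iso_def bij_betw_def)
  have J_im: "coord J s ` dmn J s = car MA' s" for s using presents by (simp add: presents_def)
  have J_eqv: "y \<in> dmn J s \<and> y' \<in> dmn J s \<and> coord J s y = coord J s y'" if "(y, y') \<in> eqv J s" for s y y'
  proof -
    have "equiv (dmn J s) (eqv J s)" using presents by (simp add: presents_def)
    then have "y \<in> dmn J s" "y' \<in> dmn J s" using that by (auto simp: equiv_class_eq_iff)
    then show ?thesis using presents that by (simp add: presents_def)
  qed
  have "iso_rel (id_interp NB) NB J MA' j" unfolding iso_rel_def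
  proof (intro conjI allI impI exI[of _ G])
    fix s
    have "\<exists>y\<in>dmn J s. G s x = coord J s y" if "x \<in> car NB s" for x
      using that G_im[of s] unfolding J_im[of s, symmetric] by blast
    then show "Domain (j s) = dmn (id_interp NB) s" by (auto simp: j_def id_interp_def)
    have "\<exists>x\<in>car NB s. G s x = coord J s y" if "y \<in> dmn J s" for y
    proof -
      have "coord J s y \<in> G s ` car NB s" unfolding G_im J_im[symmetric] using that by blast
      then show ?thesis by auto
    qed
    then show "Range (j s) = dmn J s" by (auto simp: j_def)
  next
    fix s x0 x1 y0 y1
    assume "(x0, x1) \<in> j s" "(y0, x0) \<in> eqv (id_interp NB) s" "(y1, x1) \<in> eqv J s"
    then show "(y0, y1) \<in> j s" using J_eqv[of y1 x1 s] by (auto simp: j_def id_interp_def)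
  qed (use G(1) in \<open>auto simp: j_def id_interp_def\<close>)
  moreover have "definable_rel NB (j s)" for s
  proof (rule definable_rel_dfn[OF N.sorts_disjoint N.sorts_nonempty])
    show "j s \<subseteq> elems NB \<times> elems NB" using dJ(1) car_elems by (auto simp: j_def)
    have "dfn NB (\<lambda>e. e 0 \<in> car NB s \<and> e 1 \<in> dmn J s \<and> G s (own NB s (e 0)) = tot J s (e 1))"
      by (intro dfn_conj dfn_var_car G(2) dfn_ren1[where p = "\<lambda>x. x \<in> dmn J s", OF dJ(2)])
    then show "dfn NB (\<lambda>e. (e 0, e 1) \<in> j s)"
      by (rule dfn_cong) (auto simp: j_def tot_def rep_def)
  qed
  ultimately show ?thesis unfolding definable_iso_def by blast
qed

end
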